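(* a) The only germs of 2-dimensional massive F-manifolds are, up to isomorphism, the germs $I_2(m)$, $m\in\mathbb N_{\ge2}$, defined as follows: the multiplication on $(M,p)=(\mathbb C^2,0)$ with coordinates $t_1,t_2$ and $\delta_i:=\frac{\partial}{\partial t_i}$ is given by $e:=\delta_1$ and $\delta_2\circ\delta_2=t_2^{m-2}\cdot\delta_1$. An Euler field of weight $1$ is $E=t_1\delta_1+\frac2m t_2\delta_2$. Its discriminant is $\mathcal D=\{t\mid t_1^2-\frac4{m^2}t_2^m=0\}$. $I_2(m)$ is irreducible for $m\ge3$, with caustic and bifurcation diagram $\mathcal K=\mathcal B=\{t\mid t_2=0\}$. The space of Euler fields of weight $d$ is $d\cdot E+\mathbb C\cdot e$ for $m\ge3$. b) The only germ of a 2-dimensional F-manifold which is not massive is, up to isomorphism, the germ $(\mathbb C^2,0)$ with multiplication given by $e:=\delta_1$ and $\delta_2\circ\delta_2=0$. Its caustic is empty. An Euler field of weight $1$ is $E=t_1\delta_1$. The space of all Euler fields of weight $0$ is $\{\varepsilon_1\delta_1+\varepsilon_2(t_2)\delta_2\mid\varepsilon_1\in\mathbb C,\ \varepsilon_2(t_2)\in\mathbb C\{t_2\}\}$.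
   Context: An F-manifold is a triple $(M,\circ,e)$ with $M$ a connected complex manifold of dimension $n\ge1$, $\circ$ a commutative, associative $\mathcal O_M$-bilinear multiplication on the tangent sheaf $\mathcal T_M$, and $e$ a global unit field, such that $\mathrm{Lie}_{X\circ Y}(\circ)=X\circ \mathrm{Lie}_Y(\circ)+Y\circ\mathrm{Lie}_X(\circ)$ for all local vector fields $X,Y$, where $\mathrm{Lie}_X(\circ)(Z,W)=[X,Z\circ W]-[X,Z]\circ W-Z\circ[X,W]$. An Euler field of weight $d$ is a vector field $E$ with $\mathrm{Lie}_E(\circ)=d\cdot\circ$. The F-manifold is massive if $T_pM$ is a semisimple algebra ($\cong\mathbb C^n$) for generic $p$. Each algebra $T_pM$ decomposes uniquely into a direct sum of local algebras; the caustic $\mathcal K$ is the set of points $p$ where the partition of $n$ given by the dimensions of these local algebras differs from the generic one (for massive $M$: where $T_pM$ is not semisimple). A germ $(M,p)$ is irreducible if it is not a product of germs of F-manifolds of positive dimension (equivalently, $T_pM$ is a local algebra). For an Euler field $E$ of weight 1 on a massive F-manifold, the discriminant is $\mathcal D=\{t\mid\det(E\circ)(t)=0\}$ and the bifurcation diagram $\mathcal B$ is the set of points $t$ where $E\circ:T_tM\to T_tM$ has fewer than $n$ different eigenvalues. *)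

theory Defs
  imports "HOL-Analysis.Analysis" "HOL-Library.Multiset"
begin

text \<open>
  All notions below are local, so F-manifolds are taken in a chart: the underlying manifold is a
  connected open subset of \<open>complex ^ 'n\<close>, and its tangent spaces are all identified with
  \<open>complex ^ 'n\<close> by means of the coordinate vector fields.
\<close>

subsection \<open>Holomorphic maps and vector fields\<close>

text \<open>Holomorphic in several variables: the (real) derivative exists and is \<open>\<complex>\<close>-linear.\<close>

definition holo_on :: "(complex ^ 'n \<Rightarrow> complex ^ 'm) \<Rightarrow> (complex ^ 'n) set \<Rightarrow> bool" where
  "holo_on f U \<longleftrightarrow> open U \<and>
     (\<forall>t\<in>U. \<exists>D. (f has_derivative D) (at t) \<and> Vector_Spaces.linear (*s) (*s) D)"

abbreviation jac ::
    "(complex ^ 'n \<Rightarrow> complex ^ 'm) \<Rightarrow> complex ^ 'n \<Rightarrow> complex ^ 'n \<Rightarrow> complex ^ 'm" where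
  "jac f t \<equiv> frechet_derivative f (at t)"

definition lie_bracket ::
    "(complex ^ 'n \<Rightarrow> complex ^ 'n) \<Rightarrow> (complex ^ 'n \<Rightarrow> complex ^ 'n) \<Rightarrow> complex ^ 'n \<Rightarrow> complex ^ 'n" where
  "lie_bracket X Y t = jac Y t (X t) - jac X t (Y t)"

subsection \<open>F-manifolds and Euler fields\<close>

text \<open>
  An \<open>\<O>\<close>-bilinear multiplication on the tangent sheaf is the same as a family of bilinear
  multiplications \<open>fmul M t\<close> on the tangent spaces that depends holomorphically on \<open>t\<close>.
\<close>

record 'n fmanifold =
  base :: "(complex ^ 'n) set"
  fmul :: "complex ^ 'n \<Rightarrow> complex ^ 'n \<Rightarrow> complex ^ 'n \<Rightarrow> complex ^ 'n"
  funit :: "complex ^ 'n \<Rightarrow> complex ^ 'n"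

definition field_mul :: "('n::finite) fmanifold \<Rightarrow> (complex ^ 'n \<Rightarrow> complex ^ 'n) \<Rightarrow>
    (complex ^ 'n \<Rightarrow> complex ^ 'n) \<Rightarrow> complex ^ 'n \<Rightarrow> complex ^ 'n" where
  "field_mul M X Y = (\<lambda>t. fmul M t (X t) (Y t))"

text \<open>\<open>lie_mul M X Z W\<close> is \<open>Lie\<^sub>X(\<circ>)(Z, W)\<close>.\<close>

definition lie_mul :: "('n::finite) fmanifold \<Rightarrow> (complex ^ 'n \<Rightarrow> complex ^ 'n) \<Rightarrow>
    (complex ^ 'n \<Rightarrow> complex ^ 'n) \<Rightarrow> (complex ^ 'n \<Rightarrow> complex ^ 'n) \<Rightarrow>
    complex ^ 'n \<Rightarrow> complex ^ 'n" where
  "lie_mul M X Z W t =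
     lie_bracket X (field_mul M Z W) t
     - field_mul M (lie_bracket X Z) W t
     - field_mul M Z (lie_bracket X W) t"

definition F_manifold :: "('n::finite) fmanifold \<Rightarrow> bool" where
  "F_manifold M \<longleftrightarrow>
     open (base M) \<and> connected (base M) \<and> base M \<noteq> {} \<and>
     (\<forall>v w. holo_on (\<lambda>t. fmul M t v w) (base M)) \<and>
     (\<forall>t\<in>base M. \<forall>v. Vector_Spaces.linear (*s) (*s) (fmul M t v) \<and>
                      Vector_Spaces.linear (*s) (*s) (\<lambda>w. fmul M t w v)) \<and>
     (\<forall>t\<in>base M. \<forall>v w. fmul M t v w = fmul M t w v) \<and>
     (\<forall>t\<in>base M. \<forall>u v w. fmul M t (fmul M t u v) w = fmul M t u (fmul M t v w)) \<and>
     holo_on (funit M) (base M) \<and>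
     (\<forall>t\<in>base M. \<forall>v. fmul M t (funit M t) v = v) \<and>
     (\<forall>V X Y Z W. V \<subseteq> base M \<and> holo_on X V \<and> holo_on Y V \<and> holo_on Z V \<and> holo_on W V \<longrightarrow>
        (\<forall>t\<in>V. lie_mul M (field_mul M X Y) Z W t =
                 field_mul M X (lie_mul M Y Z W) t + field_mul M Y (lie_mul M X Z W) t))"

definition F_germ :: "('n::finite) fmanifold \<Rightarrow> complex ^ 'n \<Rightarrow> bool" where
  "F_germ M p \<longleftrightarrow> F_manifold M \<and> p \<in> base M"

definition euler_field ::
    "('n::finite) fmanifold \<Rightarrow> complex \<Rightarrow> (complex ^ 'n \<Rightarrow> complex ^ 'n) \<Rightarrow> bool" where
  "euler_field M d E \<longleftrightarrow> holo_on E (base M) \<and>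
     (\<forall>V Z W. V \<subseteq> base M \<and> holo_on Z V \<and> holo_on W V \<longrightarrow>
        (\<forall>t\<in>V. lie_mul M E Z W t = d *s field_mul M Z W t))"

text \<open>
  The germs at \<open>p\<close> of Euler fields of weight \<open>d\<close>. A germ is represented by any function on
  \<open>complex ^ 'n\<close> that induces it, so membership only depends on the values near \<open>p\<close>.
\<close>

definition euler_germs ::
    "('n::finite) fmanifold \<Rightarrow> complex ^ 'n \<Rightarrow> complex \<Rightarrow> (complex ^ 'n \<Rightarrow> complex ^ 'n) set" where
  "euler_germs M p d =
     {X. \<exists>U. open U \<and> p \<in> U \<and> U \<subseteq> base M \<and> euler_field (M\<lparr>base := U\<rparr>) d X}"

subsection \<open>Isomorphisms, products and irreducibility of germs\<close>

definition germ_iso ::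
    "('n::finite) fmanifold \<Rightarrow> complex ^ 'n \<Rightarrow> ('m::finite) fmanifold \<Rightarrow> complex ^ 'm \<Rightarrow> bool" where
  "germ_iso M p N q \<longleftrightarrow>
     (\<exists>U V \<phi> \<psi>. U \<subseteq> base M \<and> p \<in> U \<and> V \<subseteq> base N \<and> \<phi> p = q \<and>
        holo_on \<phi> U \<and> holo_on \<psi> V \<and> \<phi> ` U = V \<and> \<psi> ` V = U \<and>
        (\<forall>t\<in>U. \<psi> (\<phi> t) = t) \<and> (\<forall>s\<in>V. \<phi> (\<psi> s) = s) \<and>
        (\<forall>t\<in>U. jac \<phi> t (funit M t) = funit N (\<phi> t)) \<and>
        (\<forall>t\<in>U. \<forall>v w. jac \<phi> t (fmul M t v w) = fmul N (\<phi> t) (jac \<phi> t v) (jac \<phi> t w)))"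

definition vjoin :: "complex ^ 'a \<Rightarrow> complex ^ 'b \<Rightarrow> complex ^ ('a::finite + 'b::finite)" where
  "vjoin u v = (\<chi> k. case k of Inl i \<Rightarrow> u $ i | Inr j \<Rightarrow> v $ j)"

definition vleft :: "complex ^ ('a::finite + 'b::finite) \<Rightarrow> complex ^ 'a" where
  "vleft t = (\<chi> i. t $ Inl i)"

definition vright :: "complex ^ ('a::finite + 'b::finite) \<Rightarrow> complex ^ 'b" where
  "vright t = (\<chi> j. t $ Inr j)"

definition fprod :: "('a::finite) fmanifold \<Rightarrow> ('b::finite) fmanifold \<Rightarrow> ('a::finite + 'b::finite) fmanifold" where
  "fprod M N =
     \<lparr>base = {t. vleft t \<in> base M \<and> vright t \<in> base N},
      fmul = (\<lambda>t v w. vjoin (fmul M (vleft t) (vleft v) (vleft w))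
                             (fmul N (vright t) (vright v) (vright w))),
      funit = (\<lambda>t. vjoin (funit M (vleft t)) (funit N (vright t)))\<rparr>"

text \<open>
  Irreducibility of a 2-dimensional germ. The dimensions of two positive-dimensional factors add up
  to 2, so both factors are 1-dimensional.
\<close>

definition irreducible_germ_2 :: "2 fmanifold \<Rightarrow> complex ^ 2 \<Rightarrow> bool" where
  "irreducible_germ_2 M p \<longleftrightarrow>
     \<not> (\<exists>(N1 :: 1 fmanifold) q1 (N2 :: 1 fmanifold) q2.
          F_germ N1 q1 \<and> F_germ N2 q2 \<and> germ_iso M p (fprod N1 N2) (vjoin q1 q2))"

subsection \<open>Massive F-manifolds\<close>

definition generically :: "'a::topological_space set \<Rightarrow> ('a \<Rightarrow> bool) \<Rightarrow> bool" where
  "generically U P \<longleftrightarrow> (\<exists>W. open W \<and> W \<subseteq> U \<and> U \<subseteq> closure W \<and> (\<forall>t\<in>W. P t))"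

text \<open>\<open>x * y\<close> and \<open>1\<close> on \<open>complex ^ 'n\<close> are componentwise: the algebra \<open>\<complex>\<^sup>n\<close>.\<close>

definition semisimple_at :: "('n::finite) fmanifold \<Rightarrow> complex ^ 'n \<Rightarrow> bool" where
  "semisimple_at M t \<longleftrightarrow>
     (\<exists>h :: complex ^ 'n \<Rightarrow> complex ^ 'n.
        Vector_Spaces.linear (*s) (*s) h \<and> bij h \<and>
        (\<forall>v w. h (fmul M t v w) = h v * h w) \<and> h (funit M t) = 1)"

definition massive :: "('n::finite) fmanifold \<Rightarrow> bool" where
  "massive M \<longleftrightarrow> generically (base M) (semisimple_at M)"

subsection \<open>The caustic\<close>

text \<open>
  \<open>A\<close> is a subspace closed under the multiplication \<open>mu\<close>; \<open>alg_ideal mu A\<close> are the ideals of the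
  algebra \<open>A\<close>.
\<close>

definition alg_ideal :: "(complex ^ 'n \<Rightarrow> complex ^ 'n \<Rightarrow> complex ^ 'n) \<Rightarrow>
    (complex ^ 'n) set \<Rightarrow> (complex ^ 'n) set \<Rightarrow> bool" where
  "alg_ideal mu A J \<longleftrightarrow> vec.subspace J \<and> J \<subseteq> A \<and> (\<forall>x\<in>A. \<forall>y\<in>J. mu x y \<in> J)"

definition alg_maximal_ideal :: "(complex ^ 'n \<Rightarrow> complex ^ 'n \<Rightarrow> complex ^ 'n) \<Rightarrow>
    (complex ^ 'n) set \<Rightarrow> (complex ^ 'n) set \<Rightarrow> bool" where
  "alg_maximal_ideal mu A J \<longleftrightarrow> alg_ideal mu A J \<and> J \<noteq> A \<and>
     (\<forall>K. alg_ideal mu A K \<and> J \<subseteq> K \<longrightarrow> K = J \<or> K = A)"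

definition local_algebra ::
    "(complex ^ 'n \<Rightarrow> complex ^ 'n \<Rightarrow> complex ^ 'n) \<Rightarrow> (complex ^ 'n) set \<Rightarrow> bool" where
  "local_algebra mu A \<longleftrightarrow>
     (\<exists>u\<in>A. \<forall>x\<in>A. mu u x = x) \<and> (\<exists>!J. alg_maximal_ideal mu A J)"

definition local_decomposition ::
    "(complex ^ 'n \<Rightarrow> complex ^ 'n \<Rightarrow> complex ^ 'n) \<Rightarrow> (complex ^ 'n) set set \<Rightarrow> bool" where
  "local_decomposition mu D \<longleftrightarrow> finite D \<and>
     (\<forall>A\<in>D. alg_ideal mu UNIV A \<and> local_algebra mu A) \<and>
     (\<forall>x. \<exists>!f. f \<in> (\<Pi>\<^sub>E A\<in>D. A) \<and> (\<Sum>A\<in>D. f A) = x)"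

definition alg_partition ::
    "(complex ^ 'n \<Rightarrow> complex ^ 'n \<Rightarrow> complex ^ 'n) \<Rightarrow> nat multiset" where
  "alg_partition mu =
     (THE P. \<exists>D. local_decomposition mu D \<and> P = image_mset vec.dim (mset_set D))"

definition generic_partition :: "('n::finite) fmanifold \<Rightarrow> nat multiset" where
  "generic_partition M = (THE P. generically (base M) (\<lambda>t. alg_partition (fmul M t) = P))"

definition caustic :: "('n::finite) fmanifold \<Rightarrow> (complex ^ 'n) set" where
  "caustic M = {t \<in> base M. alg_partition (fmul M t) \<noteq> generic_partition M}"

subsection \<open>Discriminant and bifurcation diagram\<close>

definition discriminant ::
    "('n::finite) fmanifold \<Rightarrow> (complex ^ 'n \<Rightarrow> complex ^ 'n) \<Rightarrow> (complex ^ 'n) set" where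
  "discriminant M E = {t \<in> base M. det (matrix (fmul M t (E t))) = 0}"

definition bifurcation_diagram ::
    "('n::finite) fmanifold \<Rightarrow> (complex ^ 'n \<Rightarrow> complex ^ 'n) \<Rightarrow> (complex ^ 'n) set" where
  "bifurcation_diagram M E =
     {t \<in> base M. card {c. \<exists>v. v \<noteq> 0 \<and> fmul M t (E t) v = c *s v} < CARD('n)}"

subsection \<open>The 2-dimensional normal forms\<close>

text \<open>The coordinate vector fields \<open>\<delta>\<^sub>i = \<partial>/\<partial>t\<^sub>i\<close>.\<close>

abbreviation \<delta> :: "'n \<Rightarrow> complex ^ 'n" where
  "\<delta> i \<equiv> axis i 1"

text \<open>
  The bilinear commutative multiplication on \<open>\<complex>\<^sup>2\<close> with unit \<open>\<delta> 1\<close> and \<open>\<delta> 2 \<circ> \<delta> 2 = f t \<cdot> \<delta> 1\<close>.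
\<close>

definition plane_F :: "(complex ^ 2 \<Rightarrow> complex) \<Rightarrow> 2 fmanifold" where
  "plane_F f =
     \<lparr>base = UNIV,
      fmul = (\<lambda>t v w. (v $ 1 * w $ 1 + v $ 2 * w $ 2 * f t) *s \<delta> 1
                       + (v $ 1 * w $ 2 + v $ 2 * w $ 1) *s \<delta> 2),
      funit = (\<lambda>t. \<delta> 1)\<rparr>"

lemma plane_F_basis:
  "fmul (plane_F f) t (\<delta> 1) v = v"
  "fmul (plane_F f) t v (\<delta> 1) = v"
  "fmul (plane_F f) t (\<delta> 2) (\<delta> 2) = f t *s \<delta> 1"
  by (simp_all add: plane_F_def vec_eq_iff forall_2 axis_def)

definition I2 :: "nat \<Rightarrow> 2 fmanifold" where
  "I2 m = plane_F (\<lambda>t. (t $ 2) ^ (m - 2))"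

definition I2_euler :: "nat \<Rightarrow> complex ^ 2 \<Rightarrow> complex ^ 2" where
  "I2_euler m t = (t $ 1) *s \<delta> 1 + (2 / of_nat m * t $ 2) *s \<delta> 2"

definition nilpotent_F :: "2 fmanifold" where
  "nilpotent_F = plane_F (\<lambda>t. 0)"

end

theory Submission
  imports Defs "HOL-Complex_Analysis.Conformal_Mappings"
begin

text \<open>
  Near a point of a plane F-manifold the tangent sheaf is spanned by the unit field \<open>e\<close> and a second
  field, and completing the square makes the second field a field \<open>X\<close> with \<open>X \<circ> X = f e\<close> for a
  function \<open>f\<close>. The F-manifold condition for the pair \<open>e, e\<close> says that the Lie derivative of the
  multiplication along \<open>e\<close> vanishes; evaluated at \<open>X, X\<close> it forces \<open>[e, X]\<close> to be a multiple of \<open>X\<close>.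
  If \<open>u\<close> is a first integral of \<open>e\<close> with \<open>X u \<noteq> 0\<close>, then \<open>X\<close> may be divided by \<open>X u\<close>, and applying
  \<open>[e, X]\<close> to \<open>u\<close> shows that now \<open>[e, X] = 0\<close> and \<open>e f = 0\<close>. A commuting frame is a coordinate frame, so
  there are coordinates \<open>t\<^sub>1, t\<^sub>2\<close> with \<open>e = \<partial>\<^sub>1\<close>, \<open>X = \<partial>\<^sub>2\<close>
  and \<open>X \<circ> X = F(t\<^sub>2) e\<close>. If \<open>F\<close> vanishes, this is the nilpotent germ. Otherwise \<open>F\<close> is
  \<open>t\<^sub>2\<^sup>k\<close> times a function without zeros, a new coordinate \<open>s(t\<^sub>2)\<close> with
  \<open>s'\<^sup>2 s\<^sup>k = F\<close> exists, and the germ is \<open>I2 (k + 2)\<close>. This is \<open>local_normal_form\<close>.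

  The analytic input is the rectification of \<open>e\<close>, a holomorphic flow box. It is obtained from a series
  in place of a differential equation: if \<open>V x = 1\<close> and \<open>x\<close> vanishes at the base point, then
  \<open>g = \<Sum>\<^sub>n (-1)\<^sup>n x\<^sup>n\<^sup>+\<^sup>1/(n+1)! V\<^sup>n f\<close> solves \<open>V g = f\<close>, because
  the series for \<open>V g\<close> telescopes (\<open>solve_directional\<close>). Convergence follows from iterated Cauchy
  estimates, which need only the one-variable theory along complex lines. The same estimates show that
  uniform limits and directional derivatives of holomorphic functions are holomorphic.

  Whether the germs are nilpotent is a global matter (\<open>massive_germ_dichotomy\<close>). A point with nilpotent
  germ has a neighbourhood without semisimple points, a point with germ \<open>I2 m\<close> has a neighbourhood in the
  closure of the open set of semisimple points. These are two disjoint open conditions that cover the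
  connected base, so all points satisfy the same one.

  The statements on the two normal forms are computations. A Lie derivative of the multiplication depends
  only on the values of its two arguments and on the first-order data of the field, so the F-manifold
  condition and the Euler condition become identities between finitely many numbers at each point
  (\<open>lie_mul_plane\<close>). The Euler condition for \<open>E\<close> on \<open>I2 m\<close> says that \<open>E\<^sub>1 - d t\<^sub>1\<close> is constant
  and that \<open>E\<^sub>2\<close> is a function of \<open>t\<^sub>2\<close> solving a linear equation of first order, singular at
  \<open>t\<^sub>2 = 0\<close>, with only one holomorphic solution.
\<close>

section \<open>Holomorphic functions of several variables\<close>

abbreviation dif :: "(complex ^ 'n \<Rightarrow> complex) \<Rightarrow> complex ^ 'n \<Rightarrow> complex ^ 'n \<Rightarrow> complex" where
  "dif f t \<equiv> frechet_derivative f (at t)"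

text \<open>
  The analogue of \<open>holo_on\<close> for scalar functions. Directional derivatives of scalar functions are scalar
  again, so that fields act on them as iterable operators.
\<close>

definition hol :: "(complex ^ 'n \<Rightarrow> complex) \<Rightarrow> (complex ^ 'n) set \<Rightarrow> bool" where
  "hol f U \<longleftrightarrow> open U \<and>
     (\<forall>t\<in>U. \<exists>D. (f has_derivative D) (at t) \<and> (\<forall>c v. D (c *s v) = c * D v))"

lemma norm_smult_complex: "norm (c *s v) = norm c * norm (v :: complex ^ 'n)"
  by (simp add: norm_vec_def norm_mult L2_set_right_distrib)

lemma bounded_linear_smult_left: "bounded_linear (\<lambda>z. z *s (v :: complex ^ 'n))"
  by (rule bounded_linear_intro[where K = "norm v"])
     (auto simp: norm_smult_complex vec_eq_iff algebra_simps)

lemmas [derivative_intros] = bounded_linear.has_derivative[OF bounded_linear_smult_left]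
lemmas [continuous_intros] = bounded_linear.continuous_on[OF bounded_linear_smult_left]

lemma has_derivative_vec_nth [derivative_intros]:
  assumes "(F has_derivative D) (at t within S)"
  shows "((\<lambda>t. F t $ i) has_derivative (\<lambda>v. D v $ i)) (at t within S)"
  using bounded_linear.has_derivative[OF bounded_linear_vec_nth assms] .

text \<open>
  The library compares derivatives along the real basis; a coordinate of a complex vector accounts for
  two of its elements.
\<close>

lemma has_derivative_vecI:
  fixes F :: "'a::euclidean_space \<Rightarrow> complex ^ 'm"
  assumes "\<And>i. ((\<lambda>t. F t $ i) has_derivative (\<lambda>v. D v $ i)) (at t within S)"
  shows "(F has_derivative D) (at t within S)"
proof -
  have "((\<lambda>x. F x \<bullet> b) has_derivative (\<lambda>x. D x \<bullet> b)) (at t within S)" if b0: "b \<in> Basis" for b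
  proof -
    obtain i u where b: "b = axis i u"
      using b0 unfolding Basis_vec_def by blast
    show ?thesis
      unfolding b inner_axis
      by (rule has_derivative_inner_left[OF assms[of i]])
  qed
  then show ?thesis
    unfolding has_derivative_componentwise_within[of F D] by blast
qed

lemma hol_open: "hol f U \<Longrightarrow> open U"
  by (simp add: hol_def)

lemma holI:
  assumes "open U"
    and "\<And>t. t \<in> U \<Longrightarrow> (f has_derivative D t) (at t)"
    and "\<And>t c v. t \<in> U \<Longrightarrow> D t (c *s v) = c * D t v"
  shows "hol f U"
  using assms unfolding hol_def by blast

lemma dif_eqI: "(f has_derivative D) (at t) \<Longrightarrow> dif f t = D"
  by (rule frechet_derivative_at[symmetric])

lemma hol_has_derivative:
  assumes "hol f U" "t \<in> U"
  shows "(f has_derivative dif f t) (at t)"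
proof -
  obtain D where "(f has_derivative D) (at t)" using assms unfolding hol_def by blast
  then show ?thesis using dif_eqI by blast
qed

lemma hol_dif_smult: "hol f U \<Longrightarrow> t \<in> U \<Longrightarrow> dif f t (c *s v) = c * dif f t v"
  unfolding hol_def using dif_eqI by blast

lemma hol_dif_add: "hol f U \<Longrightarrow> t \<in> U \<Longrightarrow> dif f t (v + w) = dif f t v + dif f t w"
  using linear_add[OF has_derivative_linear[OF hol_has_derivative]] .

lemma hol_dif_diff: "hol f U \<Longrightarrow> t \<in> U \<Longrightarrow> dif f t (v - w) = dif f t v - dif f t w"
  using linear_diff[OF has_derivative_linear[OF hol_has_derivative]] .

lemma hol_dif_0 [simp]: "hol f U \<Longrightarrow> t \<in> U \<Longrightarrow> dif f t 0 = 0"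
  using hol_dif_diff[of f U t 0 0] by simp

lemma hol_dif_sum: "hol f U \<Longrightarrow> t \<in> U \<Longrightarrow> dif f t (\<Sum>i\<in>I. v i) = (\<Sum>i\<in>I. dif f t (v i))"
  using linear_sum[OF has_derivative_linear[OF hol_has_derivative]] .

lemma vec_expand: "v = (\<Sum>i\<in>UNIV. v $ i *s \<delta> i)" for v :: "complex ^ 'n"
  by (simp add: basis_expansion)

lemma hol_dif_expand:
  assumes "hol f U" "t \<in> U"
  shows "dif f t v = (\<Sum>i\<in>UNIV. v $ i * dif f t (\<delta> i))"
proof -
  have "dif f t v = dif f t (\<Sum>i\<in>UNIV. v $ i *s \<delta> i)" by (rule arg_cong[OF vec_expand])
  also have "\<dots> = (\<Sum>i\<in>UNIV. v $ i * dif f t (\<delta> i))"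
    by (simp only: hol_dif_sum[OF assms] hol_dif_smult[OF assms])
  finally show ?thesis .
qed

lemma hol_subset: "hol f U \<Longrightarrow> open V \<Longrightarrow> V \<subseteq> U \<Longrightarrow> hol f V"
  unfolding hol_def by blast

lemma hol_continuous_on: "hol f U \<Longrightarrow> continuous_on U f"
  by (meson continuous_at_imp_continuous_on has_derivative_continuous hol_has_derivative)

lemma hol_local:
  assumes "\<And>t. t \<in> U \<Longrightarrow> \<exists>V. t \<in> V \<and> V \<subseteq> U \<and> hol f V"
  shows "hol f U"
proof -
  have "open U"
    unfolding open_subopen[of U] using assms hol_open by blast
  moreover have "\<exists>D. (f has_derivative D) (at t) \<and> (\<forall>c v. D (c *s v) = c * D v)" if "t \<in> U" for t
    using assms[OF that] unfolding hol_def by blast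
  ultimately show ?thesis unfolding hol_def by blast
qed

lemma frechet_derivative_cong_open:
  fixes f g :: "'a::real_normed_vector \<Rightarrow> 'b::real_normed_vector"
  assumes "open U" "t \<in> U" "\<And>s. s \<in> U \<Longrightarrow> f s = g s"
  shows "frechet_derivative f (at t) = frechet_derivative g (at t)"
proof -
  have "(f has_derivative D) (at t) \<longleftrightarrow> (g has_derivative D) (at t)" for D
    using has_derivative_transform_within_open[of f D t UNIV U g]
      has_derivative_transform_within_open[of g D t UNIV U f] assms by auto
  then show ?thesis unfolding frechet_derivative_def by simp
qed

lemma hol_cong:
  assumes "hol f U" "\<And>s. s \<in> U \<Longrightarrow> f s = g s"
  shows "hol g U"
  unfolding hol_def
proof (intro conjI ballI)
  show "open U" using assms by (simp add: hol_def)
  fix t assume t: "t \<in> U"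
  then obtain D where D: "(f has_derivative D) (at t)" "\<forall>c v. D (c *s v) = c * D v"
    using assms unfolding hol_def by blast
  then have "(g has_derivative D) (at t)"
    using has_derivative_transform_within_open[OF D(1) \<open>open U\<close> t assms(2)] by blast
  with D show "\<exists>D. (g has_derivative D) (at t) \<and> (\<forall>c v. D (c *s v) = c * D v)" by blast
qed

lemma hol_const [simp]: "hol (\<lambda>_. c) U \<longleftrightarrow> open U"
  by (auto simp: hol_def intro!: exI[of _ "\<lambda>_. 0"])

lemma dif_const [simp]: "dif (\<lambda>_. c) t v = 0"
  by (subst dif_eqI[of _ "\<lambda>_. 0"]) auto

lemma hol_coord [simp]: "hol (\<lambda>t. t $ i) U \<longleftrightarrow> open U"
  by (auto simp: hol_def intro!: exI[of _ "\<lambda>v. v $ i"] derivative_eq_intros)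

lemma dif_coord [simp]: "dif (\<lambda>t. t $ i) t v = v $ i"
  by (subst dif_eqI[of _ "\<lambda>v. v $ i"]) (auto intro!: derivative_eq_intros)

lemma
  assumes "hol f U" "hol g U"
  shows hol_add: "hol (\<lambda>t. f t + g t) U"
    and dif_add: "t \<in> U \<Longrightarrow> dif (\<lambda>t. f t + g t) t v = dif f t v + dif g t v"
proof -
  have 1: "((\<lambda>t. f t + g t) has_derivative (\<lambda>v. dif f t v + dif g t v)) (at t)" if "t \<in> U" for t
    using that assms by (intro has_derivative_add hol_has_derivative) auto
  show "hol (\<lambda>t. f t + g t) U"
    by (rule holI[OF hol_open 1]) (use assms in \<open>auto simp: hol_dif_smult algebra_simps\<close>)
  show "t \<in> U \<Longrightarrow> dif (\<lambda>t. f t + g t) t v = dif f t v + dif g t v"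
    by (simp add: dif_eqI[OF 1])
qed

lemma
  assumes "hol f U" "hol g U"
  shows hol_mult: "hol (\<lambda>t. f t * g t) U"
    and dif_mult: "t \<in> U \<Longrightarrow> dif (\<lambda>t. f t * g t) t v = dif f t v * g t + f t * dif g t v"
proof -
  have 1: "((\<lambda>t. f t * g t) has_derivative (\<lambda>v. dif f t v * g t + f t * dif g t v)) (at t)"
    if "t \<in> U" for t
    using that assms
    by (auto intro!: derivative_eq_intros hol_has_derivative)
  show "hol (\<lambda>t. f t * g t) U"
    by (rule holI[OF hol_open 1]) (use assms in \<open>auto simp: hol_dif_smult algebra_simps\<close>)
  show "t \<in> U \<Longrightarrow> dif (\<lambda>t. f t * g t) t v = dif f t v * g t + f t * dif g t v"
    by (simp add: dif_eqI[OF 1])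
qed

lemma
  assumes "hol f U" "\<And>t. t \<in> U \<Longrightarrow> (g has_field_derivative g' (f t)) (at (f t))"
  shows hol_compose: "hol (\<lambda>t. g (f t)) U"
    and dif_compose: "t \<in> U \<Longrightarrow> dif (\<lambda>t. g (f t)) t v = g' (f t) * dif f t v"
proof -
  have 1: "((\<lambda>t. g (f t)) has_derivative (\<lambda>v. g' (f t) * dif f t v)) (at t)" if "t \<in> U" for t
    using has_derivative_compose[OF hol_has_derivative[OF assms(1) that]
        assms(2)[OF that, unfolded has_field_derivative_def]] .
  show "hol (\<lambda>t. g (f t)) U"
    by (rule holI[OF hol_open 1]) (use assms in \<open>auto simp: hol_dif_smult algebra_simps\<close>)
  show "t \<in> U \<Longrightarrow> dif (\<lambda>t. g (f t)) t v = g' (f t) * dif f t v"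
    by (simp add: dif_eqI[OF 1])
qed

lemma hol_compose_holomorphic:
  assumes "hol f U" "g holomorphic_on S" "open S" "f ` U \<subseteq> S"
  shows "hol (\<lambda>t. g (f t)) U"
    and "t \<in> U \<Longrightarrow> dif (\<lambda>t. g (f t)) t v = deriv g (f t) * dif f t v"
proof -
  have 1: "(g has_field_derivative deriv g (f t)) (at (f t))" if "t \<in> U" for t
    using assms that by (intro holomorphic_derivI[of g S]) auto
  show "hol (\<lambda>t. g (f t)) U" "t \<in> U \<Longrightarrow> dif (\<lambda>t. g (f t)) t v = deriv g (f t) * dif f t v"
    using hol_compose[OF assms(1) 1] dif_compose[OF assms(1) 1] by auto
qed

lemma hol_cmult: "hol f U \<Longrightarrow> hol (\<lambda>t. c * f t) U"
  and dif_cmult: "hol f U \<Longrightarrow> t \<in> U \<Longrightarrow> dif (\<lambda>t. c * f t) t v = c * dif f t v"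
  using hol_mult[of "\<lambda>_. c" U f] dif_mult[of "\<lambda>_. c" U f] by (auto dest: hol_open)

lemma
  assumes "hol f U" "hol g U"
  shows hol_diff: "hol (\<lambda>t. f t - g t) U"
    and dif_diff: "t \<in> U \<Longrightarrow> dif (\<lambda>t. f t - g t) t v = dif f t v - dif g t v"
  using hol_add[OF assms(1) hol_cmult[OF assms(2), of "-1"]]
        dif_add[OF assms(1) hol_cmult[OF assms(2), of "-1"]]
        dif_cmult[OF assms(2), of _ "-1"] by auto

lemma
  assumes "\<And>i. i \<in> I \<Longrightarrow> hol (f i) U" "open U"
  shows hol_sum: "hol (\<lambda>t. \<Sum>i\<in>I. f i t) U"
    and dif_sum: "t \<in> U \<Longrightarrow> dif (\<lambda>t. \<Sum>i\<in>I. f i t) t v = (\<Sum>i\<in>I. dif (f i) t v)"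
proof -
  have "hol (\<lambda>t. \<Sum>i\<in>I. f i t) U \<and> (t \<in> U \<longrightarrow> dif (\<lambda>t. \<Sum>i\<in>I. f i t) t v = (\<Sum>i\<in>I. dif (f i) t v))"
    using assms
    by (induction I rule: infinite_finite_induct) (auto simp: hol_add intro!: trans[OF dif_add])
  then show "hol (\<lambda>t. \<Sum>i\<in>I. f i t) U"
    "t \<in> U \<Longrightarrow> dif (\<lambda>t. \<Sum>i\<in>I. f i t) t v = (\<Sum>i\<in>I. dif (f i) t v)" by auto
qed

lemma
  assumes "hol f U"
  shows hol_power: "hol (\<lambda>t. f t ^ n) U"
    and dif_power: "t \<in> U \<Longrightarrow> dif (\<lambda>t. f t ^ n) t v = of_nat n * f t ^ (n - 1) * dif f t v"
proof -
  have "((\<lambda>z. z ^ n) has_field_derivative of_nat n * z ^ (n - 1)) (at z)" for z :: complex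
    by (auto intro!: derivative_eq_intros)
  then show "hol (\<lambda>t. f t ^ n) U"
    "t \<in> U \<Longrightarrow> dif (\<lambda>t. f t ^ n) t v = of_nat n * f t ^ (n - 1) * dif f t v"
    using hol_compose[OF assms, of "\<lambda>z. z ^ n" "\<lambda>z. of_nat n * z ^ (n - 1)"] dif_compose[OF assms, of "\<lambda>z. z ^ n" "\<lambda>z. of_nat n * z ^ (n - 1)"]
    by auto
qed

lemma hol_divide:
  assumes "hol f U" "hol g U" "\<And>t. t \<in> U \<Longrightarrow> g t \<noteq> 0"
  shows "hol (\<lambda>t. f t / g t) U"
proof -
  have "hol (\<lambda>t. inverse (g t)) U"
    using assms by (intro hol_compose_holomorphic[of g U inverse "-{0}"] holomorphic_intros) auto
  from hol_mult[OF assms(1) this] show ?thesis by (simp add: divide_inverse)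
qed

section \<open>Holomorphic vector fields\<close>

lemma holo_on_nth:
  assumes "holo_on F U" shows "hol (\<lambda>t. F t $ i) U"
proof -
  have "\<exists>D. ((\<lambda>t. F t $ i) has_derivative D) (at t) \<and> (\<forall>c v. D (c *s v) = c * D v)"
    if "t \<in> U" for t
  proof -
    from assms that obtain D where D: "(F has_derivative D) (at t)"
      "Vector_Spaces.linear (*s) (*s) D" unfolding holo_on_def by blast
    interpret L: Vector_Spaces.linear "(*s)" "(*s)" D by fact
    show ?thesis using D by (intro exI[of _ "\<lambda>v. D v $ i"]) (auto intro!: derivative_intros simp: L.scale)
  qed
  then show ?thesis using assms unfolding holo_on_def hol_def by blast
qed

lemma vector_linearI:
  fixes D :: "complex ^ 'n \<Rightarrow> complex ^ 'm"
  assumes "\<And>v w. D (v + w) = D v + D w" "\<And>c v. D (c *s v) = c *s D v"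
  shows "Vector_Spaces.linear (*s) (*s) D"
  using assms by unfold_locales (auto simp: vec.scale_right_distrib vec.scale_left_distrib)

lemma holo_onI:
  fixes F :: "complex ^ 'n \<Rightarrow> complex ^ 'm"
  assumes "open U" "\<And>i. hol (\<lambda>t. F t $ i) U"
  shows "holo_on F U"
proof -
  have "\<exists>D. (F has_derivative D) (at t) \<and> Vector_Spaces.linear (*s) (*s) D" if "t \<in> U" for t
  proof (intro exI conjI)
    show "(F has_derivative (\<lambda>v. \<chi> i. dif (\<lambda>t. F t $ i) t v)) (at t)"
      by (rule has_derivative_vecI) (auto intro: hol_has_derivative assms that)
    show "Vector_Spaces.linear (*s) (*s) (\<lambda>v. \<chi> i. dif (\<lambda>t. F t $ i) t v)"
      by (rule vector_linearI)
         (auto simp: vec_eq_iff hol_dif_add[OF assms(2) that] hol_dif_smult[OF assms(2) that])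
  qed
  then show ?thesis unfolding holo_on_def using assms(1) by blast
qed

lemma holo_on_open: "holo_on F U \<Longrightarrow> open U"
  by (simp add: holo_on_def)

lemma holo_on_has_derivative:
  "holo_on F U \<Longrightarrow> t \<in> U \<Longrightarrow> (F has_derivative jac F t) (at t)"
  unfolding holo_on_def using frechet_derivative_at by blast

lemma jac_linear: "holo_on F U \<Longrightarrow> t \<in> U \<Longrightarrow> Vector_Spaces.linear (*s) (*s) (jac F t)"
  unfolding holo_on_def using frechet_derivative_at by blast

lemma jac_nth:
  assumes "holo_on F U" "t \<in> U" shows "jac F t v $ i = dif (\<lambda>t. F t $ i) t v"
proof -
  have "((\<lambda>t. F t $ i) has_derivative (\<lambda>v. jac F t v $ i)) (at t)"
    by (intro derivative_intros holo_on_has_derivative[OF assms])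
  from dif_eqI[OF this] show ?thesis by simp
qed

lemma holo_on_subset: "holo_on F U \<Longrightarrow> open V \<Longrightarrow> V \<subseteq> U \<Longrightarrow> holo_on F V"
  unfolding holo_on_def by blast

lemma holo_on_cong:
  assumes "holo_on F U" "\<And>s. s \<in> U \<Longrightarrow> F s = G s" shows "holo_on G U"
  using hol_cong[OF holo_on_nth[OF assms(1)]] assms
  by (intro holo_onI holo_on_open[OF assms(1)]) auto

lemma holo_on_smult: "hol f U \<Longrightarrow> holo_on X U \<Longrightarrow> holo_on (\<lambda>t. f t *s X t) U"
  by (rule holo_onI) (simp_all add: hol_mult holo_on_nth hol_open)

lemma holo_on_add: "holo_on X U \<Longrightarrow> holo_on Y U \<Longrightarrow> holo_on (\<lambda>t. X t + Y t) U"
  by (rule holo_onI) (simp_all add: hol_add holo_on_nth holo_on_open)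

lemma holo_on_diff: "holo_on X U \<Longrightarrow> holo_on Y U \<Longrightarrow> holo_on (\<lambda>t. X t - Y t) U"
  by (rule holo_onI) (simp_all add: hol_diff holo_on_nth holo_on_open)

lemma holo_on_const [simp]: "holo_on (\<lambda>t. c) U \<longleftrightarrow> open U"
  by (auto dest: holo_on_open intro: holo_onI)

section \<open>Cauchy estimates and uniform limits\<close>

lemma hol_line:
  assumes "hol f U" "t + z *s v \<in> U"
  shows "((\<lambda>z. f (t + z *s v)) has_field_derivative dif f (t + z *s v) v) (at z)"
proof -
  have "((\<lambda>z. t + z *s v) has_derivative (\<lambda>z. z *s v)) (at z)"
    by (auto intro!: derivative_eq_intros)
  from has_derivative_compose[OF this hol_has_derivative[OF assms]]
  show ?thesis unfolding has_field_derivative_def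
    by (simp add: hol_dif_smult[OF assms] mult.commute[of _ "dif f _ _"])
qed

text \<open>
  The classical estimate for \<open>z \<mapsto> f (t + z v)\<close> on the disc of radius \<open>r / |v|\<close>.
\<close>

lemma cauchy_estimate_line:
  assumes "hol f U" "cball t r \<subseteq> U" "0 < r" and B: "\<And>s. s \<in> cball t r \<Longrightarrow> norm (f s) \<le> B"
  shows "norm (dif f t v) \<le> B * norm v / r"
proof (cases "v = 0")
  case True
  have "t \<in> U" using assms(2,3) by auto
  then show ?thesis using True hol_dif_0[OF assms(1)] by simp
next
  case False
  define \<rho> where "\<rho> = r / norm v"
  have \<rho>: "\<rho> > 0" using False assms(3) by (simp add: \<rho>_def)
  have mem: "t + z *s v \<in> cball t r" if "z \<in> cball 0 \<rho>" for z
    using that False by (simp add: dist_norm norm_smult_complex \<rho>_def field_simps)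
  have d: "((\<lambda>z. f (t + z *s v)) has_field_derivative dif f (t + z *s v) v) (at z)"
    if "z \<in> cball 0 \<rho>" for z
    using hol_line[OF assms(1)] mem[OF that] assms(2) by blast
  have "norm ((deriv ^^ 1) (\<lambda>z. f (t + z *s v)) 0) \<le> fact 1 * B / \<rho> ^ 1"
  proof (rule Cauchy_inequality)
    show "(\<lambda>z. f (t + z *s v)) holomorphic_on ball 0 \<rho>"
      unfolding holomorphic_on_open[OF open_ball] using d ball_subset_cball[of 0 \<rho>] by blast
    show "continuous_on (cball 0 \<rho>) (\<lambda>z. f (t + z *s v))"
      using d by (meson DERIV_isCont continuous_at_imp_continuous_on)
  qed (use mem B \<rho> in auto)
  moreover have "deriv (\<lambda>z. f (t + z *s v)) 0 = dif f t v"
    using DERIV_imp_deriv[OF d[of 0]] \<rho> by simp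
  ultimately show ?thesis by (simp add: \<rho>_def)
qed

text \<open>
  Weierstrass: the estimate along lines, applied to differences of the sequence, makes the derivatives
  uniformly Cauchy with respect to the operator norm, as \<open>has_derivative_sequence\<close> requires.
\<close>

lemma
  fixes f :: "nat \<Rightarrow> complex ^ 'n \<Rightarrow> complex"
  assumes f: "\<And>n. hol (f n) U" and lim: "uniform_limit U f g sequentially"
  shows hol_uniform_limit: "hol g U"
    and dif_uniform_limit: "t \<in> U \<Longrightarrow> (\<lambda>n. dif (f n) t v) \<longlonglongrightarrow> dif g t v"
proof -
  have oU: "open U" using hol_open[OF f[of 0]] .
  have main: "\<exists>V D. open V \<and> t \<in> V \<and> V \<subseteq> U \<and> (\<forall>s\<in>V. (g has_derivative D s) (at s) \<and>
      (\<forall>v. (\<lambda>n. dif (f n) s v) \<longlonglongrightarrow> D s v))" if t: "t \<in> U" for t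
  proof -
    obtain r where r: "r > 0" "cball t (2 * r) \<subseteq> U"
    proof -
      obtain e where "e > 0" "cball t e \<subseteq> U" using oU t open_contains_cball by blast
      with that[of "e / 2"] show ?thesis by auto
    qed
    have sub: "cball s r \<subseteq> U" if "s \<in> ball t r" for s
    proof -
      have "cball s r \<subseteq> cball t (2 * r)" using that by (simp add: cball_subset_cball_iff dist_commute)
      with r show ?thesis by blast
    qed
    \<comment> \<open>Cauchy estimates on balls of radius \<open>r\<close> turn uniform closeness of values into closeness of derivatives\<close>
    have cau: "\<forall>\<^sub>F N in sequentially. \<forall>m\<ge>N. \<forall>n\<ge>N. \<forall>s\<in>ball t r. \<forall>v.
        norm (dif (f m) s v - dif (f n) s v) \<le> e * norm v" if "e > 0" for e
    proof -
      obtain N where N: "\<And>n s. n \<ge> N \<Longrightarrow> s \<in> U \<Longrightarrow> dist (f n s) (g s) < e * r / 2"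
        using lim r(1) \<open>e > 0\<close> unfolding uniform_limit_iff eventually_sequentially
        by (metis half_gt_zero mult_pos_pos)
      have "norm (dif (f m) s v - dif (f n) s v) \<le> e * norm v"
        if "m \<ge> N" "n \<ge> N" "s \<in> ball t r" for m n s v
      proof -
        have s: "s \<in> U" using sub[OF that(3)] r(1) by auto
        have "norm (dif (\<lambda>s. f m s - f n s) s v) \<le> (e * r) * norm v / r"
        proof (rule cauchy_estimate_line[OF hol_diff[OF f f] sub[OF that(3)] r(1)])
          fix x assume "x \<in> cball s r"
          then have "x \<in> U" using sub[OF that(3)] by blast
          from N[OF that(1) this] N[OF that(2) this] show "norm (f m x - f n x) \<le> e * r"
            unfolding dist_norm[symmetric] by (smt (verit, best) dist_commute dist_triangle_half_r field_sum_of_halves)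
        qed
        then show ?thesis using r(1) dif_diff[OF f f s] by simp
      qed
      then show ?thesis unfolding eventually_sequentially by (meson order_trans)
    qed
    define D where "D s v = lim (\<lambda>n. dif (f n) s v)" for s v
    have D: "(\<lambda>n. dif (f n) s v) \<longlonglongrightarrow> D s v" if "s \<in> ball t r" for s v
    proof -
      have "Cauchy (\<lambda>n. dif (f n) s v)"
      proof (rule CauchyI)
        fix e :: real assume "e > 0"
        define e' where "e' = e / (2 * (norm v + 1))"
        have "e' > 0" using \<open>e > 0\<close> by (simp add: e'_def add_nonneg_pos)
        have "e' * norm v < e"
        proof -
          have "e' * norm v \<le> e' * (norm v + 1)" using \<open>e' > 0\<close> by simp
          also have "\<dots> = e / 2"
          using norm_ge_zero[of v] by (simp add: e'_def field_simps add_nonneg_eq_0_iff)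
          finally show ?thesis using \<open>e > 0\<close> by simp
        qed
        moreover obtain N where "\<forall>m\<ge>N. \<forall>n\<ge>N. \<forall>s\<in>ball t r. \<forall>v.
            norm (dif (f m) s v - dif (f n) s v) \<le> e' * norm v"
          using cau[OF \<open>e' > 0\<close>] unfolding eventually_sequentially by blast
        ultimately show "\<exists>M. \<forall>m\<ge>M. \<forall>n\<ge>M. norm (dif (f m) s v - dif (f n) s v) < e"
          using that by (meson order_le_less_trans)
      qed
      then show ?thesis unfolding D_def using Cauchy_convergent convergent_LIMSEQ_iff by blast
    qed
    have "\<exists>g'. \<forall>x\<in>ball t r. (\<lambda>n. f n x) \<longlonglongrightarrow> g' x \<and> (g' has_derivative D x) (at x within ball t r)"
    proof (rule has_derivative_sequence[of _ _ "\<lambda>n x. dif (f n) x"])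
      show "(f n has_derivative dif (f n) x) (at x within ball t r)" if "x \<in> ball t r" for n x
        using hol_has_derivative[OF f] sub[OF that] r(1) has_derivative_at_withinI by (metis centre_in_cball less_imp_le subsetD)
      show "\<forall>\<^sub>F n in sequentially. \<forall>x\<in>ball t r. \<forall>h. norm (dif (f n) x h - D x h) \<le> e * norm h"
        if e: "e > 0" for e
      proof -
        obtain N where N: "\<And>m n s v. m \<ge> N \<Longrightarrow> n \<ge> N \<Longrightarrow> s \<in> ball t r \<Longrightarrow>
            norm (dif (f m) s v - dif (f n) s v) \<le> e * norm v"
          using cau[OF e] unfolding eventually_sequentially by blast
        have "norm (dif (f m) s v - D s v) \<le> e * norm v" if m: "m \<ge> N" and s: "s \<in> ball t r" for m s v
        proof (rule tendsto_upperbound)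
          show "(\<lambda>n. norm (dif (f m) s v - dif (f n) s v)) \<longlonglongrightarrow> norm (dif (f m) s v - D s v)"
            by (intro tendsto_intros D[OF s])
          show "\<forall>\<^sub>F n in sequentially. norm (dif (f m) s v - dif (f n) s v) \<le> e * norm v"
            unfolding eventually_sequentially using N[OF m _ s] by blast
        qed simp
        then show ?thesis unfolding eventually_sequentially by blast
      qed
      show "(\<lambda>n. f n t) \<longlonglongrightarrow> g t" using tendsto_uniform_limitI[OF lim t] .
    qed (use r in auto)
    then obtain g' where g': "\<And>x. x \<in> ball t r \<Longrightarrow> (\<lambda>n. f n x) \<longlonglongrightarrow> g' x"
      "\<And>x. x \<in> ball t r \<Longrightarrow> (g' has_derivative D x) (at x within ball t r)" by blast
    have "g' x = g x" if "x \<in> ball t r" for x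
      using LIMSEQ_unique[OF g'(1)[OF that] tendsto_uniform_limitI[OF lim]] sub[OF that] r(1)
      by (meson centre_in_cball less_imp_le subsetD)
    then have "(g has_derivative D x) (at x)" if "x \<in> ball t r" for x
      using has_derivative_transform_within_open[of g' "D x" x UNIV "ball t r" g] g'(2)[OF that] that
      by (simp add: at_within_open[OF that])
    moreover have "ball t r \<subseteq> U"
    proof
      fix s assume s: "s \<in> ball t r"
      have "s \<in> cball s r" using r(1) by simp
      with sub[OF s] show "s \<in> U" by blast
    qed
    ultimately show ?thesis using D r(1)
      by (intro exI[of _ "ball t r"] exI[of _ D]) auto
  qed
  have hd: "\<exists>D. (g has_derivative D) (at t) \<and> (\<forall>v. (\<lambda>n. dif (f n) t v) \<longlonglongrightarrow> D v)" if "t \<in> U" for t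
    using main[OF that] by blast
  show "hol g U"
    unfolding hol_def
  proof (intro conjI ballI oU)
    fix t assume t: "t \<in> U"
    from hd[OF t] obtain D where D: "(g has_derivative D) (at t)" "\<And>v. (\<lambda>n. dif (f n) t v) \<longlonglongrightarrow> D v"
      by blast
    have "D (c *s v) = c * D v" for c v
    proof (rule LIMSEQ_unique[OF D(2)])
      show "(\<lambda>n. dif (f n) t (c *s v)) \<longlonglongrightarrow> c * D v"
        unfolding hol_dif_smult[OF f t] by (intro tendsto_intros D(2))
    qed
    with D(1) show "\<exists>D. (g has_derivative D) (at t) \<and> (\<forall>c v. D (c *s v) = c * D v)" by blast
  qed
  show "(\<lambda>n. dif (f n) t v) \<longlonglongrightarrow> dif g t v" if t: "t \<in> U"
    using hd[OF t] dif_eqI by blast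
qed

section \<open>Holomorphy and symmetry of derivatives\<close>

text \<open>
  Taylor with remainder along the line in direction \<open>v\<close>: the second derivative is bounded by Cauchy, so
  the difference quotient with step \<open>h\<close> differs from the derivative by at most a constant times \<open>h\<close>,
  uniformly near \<open>t\<close>. The steps \<open>\<epsilon> / Suc n\<close> make it a sequence to which the Weierstrass theorem applies.
\<close>

lemma difference_quotient_uniform:
  assumes f: "hol f U" and t: "t \<in> U"
  obtains V :: "(complex ^ 'n) set" and \<epsilon> :: real where "open V" "t \<in> V" "V \<subseteq> U" "\<epsilon> > 0"
    "\<And>s n. s \<in> V \<Longrightarrow> s + of_real (\<epsilon> / Suc n) *s v \<in> U"
    "\<And>n. open ((\<lambda>s. s + of_real (\<epsilon> / Suc n) *s v) -` U)"
    "uniform_limit V (\<lambda>n s. (f (s + of_real (\<epsilon> / Suc n) *s v) - f s) / of_real (\<epsilon> / Suc n))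
       (\<lambda>s. dif f s v) sequentially"
proof -
  have oU: "open U" using hol_open[OF f] .
  obtain r where r: "r > 0" "cball t (2 * r) \<subseteq> U"
  proof -
    obtain e where "e > 0" "cball t e \<subseteq> U" using oU t open_contains_cball by blast
    with that[of "e / 2"] show ?thesis by auto
  qed
  obtain B where B: "\<And>s. s \<in> cball t (2 * r) \<Longrightarrow> norm (f s) \<le> B"
  proof -
    have "bounded (f ` cball t (2 * r))"
      by (intro compact_imp_bounded compact_continuous_image continuous_on_subset[OF hol_continuous_on[OF f] r(2)])
         simp
    then obtain B where "\<forall>x\<in>f ` cball t (2 * r). norm x \<le> B" unfolding bounded_iff by blast
    with that show ?thesis by blast
  qed
  define \<epsilon> where "\<epsilon> = r / (2 * (norm v + 1))"
  have \<epsilon>: "\<epsilon> > 0" using r(1) by (simp add: \<epsilon>_def add_nonneg_pos)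
  have \<epsilon>v: "2 * \<epsilon> * norm v \<le> r"
  proof -
    have "2 * \<epsilon> * norm v \<le> 2 * \<epsilon> * (norm v + 1)" using \<epsilon> by simp
    also have "\<dots> = r" using norm_ge_zero[of v] by (simp add: \<epsilon>_def field_simps add_nonneg_eq_0_iff)
    finally show ?thesis .
  qed
  have mem: "s + z *s v \<in> cball t (2 * r)" if "s \<in> ball t r" "z \<in> cball 0 (2 * \<epsilon>)" for s z
  proof -
    have "norm (z *s v) \<le> r"
      using mult_right_mono[of "norm z" "2 * \<epsilon>" "norm v"] that(2) \<epsilon>v by (simp add: norm_smult_complex)
    moreover have "dist t (s + z *s v) \<le> dist t s + norm (z *s v)"
      by (metis add_diff_cancel_left' dist_norm dist_triangle norm_minus_commute)
    ultimately show ?thesis using that(1) by auto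
  qed
  define C where "C = 2 * B / \<epsilon>^2"
  have est: "norm ((f (s + of_real h *s v) - f s) / of_real h - dif f s v) \<le> C * h"
    if s: "s \<in> ball t r" and h: "0 < h" "h \<le> \<epsilon>" for s h
  proof -
    define g where "g z = f (s + z *s v)" for z
    have dg: "(g has_field_derivative dif f (s + z *s v) v) (at z)" if "z \<in> cball 0 (2*\<epsilon>)" for z
      unfolding g_def using hol_line[OF f] mem[OF s that] r(2) by blast
    have holg: "g holomorphic_on ball 0 (2*\<epsilon>)"
      unfolding holomorphic_on_open[OF open_ball] using dg ball_subset_cball[of 0 "2*\<epsilon>"] by blast
    have contg: "continuous_on (cball 0 (2*\<epsilon>)) g"
      using dg by (meson DERIV_isCont continuous_at_imp_continuous_on)
    have "norm (g (of_real h) - (\<Sum>i\<le>1. (deriv ^^ i) g 0 * (of_real h - 0) ^ i / fact i))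
        \<le> C * norm (of_real h - 0 :: complex) ^ Suc 1 / fact 1"
    proof (rule complex_Taylor[of "cball 0 \<epsilon>" 1 "\<lambda>i. (deriv ^^ i) g", simplified funpow_0])
      show "((deriv ^^ i) g has_field_derivative (deriv ^^ Suc i) g x) (at x within cball 0 \<epsilon>)"
        if "x \<in> cball 0 \<epsilon>" for i x
      proof -
        have "(deriv ^^ i) g holomorphic_on ball 0 (2*\<epsilon>)"
          by (rule holomorphic_higher_deriv[OF holg]) simp
        then have "((deriv ^^ i) g has_field_derivative deriv ((deriv ^^ i) g) x) (at x)"
          using that \<epsilon> by (intro holomorphic_derivI[of _ "ball 0 (2*\<epsilon>)"]) auto
        then show ?thesis by (simp add: has_field_derivative_at_within)
      qed
      show "norm ((deriv ^^ Suc 1) g x) \<le> C" if x: "x \<in> cball 0 \<epsilon>" for x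
      proof -
        have sub: "cball x \<epsilon> \<subseteq> cball 0 (2*\<epsilon>)" using x \<epsilon> by (simp add: cball_subset_cball_iff)
        have subb: "ball x \<epsilon> \<subseteq> ball 0 (2*\<epsilon>)" using x \<epsilon> by (simp add: ball_subset_ball_iff)
        have "norm ((deriv ^^ 2) g x) \<le> fact 2 * B / \<epsilon> ^ 2"
        proof (rule Cauchy_inequality[OF holomorphic_on_subset[OF holg subb] continuous_on_subset[OF contg sub] \<epsilon>])
          fix z assume "norm (x - z) = \<epsilon>"
          then have "z \<in> cball 0 (2*\<epsilon>)" using sub by (auto simp: dist_norm)
          then show "norm (g z) \<le> B" unfolding g_def using B mem[OF s] by blast
        qed
        then show ?thesis unfolding C_def by (simp add: numeral_2_eq_2)
      qed
    qed (use h \<epsilon> in auto)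
    moreover have "deriv g 0 = dif f s v" using DERIV_imp_deriv[OF dg[of 0]] \<epsilon> by simp
    moreover have "g 0 = f s" by (simp add: g_def)
    ultimately have *: "norm (g (of_real h) - (f s + dif f s v * of_real h)) \<le> C * h^2"
      using h by (simp add: power2_eq_square)
    have "(f (s + of_real h *s v) - f s) / of_real h - dif f s v =
        (g (of_real h) - (f s + dif f s v * of_real h)) / of_real h"
      using h by (simp add: g_def field_simps)
    also have "norm \<dots> \<le> C * h^2 / h" using * h by (simp add: norm_divide divide_right_mono)
    finally show ?thesis using h by (simp add: power2_eq_square)
  qed
  have \<epsilon>n: "0 < \<epsilon> / Suc n" "\<epsilon> / Suc n \<le> \<epsilon>" for n using \<epsilon> by (auto simp: field_simps)
  have B0: "B \<ge> 0" using B[of t] r(1) norm_ge_zero order_trans by (metis centre_in_cball less_eq_real_def mult_2 add_nonneg_nonneg)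
  show ?thesis
  proof (rule that[of "ball t r" \<epsilon>])
    show "uniform_limit (ball t r) (\<lambda>n s. (f (s + of_real (\<epsilon> / Suc n) *s v) - f s) / of_real (\<epsilon> / Suc n))
       (\<lambda>s. dif f s v) sequentially"
    proof (rule uniform_limitI)
      fix e :: real assume e: "e > 0"
      have "(\<lambda>n. C * (\<epsilon> / Suc n)) \<longlonglongrightarrow> C * 0"
        by (intro tendsto_intros) (rule LIMSEQ_Suc[OF lim_const_over_n])
      then have "\<forall>\<^sub>F n in sequentially. C * (\<epsilon> / Suc n) < e" using e by (intro order_tendstoD) auto
      then show "\<forall>\<^sub>F n in sequentially. \<forall>s\<in>ball t r. dist ((f (s + of_real (\<epsilon> / Suc n) *s v) - f s) / of_real (\<epsilon> / Suc n)) (dif f s v) < e"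
      proof eventually_elim
        case (elim n)
        show ?case
          unfolding dist_norm using est[OF _ \<epsilon>n(1)[of n] \<epsilon>n(2)[of n]] elim by (meson order_le_less_trans)
      qed
    qed
    show "s + of_real (\<epsilon> / Suc n) *s v \<in> U" if "s \<in> ball t r" for s n
    proof -
      have "norm (complex_of_real (\<epsilon> / Suc n)) \<le> 2 * \<epsilon>"
        unfolding norm_of_real using \<epsilon>n[of n] \<epsilon> by linarith
      then show ?thesis using mem[OF that, of "of_real (\<epsilon> / Suc n)"] r(2)
        unfolding mem_cball_0 by blast
    qed
    show "open ((\<lambda>s. s + of_real (\<epsilon> / Suc n) *s v) -` U)" for n
      by (intro open_vimage oU continuous_intros)
  qed (use r \<epsilon> in auto)
qed

lemma hol_shift:
  assumes "hol f U" "open V" "\<And>s. s \<in> V \<Longrightarrow> s + a \<in> U"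
  shows "hol (\<lambda>s. f (s + a)) V" "s \<in> V \<Longrightarrow> dif (\<lambda>s. f (s + a)) s w = dif f (s + a) w"
proof -
  have 1: "((\<lambda>s. f (s + a)) has_derivative dif f (s + a)) (at s)" if "s \<in> V" for s
    using has_derivative_compose[of "\<lambda>s. s + a" "\<lambda>v. v" s UNIV f "dif f (s + a)"]
      hol_has_derivative[OF assms(1) assms(3)[OF that]]
      has_derivative_add[OF has_derivative_ident[of "at s"] has_derivative_const[of a "at s"]]
    by simp
  show "hol (\<lambda>s. f (s + a)) V"
    by (rule holI[OF assms(2) 1]) (use assms hol_dif_smult in blast)+
  show "s \<in> V \<Longrightarrow> dif (\<lambda>s. f (s + a)) s w = dif f (s + a) w"
    using dif_eqI[OF 1] by simp
qed

text \<open>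
  A directional derivative is a uniform limit of difference quotients, hence holomorphic; and since
  derivatives pass to the limit, differentiating the quotients in a second direction gives the
  symmetry of second derivatives as well.
\<close>

lemma
  assumes f: "hol f U"
  shows hol_dif: "hol (\<lambda>t. dif f t v) U"
    and dif_dif_commute: "t \<in> U \<Longrightarrow> dif (\<lambda>s. dif f s v) t w = dif (\<lambda>s. dif f s w) t v"
proof -
  have main: "\<exists>V. t \<in> V \<and> V \<subseteq> U \<and> hol (\<lambda>t. dif f t v) V \<and>
     (\<exists>\<epsilon>>0. (\<lambda>n. (dif f (t + of_real (\<epsilon> / Suc n) *s v) w - dif f t w) / of_real (\<epsilon> / Suc n))
       \<longlonglongrightarrow> dif (\<lambda>s. dif f s v) t w)" if t: "t \<in> U" for t v w
  proof -
    obtain V \<epsilon> where V: "open V" "t \<in> V" "V \<subseteq> U" "\<epsilon> > 0"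
      "\<And>s n. s \<in> V \<Longrightarrow> s + of_real (\<epsilon> / Suc n) *s v \<in> U"
      and lim: "uniform_limit V (\<lambda>n s. (f (s + of_real (\<epsilon> / Suc n) *s v) - f s) / of_real (\<epsilon> / Suc n))
         (\<lambda>s. dif f s v) sequentially"
      by (rule difference_quotient_uniform[OF f t, of v]) blast
    define q where "q n s = (f (s + of_real (\<epsilon> / Suc n) *s v) - f s) / of_real (\<epsilon> / Suc n)" for n s
    have q_eq: "q n = (\<lambda>s. (1 / of_real (\<epsilon> / Suc n)) * (f (s + of_real (\<epsilon> / Suc n) *s v) - f s))" for n
      by (simp add: q_def fun_eq_iff)
    have sh: "hol (\<lambda>s. f (s + of_real (\<epsilon> / Suc n) *s v)) V" for n
      by (rule hol_shift(1)[OF f V(1)]) (rule V(5))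
    note fV = hol_subset[OF f V(1,3)]
    have qhol: "hol (q n) V" for n unfolding q_eq
      by (intro hol_cmult hol_diff sh fV)
    have "dif (q n) t w = (dif f (t + of_real (\<epsilon> / Suc n) *s v) w - dif f t w) / of_real (\<epsilon> / Suc n)" for n
    proof -
      have "dif (\<lambda>s. f (s + of_real (\<epsilon> / Suc n) *s v)) t w = dif f (t + of_real (\<epsilon> / Suc n) *s v) w"
        by (rule hol_shift(2)[OF f V(1) _ V(2)]) (rule V(5))
      then show ?thesis
        unfolding q_eq dif_cmult[OF hol_diff[OF sh fV] V(2)] dif_diff[OF sh fV V(2)]
        by (simp del: of_nat_Suc)
    qed
    with dif_uniform_limit[OF qhol lim[folded q_def] V(2), of w] hol_uniform_limit[OF qhol lim[folded q_def]] V
    show ?thesis by (intro exI[of _ V]) auto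
  qed
  show hd: "hol (\<lambda>t. dif f t v) U" for v
    using main by (intro hol_local) blast
  show "dif (\<lambda>s. dif f s v) t w = dif (\<lambda>s. dif f s w) t v" if t: "t \<in> U"
  proof -
    obtain \<epsilon> where e: "\<epsilon> > 0" and lim: "(\<lambda>n. (dif f (t + of_real (\<epsilon> / Suc n) *s v) w - dif f t w) / of_real (\<epsilon> / Suc n))
       \<longlonglongrightarrow> dif (\<lambda>s. dif f s v) t w" using main[OF t] by blast
    have d: "((\<lambda>z. dif f (t + z *s v) w) has_field_derivative dif (\<lambda>s. dif f s w) t v) (at 0)"
      using hol_line[OF hd, of t 0 v w] t by simp
    have "filterlim (\<lambda>n. complex_of_real (\<epsilon> / Suc n)) (at 0) sequentially"
    proof (rule filterlim_atI)
      show "(\<lambda>n. complex_of_real (\<epsilon> / Suc n)) \<longlonglongrightarrow> 0"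
        using tendsto_of_real[OF LIMSEQ_Suc[OF lim_const_over_n[of \<epsilon>]], where 'a = complex]
        by (simp del: of_real_divide of_nat_Suc)
    qed (use e in \<open>auto simp del: of_nat_Suc\<close>)
    from filterlim_compose[OF d[unfolded DERIV_def] this]
    have "(\<lambda>n. (dif f (t + of_real (\<epsilon> / Suc n) *s v) w - dif f t w) / of_real (\<epsilon> / Suc n))
       \<longlonglongrightarrow> dif (\<lambda>s. dif f s w) t v" by simp
    with lim show ?thesis by (rule LIMSEQ_unique)
  qed
qed

lemma
  assumes f: "hol f U" and X: "holo_on X U"
  shows hol_dir: "hol (\<lambda>t. dif f t (X t)) U"
    and dif_dir: "t \<in> U \<Longrightarrow> dif (\<lambda>s. dif f s (X s)) t w =
           dif (\<lambda>s. dif f s (X t)) t w + dif f t (jac X t w)"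
proof -
  have eq: "dif f t (X t) = (\<Sum>i\<in>UNIV. X t $ i * dif f t (\<delta> i))" if "t \<in> U" for t
    by (rule hol_dif_expand[OF f that])
  have h: "hol (\<lambda>t. X t $ i * dif f t (\<delta> i)) U" for i
    by (intro hol_mult holo_on_nth[OF X] hol_dif f)
  show "hol (\<lambda>t. dif f t (X t)) U"
    by (rule hol_cong[OF hol_sum[OF h hol_open[OF f]]]) (simp add: eq)
  show "dif (\<lambda>s. dif f s (X s)) t w = dif (\<lambda>s. dif f s (X t)) t w + dif f t (jac X t w)" if t: "t \<in> U"
  proof -
    have "dif (\<lambda>s. dif f s (X s)) t w = dif (\<lambda>t. \<Sum>i\<in>UNIV. X t $ i * dif f t (\<delta> i)) t w"
      by (rule fun_cong[OF frechet_derivative_cong_open[OF hol_open[OF f] t eq]])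
    also have "\<dots> = (\<Sum>i\<in>UNIV. dif (\<lambda>t. X t $ i * dif f t (\<delta> i)) t w)"
      by (rule dif_sum[OF h hol_open[OF f] t])
    also have "\<dots> = (\<Sum>i\<in>UNIV. jac X t w $ i * dif f t (\<delta> i) + X t $ i * dif (\<lambda>s. dif f s w) t (\<delta> i))"
      by (simp add: dif_mult[OF holo_on_nth[OF X] hol_dif[OF f] t] jac_nth[OF X t]
           dif_dif_commute[OF f t, of "\<delta> _"])
    also have "\<dots> = dif f t (jac X t w) + dif (\<lambda>s. dif f s w) t (X t)"
      by (simp add: sum.distrib hol_dif_expand[OF f t, of "jac X t w"]
          hol_dif_expand[OF hol_dif[OF f] t, of _ "X t"])
    finally show ?thesis using dif_dif_commute[OF f t, of w "X t"] by simp
  qed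
qed

text \<open>
  The Lie bracket as commutator of derivations: the second derivatives cancel by symmetry.
\<close>

lemma dif_lie_bracket:
  assumes "hol f U" "holo_on X U" "holo_on Y U" "t \<in> U"
  shows "dif f t (lie_bracket X Y t) =
    dif (\<lambda>s. dif f s (Y s)) t (X t) - dif (\<lambda>s. dif f s (X s)) t (Y t)"
  unfolding lie_bracket_def
  using dif_dir[OF assms(1,2,4), of "Y t"] dif_dir[OF assms(1,3,4), of "X t"]
    dif_dif_commute[OF assms(1,4), of "X t" "Y t"] hol_dif_diff[OF assms(1,4)]
  by simp

section \<open>Lie series\<close>

text \<open>
  One term of the exponential series is at most its sum.
\<close>

lemma power_self_le_exp_fact: "real n ^ n \<le> exp (real n) * fact n"
proof -
  have "(\<Sum>k\<in>{n}. real n ^ k /\<^sub>R fact k) \<le> (\<Sum>k. real n ^ k /\<^sub>R fact k)"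
    by (rule sum_le_suminf[OF summable_exp_generic]) auto
  then show ?thesis unfolding exp_def by (simp add: field_simps)
qed

primrec iter_dir :: "(complex ^ 'n \<Rightarrow> complex ^ 'n) \<Rightarrow> (complex ^ 'n \<Rightarrow> complex) \<Rightarrow> nat \<Rightarrow> complex ^ 'n \<Rightarrow> complex" where
  "iter_dir V f 0 = f"
| "iter_dir V f (Suc k) = (\<lambda>t. dif (iter_dir V f k) t (V t))"

lemma hol_iter_dir: "hol f U \<Longrightarrow> holo_on V U \<Longrightarrow> hol (iter_dir V f k) U"
  by (induction k) (auto intro: hol_dir)

text \<open>
  Each application of \<open>V\<close> costs one Cauchy estimate. Dividing the available radius \<open>r\<close> into \<open>n\<close> equal
  steps for the \<open>n\<close>-th iterate gives a bound by a multiple of \<open>(A n / r)\<^sup>n\<close>, which is geometric growth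
  times \<open>n!\<close>.
\<close>

lemma iter_dir_bound:
  fixes V :: "complex ^ 'n \<Rightarrow> complex ^ 'n"
  assumes f: "hol f U" and V: "holo_on V U" and p: "p \<in> U"
  obtains r B K where "r > 0" "B \<ge> 0" "K > 0" "ball p r \<subseteq> U"
    "\<And>n q. q \<in> ball p r \<Longrightarrow> norm (iter_dir V f n q) \<le> B * K ^ n * fact n"
proof -
  obtain r where r: "r > 0" "cball p (2 * r) \<subseteq> U"
  proof -
    obtain e where "e > 0" "cball p e \<subseteq> U" using hol_open[OF f] p open_contains_cball by blast
    with that[of "e / 2"] show ?thesis by auto
  qed
  have contV: "continuous_on U V"
    by (meson continuous_at_imp_continuous_on has_derivative_continuous holo_on_has_derivative[OF V])
  have "bounded (f ` cball p (2 * r))" "bounded (V ` cball p (2 * r))"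
    by (intro compact_imp_bounded compact_continuous_image continuous_on_subset[OF hol_continuous_on[OF f] r(2)]
        continuous_on_subset[OF contV r(2)] compact_cball)+
  then obtain B A' where B: "\<And>q. q \<in> cball p (2 * r) \<Longrightarrow> norm (f q) \<le> B"
    and A': "\<And>q. q \<in> cball p (2 * r) \<Longrightarrow> norm (V q) \<le> A'"
    unfolding bounded_iff by (metis imageI)
  define A where "A = \<bar>A'\<bar> + 1"
  have A: "A > 0" "\<And>q. q \<in> cball p (2 * r) \<Longrightarrow> norm (V q) \<le> A"
    using A' by (force simp: A_def)+
  have "p \<in> cball p (2 * r)" using r by simp
  from B[OF this] have B0: "B \<ge> 0" using norm_ge_zero order_trans by blast
  \<comment> \<open>after \<open>k\<close> steps of width \<open>d\<close> the radius \<open>2 * r\<close> has shrunk by \<open>k * d\<close>\<close>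
  have shrink: "norm (iter_dir V f k q) \<le> B * (A / d) ^ k"
    if d: "d > 0" and q: "q \<in> cball p (2 * r - real k * d)" for d k q
    using q
  proof (induction k arbitrary: q)
    case 0
    then show ?case using B by simp
  next
    case (Suc k)
    have sub: "cball q d \<subseteq> cball p (2 * r - real k * d)"
      using Suc.prems d by (simp add: cball_subset_cball_iff algebra_simps dist_commute)
    have sub2: "cball p (2 * r - real j * d) \<subseteq> cball p (2 * r)" for j
      using d by (intro subset_cball) simp
    have "norm (dif (iter_dir V f k) q (V q)) \<le> (B * (A / d) ^ k) * norm (V q) / d"
      by (rule cauchy_estimate_line[OF hol_iter_dir[OF f V] _ d Suc.IH]) (use sub sub2 r(2) in blast)+
    also have "\<dots> \<le> (B * (A / d) ^ k) * A / d"
      using Suc.prems sub2[of "Suc k"] A B0 d by (intro divide_right_mono mult_left_mono) auto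
    finally show ?case by (simp add: mult_ac)
  qed
  define K where "K = A * exp 1 / r"
  have bound: "norm (iter_dir V f n q) \<le> B * K ^ n * fact n" if q: "q \<in> ball p r" for n q
  proof (cases "n = 0")
    case True
    then show ?thesis using B[of q] q r(1) by auto
  next
    case False
    have "norm (iter_dir V f n q) \<le> B * (A / (r / real n)) ^ n"
      by (rule shrink) (use False q r(1) in auto)
    also have "\<dots> = B * ((A / r) ^ n * real n ^ n)" by (simp add: power_mult_distrib power_divide)
    also have "\<dots> \<le> B * ((A / r) ^ n * (exp (real n) * fact n))"
      using B0 A r(1) power_self_le_exp_fact[of n] by (intro mult_left_mono) auto
    also have "\<dots> = B * K ^ n * fact n"
      by (simp add: K_def power_mult_distrib power_divide exp_of_nat_mult[of n 1, simplified])
    finally show ?thesis .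
  qed
  show ?thesis
  proof (rule that[OF r(1) B0 _ _ bound])
    show "K > 0" using A r(1) by (simp add: K_def)
    have "ball p r \<subseteq> cball p (2 * r)" using r(1) by auto
    with r(2) show "ball p r \<subseteq> U" by blast
  qed
qed

text \<open>
  If \<open>Y\<close> commutes with \<open>V\<close>, then \<open>Y V h = V Y h = 0\<close> whenever \<open>Y h = 0\<close>.
\<close>

lemma iter_dir_commuting:
  assumes f: "hol f U" and V: "holo_on V U" and Y: "holo_on Y U"
    and br: "\<And>t. t \<in> U \<Longrightarrow> lie_bracket Y V t = 0" and f0: "\<And>t. t \<in> U \<Longrightarrow> dif f t (Y t) = 0"
    and t: "t \<in> U"
  shows "dif (iter_dir V f k) t (Y t) = 0"
  using t
proof (induction k arbitrary: t)
  case 0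
  then show ?case using f0 by simp
next
  case (Suc k)
  have h: "hol (iter_dir V f k) U" by (rule hol_iter_dir[OF f V])
  have "dif (\<lambda>s. dif (iter_dir V f k) s (Y s)) t (V t) = dif (\<lambda>s. 0) t (V t)"
    by (rule fun_cong[OF frechet_derivative_cong_open[OF hol_open[OF f] Suc.prems Suc.IH]])
  with dif_lie_bracket[OF h Y V Suc.prems] br[OF Suc.prems] show ?case
    by (simp add: hol_dif_0[OF h Suc.prems])
qed

text \<open>
  The solution is \<open>g = \<Sum>\<^sub>n (-1)\<^sup>n x\<^sup>n\<^sup>+\<^sup>1/(n+1)! V\<^sup>n f\<close>. As \<open>V x = 1\<close>, applying \<open>V\<close> to the \<open>n\<close>-th term gives
  \<open>a\<^sub>n - a\<^sub>n\<^sub>+\<^sub>1\<close> with \<open>a\<^sub>n = (-1)\<^sup>n x\<^sup>n/n! V\<^sup>n f\<close>, and the partial sums telescope. Every term is divisible by \<open>x\<close>, so \<open>g\<close>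
  has no derivative at \<open>p\<close> in directions in which \<open>x\<close> is stationary; and fields that commute with
  \<open>V\<close> and annihilate \<open>x\<close> and \<open>f\<close> annihilate every term.
\<close>

lemma solve_directional:
  fixes V :: "complex ^ 'n \<Rightarrow> complex ^ 'n"
  assumes V: "holo_on V U" and x: "hol x U" and Vx: "\<And>t. t \<in> U \<Longrightarrow> dif x t (V t) = 1"
    and p: "p \<in> U" "x p = 0" and f: "hol f U"
  obtains W g where "open W" "p \<in> W" "W \<subseteq> U" "hol g W" "\<And>t. t \<in> W \<Longrightarrow> dif g t (V t) = f t"
    "\<And>w. dif x p w = 0 \<Longrightarrow> dif g p w = 0"
    "\<forall>Y. holo_on Y U \<and> (\<forall>t\<in>U. lie_bracket Y V t = 0 \<and> dif x t (Y t) = 0 \<and> dif f t (Y t) = 0) \<longrightarrow>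
       (\<forall>t\<in>W. dif g t (Y t) = 0)"
proof -
  define h where "h = iter_dir V f"
  have h: "hol (h n) U" for n unfolding h_def by (rule hol_iter_dir[OF f V])
  have h0: "h 0 = f" and hSuc: "h (Suc n) t = dif (h n) t (V t)" for n t by (simp_all add: h_def)
  obtain r B K where r: "r > 0" "B \<ge> 0" "K > 0" "ball p r \<subseteq> U"
    and hb: "\<And>n q. q \<in> ball p r \<Longrightarrow> norm (h n q) \<le> B * K ^ n * fact n"
    using iter_dir_bound[OF f V p(1)] unfolding h_def by metis
  \<comment> \<open>on \<open>|x| < \<rho>\<close> the factor \<open>K\<^sup>n\<close> is compensated by \<open>x\<^sup>n\<close>, leaving \<open>(1/2)\<^sup>n\<close>\<close>
  define \<rho> where "\<rho> = 1 / (2 * K)"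
  define W where "W = ball p r \<inter> (U \<inter> x -` ball 0 \<rho>)"
  have W: "open W" "p \<in> W" "W \<subseteq> U"
    using r p continuous_open_preimage[OF hol_continuous_on[OF x] hol_open[OF x] open_ball, of 0 \<rho>]
    by (auto simp: W_def \<rho>_def)
  define c :: "nat \<Rightarrow> complex" where "c n = (-1) ^ n / fact (Suc n)" for n
  define T where "T n t = c n * (x t ^ Suc n * h n t)" for n t
  have T: "hol (T n) W" for n unfolding T_def
    by (intro hol_cmult hol_mult hol_power hol_subset[OF x W(1,3)] hol_subset[OF h W(1,3)])
  have dT: "dif (T n) t w = c n * (of_nat (Suc n) * x t ^ n * dif x t w * h n t + x t ^ Suc n * dif (h n) t w)"
    if "t \<in> W" for n t w
  proof -
    have tU: "t \<in> U" using that W by blast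
    show ?thesis unfolding T_def
        dif_cmult[OF hol_mult[OF hol_power[OF x] h] tU] dif_mult[OF hol_power[OF x] h tU] dif_power[OF x tU]
      by simp
  qed
  define S where "S N t = (\<Sum>n<N. T n t)" for N t
  have S: "hol (S N) W" for N unfolding S_def by (intro hol_sum T W)
  have dS: "dif (S N) t w = (\<Sum>n<N. dif (T n) t w)" if "t \<in> W" for N t w
    unfolding S_def by (rule dif_sum[OF T W(1) that])
  have \<rho>K: "\<rho> * K = 1 / 2" "\<rho> > 0" using r by (auto simp: \<rho>_def)
  have xb: "norm (x t ^ n * h n t) \<le> B * (1/2) ^ n * fact n" if "t \<in> W" for t n
  proof -
    have "norm (x t ^ n * h n t) \<le> \<rho> ^ n * (B * K ^ n * fact n)"
      unfolding norm_mult norm_power using that hb[of t n] \<rho>K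
      by (intro mult_mono power_mono) (auto simp: W_def)
    also have "\<dots> = B * (\<rho> * K) ^ n * fact n" by (simp add: power_mult_distrib)
    finally show ?thesis by (simp add: \<rho>K)
  qed
  have "uniform_limit W (\<lambda>N t. \<Sum>n<N. T n t) (\<lambda>t. suminf (\<lambda>n. T n t)) sequentially"
  proof (rule Weierstrass_m_test)
    show "norm (T n t) \<le> \<rho> * B * (1/2) ^ n" if t: "t \<in> W" for n t
    proof -
      have xr: "norm (x t) \<le> \<rho>" using t by (auto simp: W_def)
      have "norm (T n t) = norm (x t) * (norm (x t ^ n * h n t) / fact (Suc n))"
        by (simp add: T_def c_def norm_mult norm_divide norm_power del: fact_Suc)
      also have "\<dots> \<le> \<rho> * ((B * (1/2) ^ n * fact n) / fact (Suc n))"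
        by (intro mult_mono divide_right_mono xb[OF t] xr) (use \<rho>K in auto)
      also have "\<dots> \<le> \<rho> * ((B * (1/2) ^ n * fact n) / fact n)"
        using \<rho>K r by (intro mult_left_mono divide_left_mono) (auto simp: fact_mono)
      finally show ?thesis by simp
    qed
    show "summable (\<lambda>n. \<rho> * B * (1/2) ^ n)" by (intro summable_mult summable_geometric) simp
  qed
  then have lim: "uniform_limit W S (\<lambda>t. suminf (\<lambda>n. T n t)) sequentially" by (simp add: S_def[abs_def])
  define g where "g t = suminf (\<lambda>n. T n t)" for t
  note g = hol_uniform_limit[OF S lim, folded g_def] and dg = dif_uniform_limit[OF S lim, folded g_def]
  show ?thesis
  proof (rule that[OF W g])
    fix t assume t: "t \<in> W"
    then have tU: "t \<in> U" using W by blast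
    define a where "a n = (-1) ^ n / fact n * (x t ^ n * h n t)" for n
    have "dif (T n) t (V t) = a n - a (Suc n)" for n
      unfolding dT[OF t] a_def Vx[OF tU] hSuc[symmetric] c_def
      unfolding fact_Suc[of n]
      by (simp add: field_simps del: of_nat_Suc fact_Suc)
    then have "dif (S N) t (V t) = f t - a N" for N
      unfolding dS[OF t] by (simp add: sum_lessThan_telescope') (simp add: a_def h0)
    then have "(\<lambda>N. f t - a N) \<longlonglongrightarrow> dif g t (V t)" using dg[OF t, of "V t"] by simp
    moreover have "a \<longlonglongrightarrow> 0"
    proof (rule Lim_null_comparison)
      show "\<forall>\<^sub>F n in sequentially. norm (a n) \<le> B * (1/2) ^ n"
      proof (intro always_eventually allI)
        fix n
        have "norm (a n) = norm (x t ^ n * h n t) / fact n" by (simp add: a_def norm_mult norm_divide norm_power)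
        also have "\<dots> \<le> (B * (1/2) ^ n * fact n) / fact n" by (intro divide_right_mono xb[OF t]) simp
        finally show "norm (a n) \<le> B * (1/2) ^ n" by simp
      qed
      show "(\<lambda>n. B * (1/2) ^ n) \<longlonglongrightarrow> 0"
        by (intro tendsto_mult_right_zero LIMSEQ_power_zero) simp
    qed
    then have "(\<lambda>N. f t - a N) \<longlonglongrightarrow> f t - 0" by (intro tendsto_intros)
    ultimately have "dif g t (V t) = f t - 0" by (rule LIMSEQ_unique)
    then show "dif g t (V t) = f t" by simp
  next
    fix w assume w: "dif x p w = 0"
    have "dif (S N) p w = 0" for N unfolding dS[OF W(2)] dT[OF W(2)] using w p(2) by simp
    then show "dif g p w = 0" using dg[OF W(2), of w] by (simp add: LIMSEQ_const_iff)
  next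
    show "\<forall>Y. holo_on Y U \<and> (\<forall>t\<in>U. lie_bracket Y V t = 0 \<and> dif x t (Y t) = 0 \<and> dif f t (Y t) = 0) \<longrightarrow>
       (\<forall>t\<in>W. dif g t (Y t) = 0)"
    proof (intro allI impI ballI, elim conjE)
    fix Y t assume Y0: "holo_on Y U" "\<forall>t\<in>U. lie_bracket Y V t = 0 \<and> dif x t (Y t) = 0 \<and> dif f t (Y t) = 0"
      and t: "t \<in> W"
    then have Y: "holo_on Y U" "\<And>t. t \<in> U \<Longrightarrow> lie_bracket Y V t = 0"
       "\<And>t. t \<in> U \<Longrightarrow> dif x t (Y t) = 0" "\<And>t. t \<in> U \<Longrightarrow> dif f t (Y t) = 0" by auto
    have tU: "t \<in> U" using t W by blast
    have "dif (h n) t (Y t) = 0" for n unfolding h_def by (rule iter_dir_commuting[OF f V Y(1,2,4) tU])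
    then have "dif (S N) t (Y t) = 0" for N unfolding dS[OF t] dT[OF t] using Y(3)[OF tU] by simp
    then show "dif g t (Y t) = 0" using dg[OF t, of "Y t"] by (simp add: LIMSEQ_const_iff)
    qed
  qed
qed

section \<open>Local inverses\<close>

lemma jac_add: "holo_on F U \<Longrightarrow> t \<in> U \<Longrightarrow> jac F t (v + w) = jac F t v + jac F t w"
  using linear_add[OF has_derivative_linear[OF holo_on_has_derivative]] .

lemma jac_smult:
  assumes "holo_on F U" "t \<in> U" shows "jac F t (c *s v) = c *s jac F t v"
proof -
  interpret L: Vector_Spaces.linear "(*s)" "(*s)" "jac F t" by (rule jac_linear[OF assms])
  show ?thesis by (rule L.scale)
qed

lemma jac_0: "holo_on F U \<Longrightarrow> t \<in> U \<Longrightarrow> jac F t 0 = 0"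
  using linear_0[OF has_derivative_linear[OF holo_on_has_derivative]] .

text \<open>
  The real inverse function theorem applies since derivatives are continuous; the inverse is
  holomorphic since the inverse of a complex linear map is complex linear.
\<close>

lemma holo_local_inverse:
  fixes \<Phi> :: "complex ^ 'n \<Rightarrow> complex ^ 'n"
  assumes \<Phi>: "holo_on \<Phi> U" and p: "p \<in> U" and inj: "inj (jac \<Phi> p)"
  obtains U' V \<psi> where "open U'" "p \<in> U'" "U' \<subseteq> U" "open V" "\<Phi> ` U' = V" "\<psi> ` V = U'"
    "\<And>t. t \<in> U' \<Longrightarrow> \<psi> (\<Phi> t) = t" "\<And>s. s \<in> V \<Longrightarrow> \<Phi> (\<psi> s) = s" "holo_on \<psi> V"
proof -
  define \<Phi>' where "\<Phi>' t = Blinfun (jac \<Phi> t)" for t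
  have \<Phi>': "blinfun_apply (\<Phi>' t) = jac \<Phi> t" if "t \<in> U" for t
    unfolding \<Phi>'_def
    by (rule bounded_linear_Blinfun_apply[OF has_derivative_bounded_linear[OF holo_on_has_derivative[OF \<Phi> that]]])
  have der: "(\<Phi> has_derivative blinfun_apply (\<Phi>' t)) (at t)" if "t \<in> U" for t
    unfolding \<Phi>'[OF that] by (rule holo_on_has_derivative[OF \<Phi> that])
  have cont: "continuous_on U \<Phi>'"
  proof (rule continuous_on_blinfun_componentwise)
    fix i :: "complex ^ 'n"
    have "continuous_on U (\<lambda>t. \<chi> k. dif (\<lambda>t. \<Phi> t $ k) t i)"
      by (intro continuous_on_vec_lambda hol_continuous_on[OF hol_dif] holo_on_nth \<Phi>)
    then show "continuous_on U (\<lambda>t. blinfun_apply (\<Phi>' t) i)"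
      by (rule continuous_on_eq) (simp add: \<Phi>' vec_eq_iff jac_nth[OF \<Phi>])
  qed
  obtain g where g: "linear g" "g \<circ> jac \<Phi> p = id"
    using linear_injective_left_inverse[OF has_derivative_linear[OF holo_on_has_derivative[OF \<Phi> p]] inj] by blast
  have invf: "Blinfun g o\<^sub>L \<Phi>' p = id_blinfun"
  proof (rule blinfun_eqI)
    fix v
    have "bounded_linear g" using g(1) linear_conv_bounded_linear by blast
    then show "blinfun_apply (Blinfun g o\<^sub>L \<Phi>' p) v = blinfun_apply id_blinfun v"
      using fun_cong[OF g(2), of v] by (simp add: bounded_linear_Blinfun_apply \<Phi>'[OF p])
  qed
  obtain U' V \<psi> \<psi>' where U': "open U'" "U' \<subseteq> U" "p \<in> U'" "open V" "\<Phi> p \<in> V" and h: "homeomorphism U' V \<Phi> \<psi>"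
    and d: "\<And>y. y \<in> V \<Longrightarrow> (\<psi> has_derivative \<psi>' y) (at y)"
      "\<And>y. y \<in> V \<Longrightarrow> \<psi>' y = inv (blinfun_apply (\<Phi>' (\<psi> y)))"
      "\<And>y. y \<in> V \<Longrightarrow> bij (blinfun_apply (\<Phi>' (\<psi> y)))"
    using inverse_function_theorem[OF holo_on_open[OF \<Phi>] der cont p invf] by metis
  have im: "\<Phi> ` U' = V" "\<psi> ` V = U'" using homeomorphism_image1[OF h] homeomorphism_image2[OF h] by auto
  have "holo_on \<psi> V"
    unfolding holo_on_def
  proof (intro conjI ballI exI)
    fix y assume y: "y \<in> V"
    show "(\<psi> has_derivative \<psi>' y) (at y)" by (rule d[OF y])
    have \<psi>y: "\<psi> y \<in> U" using im y U' by blast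
    have b: "bij (jac \<Phi> (\<psi> y))" using d(3)[OF y] \<Phi>'[OF \<psi>y] by simp
    have j: "jac \<Phi> (\<psi> y) (\<psi>' y v) = v" for v
      using b d(2)[OF y] \<Phi>'[OF \<psi>y] by (simp add: bij_is_surj surj_f_inv_f)
    show "Vector_Spaces.linear (*s) (*s) (\<psi>' y)"
    proof (rule vector_linearI)
      show "\<psi>' y (v + w) = \<psi>' y v + \<psi>' y w" for v w
        by (rule injD[OF bij_is_inj[OF b]]) (simp add: j jac_add[OF \<Phi> \<psi>y])
      show "\<psi>' y (c *s v) = c *s \<psi>' y v" for c v
        by (rule injD[OF bij_is_inj[OF b]]) (simp add: j jac_smult[OF \<Phi> \<psi>y])
    qed
  qed (use U' in auto)
  with U' im h show ?thesis
    by (intro that[of U' V \<psi>]) (auto simp: homeomorphism_def)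
qed

lemma
  assumes f: "hol f U" and \<psi>: "holo_on \<psi> V" and im: "\<And>s. s \<in> V \<Longrightarrow> \<psi> s \<in> U"
  shows hol_pullback: "hol (\<lambda>s. f (\<psi> s)) V"
    and dif_pullback: "s \<in> V \<Longrightarrow> dif (\<lambda>s. f (\<psi> s)) s v = dif f (\<psi> s) (jac \<psi> s v)"
proof -
  have 1: "((\<lambda>s. f (\<psi> s)) has_derivative (\<lambda>v. dif f (\<psi> s) (jac \<psi> s v))) (at s)" if "s \<in> V" for s
    by (rule has_derivative_compose[OF holo_on_has_derivative[OF \<psi> that] hol_has_derivative[OF f im[OF that]]])
  show "hol (\<lambda>s. f (\<psi> s)) V"
    by (rule holI[OF holo_on_open[OF \<psi>] 1]) (simp_all add: jac_smult[OF \<psi>] hol_dif_smult[OF f im])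
  show "s \<in> V \<Longrightarrow> dif (\<lambda>s. f (\<psi> s)) s v = dif f (\<psi> s) (jac \<psi> s v)"
    by (simp add: dif_eqI[OF 1])
qed

lemma jac_compose:
  assumes F: "holo_on F U" and \<psi>: "holo_on \<psi> V" and s: "s \<in> V" "\<psi> s \<in> U"
  shows "jac (\<lambda>s. F (\<psi> s)) s v = jac F (\<psi> s) (jac \<psi> s v)"
proof -
  have "((\<lambda>s. F (\<psi> s)) has_derivative (\<lambda>v. jac F (\<psi> s) (jac \<psi> s v))) (at s)"
    by (rule has_derivative_compose[OF holo_on_has_derivative[OF \<psi> s(1)] holo_on_has_derivative[OF F s(2)]])
  from frechet_derivative_at[OF this] show ?thesis by metis
qed

lemma jac_inverse:
  fixes F :: "complex ^ 'n \<Rightarrow> complex ^ 'm"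
  assumes F: "holo_on F U" and \<psi>: "holo_on \<psi> V" and im: "F ` U = V" "\<psi> ` V = U"
    and inv: "\<And>t. t \<in> U \<Longrightarrow> \<psi> (F t) = t" and t: "t \<in> U"
  shows "jac \<psi> (F t) (jac F t v) = v"
proof -
  have "jac (\<lambda>t. \<psi> (F t)) t v = jac \<psi> (F t) (jac F t v)"
    by (rule jac_compose[OF \<psi> F t]) (use im t in blast)
  moreover have "jac (\<lambda>t. \<psi> (F t)) t = jac (\<lambda>t. t) t"
    by (rule frechet_derivative_cong_open[OF holo_on_open[OF F] t inv])
  ultimately show ?thesis by (simp add: frechet_derivative_ident)
qed

lemma jac_scale_field:
  assumes "hol f U" "holo_on X U" "t \<in> U"
  shows "jac (\<lambda>s. f s *s X s) t v = dif f t v *s X t + f t *s jac X t v"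
  by (simp add: vec_eq_iff jac_nth[OF holo_on_smult[OF assms(1,2)] assms(3)] jac_nth[OF assms(2,3)]
      dif_mult[OF assms(1) holo_on_nth[OF assms(2)] assms(3)])

section \<open>Multiplications on the tangent planes\<close>

definition det2 :: "complex ^ 2 \<Rightarrow> complex ^ 2 \<Rightarrow> complex" where
  "det2 v w = v $ 1 * w $ 2 - v $ 2 * w $ 1"

lemma det2_simps:
  "det2 (u + v) w = det2 u w + det2 v w" "det2 u (v + w) = det2 u v + det2 u w"
  "det2 (u - v) w = det2 u w - det2 v w" "det2 u (v - w) = det2 u v - det2 u w"
  "det2 (c *s u) w = c * det2 u w" "det2 u (c *s w) = c * det2 u w" "det2 u u = 0"
  by (auto simp: det2_def algebra_simps)

lemma cramer2:
  assumes "det2 u w \<noteq> 0"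
  shows "v = (det2 v w / det2 u w) *s u + (det2 u v / det2 u w) *s w"
proof -
  have "v $ 1 * det2 u w = det2 v w * u $ 1 + det2 u v * w $ 1"
    "v $ 2 * det2 u w = det2 v w * u $ 2 + det2 u v * w $ 2"
    by (simp_all add: det2_def algebra_simps)
  then have "v $ 1 = (det2 v w * u $ 1 + det2 u v * w $ 1) / det2 u w"
    "v $ 2 = (det2 v w * u $ 2 + det2 u v * w $ 2) / det2 u w"
    using assms unfolding eq_divide_eq by auto
  then show ?thesis
    unfolding vec_eq_iff forall_2 add_divide_distrib by simp
qed

lemma hol_det2: "holo_on X U \<Longrightarrow> holo_on Y U \<Longrightarrow> hol (\<lambda>t. det2 (X t) (Y t)) U"
  unfolding det2_def by (intro hol_diff hol_mult holo_on_nth)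

lemma F_manifoldD:
  assumes "F_manifold M"
  shows "open (base M)" "connected (base M)"
    "\<forall>v w. holo_on (\<lambda>t. fmul M t v w) (base M)"
    "\<forall>t\<in>base M. \<forall>v. Vector_Spaces.linear (*s) (*s) (fmul M t v) \<and>
                      Vector_Spaces.linear (*s) (*s) (\<lambda>w. fmul M t w v)"
    "\<forall>t\<in>base M. \<forall>v w. fmul M t v w = fmul M t w v"
    "holo_on (funit M) (base M)"
    "\<forall>t\<in>base M. \<forall>v. fmul M t (funit M t) v = v"
    "\<forall>V X Y Z W. V \<subseteq> base M \<and> holo_on X V \<and> holo_on Y V \<and> holo_on Z V \<and> holo_on W V \<longrightarrow>
        (\<forall>t\<in>V. lie_mul M (field_mul M X Y) Z W t =
                 field_mul M X (lie_mul M Y Z W) t + field_mul M Y (lie_mul M X Z W) t)"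
  using assms unfolding F_manifold_def by - (elim conjE, assumption)+

lemma
  assumes "F_manifold M" "t \<in> base M"
  shows fmul_add_right: "fmul M t v (w + w') = fmul M t v w + fmul M t v w'"
    and fmul_smult_right: "fmul M t v (c *s w) = c *s fmul M t v w"
    and fmul_add_left: "fmul M t (v + v') w = fmul M t v w + fmul M t v' w"
    and fmul_smult_left: "fmul M t (c *s v) w = c *s fmul M t v w"
    and fmul_zero_left: "fmul M t 0 w = 0"
    and fmul_zero_right: "fmul M t w 0 = 0"
    and fmul_unit_left: "fmul M t (funit M t) v = v"
    and fmul_unit_right: "fmul M t v (funit M t) = v"
proof -
  have c: "fmul M t v w = fmul M t w v" for v w
    using F_manifoldD(5)[OF assms(1)] assms(2) by blast
  have u: "fmul M t (funit M t) v = v" for v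
    using F_manifoldD(7)[OF assms(1)] assms(2) by blast
  interpret R: Vector_Spaces.linear "(*s)" "(*s)" "fmul M t v" for v
    using F_manifoldD(4)[OF assms(1)] assms(2) by blast
  show "fmul M t v (w + w') = fmul M t v w + fmul M t v w'" by (rule R.add)
  show "fmul M t v (c *s w) = c *s fmul M t v w" by (rule R.scale)
  show "fmul M t w 0 = 0" by (rule R.zero)
  show "fmul M t (v + v') w = fmul M t v w + fmul M t v' w" using R.add[of w v v'] by (simp add: c[of _ w])
  show "fmul M t (c *s v) w = c *s fmul M t v w" using R.scale[of w c v] by (simp add: c[of _ w])
  show "fmul M t 0 w = 0" using R.zero[of w] by (simp add: c[of _ w])
  show "fmul M t (funit M t) v = v" by (rule u)
  show "fmul M t v (funit M t) = v" using u[of v] by (simp add: c[of v])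
qed

lemmas fmul_linear = fmul_add_right fmul_smult_right fmul_add_left fmul_smult_left
  fmul_zero_left fmul_zero_right

lemma base_open: "F_manifold M \<Longrightarrow> open (base M)"
  by (simp add: F_manifold_def)

lemma holo_on_unit: "F_manifold M \<Longrightarrow> holo_on (funit M) (base M)"
  by (simp add: F_manifold_def)

text \<open>
  The F-manifold condition for \<open>X = Y = e\<close>, with \<open>e \<circ> e = e\<close>, reads \<open>Lie\<^sub>e(\<circ>) = 2 Lie\<^sub>e(\<circ>)\<close>.
\<close>

lemma lie_unit_mul:
  assumes M: "F_manifold M" and V: "V \<subseteq> base M" "open V" and Z: "holo_on Z V" "holo_on W V" and t: "t \<in> V"
  shows "lie_mul M (funit M) Z W t = 0"
proof -
  have tb: "t \<in> base M" using V t by blast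
  have e: "holo_on (funit M) V" by (rule holo_on_subset[OF holo_on_unit[OF M] V(2,1)])
  have eq: "field_mul M (funit M) (funit M) s = funit M s" if "s \<in> V" for s
    using fmul_unit_left[OF M, of s] that V by (auto simp: field_mul_def)
  have br: "lie_bracket (field_mul M (funit M) (funit M)) Y t = lie_bracket (funit M) Y t" for Y
    using frechet_derivative_cong_open[OF V(2) t, of "field_mul M (funit M) (funit M)" "funit M"] eq
    by (simp add: lie_bracket_def t)
  have "lie_mul M (field_mul M (funit M) (funit M)) Z W t =
      field_mul M (funit M) (lie_mul M (funit M) Z W) t + field_mul M (funit M) (lie_mul M (funit M) Z W) t"
    using F_manifoldD(8)[OF M] V(1) e Z t by blast
  moreover have "lie_mul M (field_mul M (funit M) (funit M)) Z W t = lie_mul M (funit M) Z W t"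
    unfolding lie_mul_def field_mul_def using br[unfolded field_mul_def] by simp
  ultimately show ?thesis
    by (simp add: field_mul_def fmul_unit_left[OF M tb])
qed

text \<open>
  A map that sends the frame \<open>e, X\<close> to the coordinate frame is a local isomorphism as soon as the
  multiplication tables agree on the frame.
\<close>

lemma germ_iso_plane_F:
  fixes M :: "2 fmanifold"
  assumes M: "F_manifold M" and U: "U \<subseteq> base M" "p \<in> U" and \<Phi>: "holo_on \<Phi> U" "\<Phi> p = 0"
    and e: "\<And>t. t \<in> U \<Longrightarrow> jac \<Phi> t (funit M t) = \<delta> 1"
    and X: "\<And>t. t \<in> U \<Longrightarrow> jac \<Phi> t (X t) = \<delta> 2"
    and XX: "\<And>t. t \<in> U \<Longrightarrow> fmul M t (X t) (X t) = g (\<Phi> t) *s funit M t"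
  shows "germ_iso M p (plane_F g) 0"
proof -
  have expand: "v = (v $ 1) *s \<delta> 1 + (v $ 2) *s \<delta> 2" for v :: "complex ^ 2"
    by (simp add: vec_eq_iff forall_2 axis_def)
  have jc: "jac \<Phi> t (a *s funit M t + b *s X t) = a *s \<delta> 1 + b *s \<delta> 2" if "t \<in> U" for t a b
    by (simp add: jac_add[OF \<Phi>(1) that] jac_smult[OF \<Phi>(1) that] e[OF that] X[OF that])
  have surj: "surj (jac \<Phi> t)" if "t \<in> U" for t
    unfolding surj_def
  proof
    fix y
    have "y = jac \<Phi> t ((y $ 1) *s funit M t + (y $ 2) *s X t)"
      unfolding jc[OF that] by (rule expand)
    then show "\<exists>x. y = jac \<Phi> t x" by blast
  qed
  have inj: "inj (jac \<Phi> t)" if "t \<in> U" for t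
    by (rule linear_surjective_imp_injective[OF has_derivative_linear[OF holo_on_has_derivative[OF \<Phi>(1) that]] surj[OF that]])
       (rule refl)
  obtain U' V \<psi> where U': "open U'" "p \<in> U'" "U' \<subseteq> U" "open V" "\<Phi> ` U' = V" "\<psi> ` V = U'"
    "\<And>t. t \<in> U' \<Longrightarrow> \<psi> (\<Phi> t) = t" "\<And>s. s \<in> V \<Longrightarrow> \<Phi> (\<psi> s) = s" "holo_on \<psi> V"
    using holo_local_inverse[OF \<Phi>(1) U(2) inj[OF U(2)]] by metis
  have mul: "jac \<Phi> t (fmul M t v w) = fmul (plane_F g) (\<Phi> t) (jac \<Phi> t v) (jac \<Phi> t w)"
    if t: "t \<in> U" for t v w
  proof -
    have tb: "t \<in> base M" using t U by blast
    have frame: "\<exists>a b. v = a *s funit M t + b *s X t" for v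
    proof -
      have "jac \<Phi> t v = jac \<Phi> t ((jac \<Phi> t v $ 1) *s funit M t + (jac \<Phi> t v $ 2) *s X t)"
        using jc[OF t] expand by metis
      from injD[OF inj[OF t] this] show ?thesis by blast
    qed
    obtain a b c d where v: "v = a *s funit M t + b *s X t" and w: "w = c *s funit M t + d *s X t"
      using frame by metis
    have "fmul M t v w = (a * c + b * d * g (\<Phi> t)) *s funit M t + (a * d + b * c) *s X t"
      unfolding v w fmul_linear[OF M tb] fmul_unit_left[OF M tb] fmul_unit_right[OF M tb] XX[OF t]
      by (simp add: vec_eq_iff algebra_simps)
    then have "jac \<Phi> t (fmul M t v w) = (a * c + b * d * g (\<Phi> t)) *s \<delta> 1 + (a * d + b * c) *s \<delta> 2"
      by (simp only: jc[OF t])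
    moreover have "jac \<Phi> t v = a *s \<delta> 1 + b *s \<delta> 2" "jac \<Phi> t w = c *s \<delta> 1 + d *s \<delta> 2"
      unfolding v w by (rule jc[OF t])+
    ultimately show ?thesis
      by (simp add: plane_F_def vec_eq_iff forall_2 axis_def)
  qed
  show ?thesis
    unfolding germ_iso_def
  proof (intro exI conjI)
    show "holo_on \<Phi> U'" by (rule holo_on_subset[OF \<Phi>(1) U'(1,3)])
    show "V \<subseteq> base (plane_F g)" by (simp add: plane_F_def)
    show "\<forall>t\<in>U'. jac \<Phi> t (funit M t) = funit (plane_F g) (\<Phi> t)"
      using e U'(3) by (auto simp: plane_F_def)
  qed (use U' U \<Phi>(2) mul in auto)
qed

section \<open>Rectifying the unit field\<close>

text \<open>
  The affine function \<open>x\<close> has derivative \<open>0\<close> along \<open>w\<close> and, since \<open>e p\<close> and \<open>w\<close> are independent, a nonzero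
  derivative along \<open>e\<close> near \<open>p\<close>. Rescaling \<open>e\<close> to \<open>V\<close> with \<open>V x = 1\<close> makes \<open>solve_directional\<close> applicable:
  \<open>V \<tau> = 1 / e x\<close> gives \<open>e \<tau> = 1\<close>, and subtracting a solution of \<open>V g = V y\<close> from an affine function \<open>y\<close>
  gives a first integral \<open>u\<close>. It is not critical in direction \<open>w\<close>, since \<open>g\<close> is stationary in that
  direction at \<open>p\<close> and \<open>y\<close> is not.
\<close>

lemma first_integral:
  fixes e :: "complex ^ 2 \<Rightarrow> complex ^ 2"
  assumes e: "holo_on e U" and p: "p \<in> U" and w: "det2 (e p) w \<noteq> 0"
  obtains W u \<tau> where "open W" "p \<in> W" "W \<subseteq> U" "hol u W" "hol \<tau> W" "u p = 0"
    "\<And>t. t \<in> W \<Longrightarrow> dif u t (e t) = 0" "dif u p w \<noteq> 0" "\<And>t. t \<in> W \<Longrightarrow> dif \<tau> t (e t) = 1"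
proof -
  have oU: "open U" using holo_on_open[OF e] .
  have lin: "hol (\<lambda>t. det2 t a - c) U" "hol (\<lambda>t. det2 a t - c) U"
    "t \<in> U \<Longrightarrow> dif (\<lambda>t. det2 t a - c) t v = det2 v a"  "t \<in> U \<Longrightarrow> dif (\<lambda>t. det2 a t - c) t v = det2 a v"
    for a :: "complex ^ 2" and c t v
  proof -
    have 1: "((\<lambda>t. det2 t a - c) has_derivative (\<lambda>v. det2 v a)) (at t)"
        "((\<lambda>t. det2 a t - c) has_derivative (\<lambda>v. det2 a v)) (at t)" for t
      unfolding det2_def by (auto intro!: derivative_eq_intros)
    show "hol (\<lambda>t. det2 t a - c) U" "hol (\<lambda>t. det2 a t - c) U"
      using holI[OF oU, of "\<lambda>t. det2 t a - c" "\<lambda>_ v. det2 v a"]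
        holI[OF oU, of "\<lambda>t. det2 a t - c" "\<lambda>_ v. det2 a v"] 1 by (simp_all add: det2_simps)
    show "dif (\<lambda>t. det2 t a - c) t v = det2 v a"  "dif (\<lambda>t. det2 a t - c) t v = det2 a v"
      by (simp_all add: dif_eqI[OF 1(1)] dif_eqI[OF 1(2)])
  qed
  define N where "N = {t \<in> U. det2 (e t) w \<noteq> 0}"
  have hd: "hol (\<lambda>t. det2 (e t) w) U" by (intro hol_det2 e) (simp add: oU)
  have "open (U \<inter> (\<lambda>t. det2 (e t) w) -` (- {0}))"
    by (intro continuous_open_preimage hol_continuous_on[OF hd] oU) auto
  also have "U \<inter> (\<lambda>t. det2 (e t) w) -` (- {0}) = N" by (auto simp: N_def)
  finally have oN: "open N" .
  have N: "p \<in> N" "N \<subseteq> U" using p w by (auto simp: N_def)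
  define x where "x = (\<lambda>t. det2 t w - det2 p w)"
  define y where "y = (\<lambda>t. det2 (e p) t - det2 (e p) p)"
  have x: "hol x N" "x p = 0" "\<And>t v. t \<in> N \<Longrightarrow> dif x t v = det2 v w"
    using hol_subset[OF lin(1) oN N(2)] lin(3) N by (auto simp: x_def)
  have y: "hol y N" "y p = 0" "\<And>t v. t \<in> N \<Longrightarrow> dif y t v = det2 (e p) v"
    using hol_subset[OF lin(2) oN N(2)] lin(4) N by (auto simp: y_def)
  have hdN: "hol (\<lambda>t. 1 / det2 (e t) w) N"
    by (rule hol_divide) (use hol_subset[OF hd oN N(2)] oN in \<open>auto simp: N_def\<close>)
  define V where "V = (\<lambda>t. (1 / det2 (e t) w) *s e t)"
  have V: "holo_on V N" unfolding V_def by (intro holo_on_smult hdN holo_on_subset[OF e oN N(2)])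
  have Vx: "dif x t (V t) = 1" if "t \<in> N" for t
    using that by (simp add: x V_def det2_simps) (simp add: N_def)
  have eV: "e t = det2 (e t) w *s V t" if "t \<in> N" for t
    using that by (simp add: V_def N_def)
  obtain W1 \<tau> where W1: "open W1" "p \<in> W1" "W1 \<subseteq> N" "hol \<tau> W1"
    "\<And>t. t \<in> W1 \<Longrightarrow> dif \<tau> t (V t) = 1 / det2 (e t) w"
    by (rule solve_directional[OF V x(1) _ N(1) x(2) hdN]) (erule Vx, rule that)
  obtain W2 g where W2: "open W2" "p \<in> W2" "W2 \<subseteq> N" "hol g W2"
    "\<And>t. t \<in> W2 \<Longrightarrow> dif g t (V t) = dif y t (V t)" "\<And>w. dif x p w = 0 \<Longrightarrow> dif g p w = 0"
    by (rule solve_directional[OF V x(1) _ N(1) x(2) hol_dir[OF y(1) V]]) (erule Vx, rule that)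
  define W where "W = W1 \<inter> W2"
  have W: "open W" "p \<in> W" "W \<subseteq> N" "W \<subseteq> W1" "W \<subseteq> W2" using W1 W2 by (auto simp: W_def)
  have gW: "hol g W" "hol \<tau> W" using W1(4) W2(4) W hol_subset by blast+
  have yW: "hol y W" by (rule hol_subset[OF y(1) W(1,3)])
  define u where "u t = y t - (g t - g p)" for t
  have g': "hol (\<lambda>t. g t - g p) W" by (intro hol_diff gW) (simp add: W)
  have u: "hol u W" unfolding u_def by (intro hol_diff yW g')
  have du: "dif u t v = dif y t v - dif g t v" if "t \<in> W" for t v
    unfolding u_def dif_diff[OF yW g' that]
    using dif_diff[OF gW(1), of "\<lambda>_. g p" t v] that W(1) by simp
  show ?thesis
  proof (rule that[OF W(1,2) _ u gW(2)])
    show "W \<subseteq> U" using W N by blast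
    show "u p = 0" by (simp add: u_def y)
    show "dif u t (e t) = 0" if "t \<in> W" for t
    proof -
      have "t \<in> N" using that W by blast
      from eV[OF this] have "dif u t (e t) = det2 (e t) w * dif u t (V t)"
        using hol_dif_smult[OF u that] by metis
      also have "dif u t (V t) = 0" using du[OF that] W2(5)[of t] that W by auto
      finally show ?thesis by simp
    qed
    have "dif x p w = 0" by (simp add: x N det2_simps)
    then show "dif u p w \<noteq> 0" using du[OF W(2)] W2(6) w by (simp add: y N)
    show "dif \<tau> t (e t) = 1" if "t \<in> W" for t
    proof -
      have tN: "t \<in> N" using that W by blast
      from eV[OF this] have "dif \<tau> t (e t) = det2 (e t) w * dif \<tau> t (V t)"
        using hol_dif_smult[OF gW(2) that] by metis
      also have "dif \<tau> t (V t) = 1 / det2 (e t) w" using W1(5) that W by blast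
      finally show ?thesis using tN by (simp add: N_def)
    qed
  qed
qed

lemma open_nonzero:
  assumes "hol f U" shows "open {t \<in> U. f t \<noteq> 0}"
proof -
  have "open (U \<inter> f -` (- {0}))"
    by (intro continuous_open_preimage hol_continuous_on[OF assms] hol_open[OF assms]) auto
  also have "U \<inter> f -` (- {0}) = {t \<in> U. f t \<noteq> 0}" by auto
  finally show ?thesis .
qed

text \<open>
  A constant vector \<open>w\<close> independent of \<open>e p\<close> stays independent nearby and satisfies
  \<open>w \<circ> w = a w + b e\<close> there; then \<open>X = w - (a / 2) e\<close> is the completed square.
\<close>

lemma traceless_frame:
  fixes M :: "2 fmanifold"
  assumes M: "F_manifold M" and p: "p \<in> base M"
  obtains U X f where "open U" "p \<in> U" "U \<subseteq> base M" "holo_on X U" "hol f U"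
    "\<And>t. t \<in> U \<Longrightarrow> fmul M t (X t) (X t) = f t *s funit M t"
    "\<And>t. t \<in> U \<Longrightarrow> det2 (funit M t) (X t) \<noteq> 0"
proof -
  let ?e = "funit M"
  have e0: "?e p \<noteq> 0"
  proof
    assume "?e p = 0"
    then have "v = 0" for v :: "complex ^ 2" using fmul_unit_left[OF M p, of v] fmul_zero_left[OF M p] by simp
    from this[of "\<delta> 1"] show False by (simp add: axis_eq_0_iff)
  qed
  obtain w where w: "det2 (?e p) w \<noteq> 0"
  proof (cases "?e p $ 1 = 0")
    case True
    then have "?e p $ 2 \<noteq> 0" using e0 by (auto simp: vec_eq_iff forall_2)
    then have "det2 (?e p) (\<delta> 1) \<noteq> 0" by (simp add: det2_def axis_def)
    then show ?thesis by (rule that)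
  next
    case False
    then have "det2 (?e p) (\<delta> 2) \<noteq> 0" by (simp add: det2_def axis_def)
    then show ?thesis by (rule that)
  qed
  define D where "D t = det2 (?e t) w" for t
  define Q where "Q t = fmul M t w w" for t
  define U where "U = {t \<in> base M. D t \<noteq> 0}"
  have D: "hol D (base M)" unfolding D_def
    by (intro hol_det2 holo_on_unit[OF M]) (simp add: base_open[OF M])
  have U: "open U" "p \<in> U" "U \<subseteq> base M"
    using open_nonzero[OF D] p w by (auto simp: U_def D_def)
  have D: "hol D U" and D0: "\<And>t. t \<in> U \<Longrightarrow> D t \<noteq> 0"
    by (rule hol_subset[OF D U(1,3)]) (simp add: U_def)
  have e: "holo_on ?e U" by (rule holo_on_subset[OF holo_on_unit[OF M] U(1,3)])
  have Q: "holo_on Q U" unfolding Q_def using F_manifoldD(3)[OF M] U holo_on_subset by blast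
  define a where "a t = det2 (?e t) (Q t) / D t" for t
  define b where "b t = det2 (Q t) w / D t" for t
  have a: "hol a U" unfolding a_def by (intro hol_divide hol_det2 e Q D D0)
  have b: "hol b U" unfolding b_def by (intro hol_divide hol_det2 e Q D D0) (simp add: U)
  have Qe: "Q t = b t *s ?e t + a t *s w" if "t \<in> U" for t
    unfolding a_def b_def D_def by (rule cramer2) (use D0[OF that] in \<open>simp add: D_def\<close>)
  define X where "X t = w - (1/2 * a t) *s ?e t" for t
  define f where "f t = b t + 1/4 * (a t * a t)" for t
  show ?thesis
  proof (rule that[OF U])
    show "holo_on X U" unfolding X_def by (intro holo_on_diff holo_on_smult hol_cmult a e) (simp add: U)
    show "hol f U" unfolding f_def by (intro hol_add hol_cmult hol_mult a b)
    show "fmul M t (X t) (X t) = f t *s ?e t" if "t \<in> U" for t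
    proof -
      have tb: "t \<in> base M" using that U by blast
      have Xt: "X t = w + (- (1/2 * a t)) *s ?e t" by (simp add: X_def)
      have "fmul M t (X t) (X t) = Q t - a t *s w + (1/4 * (a t * a t)) *s ?e t"
        unfolding Xt fmul_linear[OF M tb] fmul_unit_left[OF M tb] fmul_unit_right[OF M tb] Q_def
        by (simp add: vec_eq_iff algebra_simps)
      also have "\<dots> = f t *s ?e t" unfolding Qe[OF that] f_def by (simp add: vec_eq_iff algebra_simps)
      finally show ?thesis .
    qed
    show "det2 (?e t) (X t) \<noteq> 0" if "t \<in> U" for t
      using D0[OF that] by (simp add: X_def D_def det2_simps)
  qed
qed

lemma dif_zero_on:
  assumes "open U" "t \<in> U" "\<And>s. s \<in> U \<Longrightarrow> f s = c"
  shows "dif f t v = 0"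
  using frechet_derivative_cong_open[OF assms(1,2), of f "\<lambda>_. c"] assms(3) by simp

text \<open>
  With a traceless \<open>X\<close> with \<open>X u = 1\<close> and \<open>[e, X] = \<alpha> e + \<beta> X\<close>, the vanishing of \<open>Lie\<^sub>e(\<circ>)(X, X)\<close> reads
  \<open>(e f) e = 2 \<alpha> X + 2 \<beta> f e\<close>, so \<open>\<alpha> = 0\<close> and \<open>e f = 2 \<beta> f\<close>; applying the bracket to \<open>u\<close>, with \<open>e u = 0\<close>,
  gives \<open>\<beta> = 0\<close>. The function \<open>u\<close> serves as second coordinate. The first one is a solution \<open>\<tau>\<close> of
  \<open>e \<tau> = 1\<close> corrected by a \<open>\<sigma>\<close> with \<open>X \<sigma> = - X \<tau>\<close> and \<open>e \<sigma> = 0\<close>; such a \<open>\<sigma>\<close> exists because \<open>e\<close> commutes with \<open>X\<close>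
  and annihilates both \<open>u\<close> and \<open>X \<tau>\<close>.
\<close>

lemma rectified_frame:
  fixes M :: "2 fmanifold"
  assumes M: "F_manifold M" and p: "p \<in> base M"
  obtains U X f t1 t2 where "open U" "p \<in> U" "U \<subseteq> base M" "holo_on X U" "hol f U" "hol t1 U" "hol t2 U"
    "t1 p = 0" "t2 p = 0"
    "\<And>t. t \<in> U \<Longrightarrow> fmul M t (X t) (X t) = f t *s funit M t"
    "\<And>t. t \<in> U \<Longrightarrow> dif t1 t (funit M t) = 1" "\<And>t. t \<in> U \<Longrightarrow> dif t2 t (funit M t) = 0"
    "\<And>t. t \<in> U \<Longrightarrow> dif t1 t (X t) = 0" "\<And>t. t \<in> U \<Longrightarrow> dif t2 t (X t) = 1"
    "\<And>t. t \<in> U \<Longrightarrow> dif f t (funit M t) = 0"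
proof -
  let ?e = "funit M"
  obtain U0 X0 f0 where U0: "open U0" "p \<in> U0" "U0 \<subseteq> base M" "holo_on X0 U0" "hol f0 U0"
    and X0: "\<And>t. t \<in> U0 \<Longrightarrow> fmul M t (X0 t) (X0 t) = f0 t *s ?e t"
    and ind0: "\<And>t. t \<in> U0 \<Longrightarrow> det2 (?e t) (X0 t) \<noteq> 0"
    by (rule traceless_frame[OF M p]) blast
  have e0: "holo_on ?e U0" by (rule holo_on_subset[OF holo_on_unit[OF M] U0(1,3)])
  obtain W u \<tau> where W: "open W" "p \<in> W" "W \<subseteq> U0" "hol u W" "hol \<tau> W" "u p = 0"
    "\<And>t. t \<in> W \<Longrightarrow> dif u t (?e t) = 0" "dif u p (X0 p) \<noteq> 0" "\<And>t. t \<in> W \<Longrightarrow> dif \<tau> t (?e t) = 1"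
    by (rule first_integral[OF e0 U0(2) ind0[OF U0(2)]]) blast
  have X0W: "holo_on X0 W" by (rule holo_on_subset[OF U0(4) W(1,3)])
  have du: "hol (\<lambda>t. dif u t (X0 t)) W" by (rule hol_dir[OF W(4) X0W])
  define U where "U = {t \<in> W. dif u t (X0 t) \<noteq> 0}"
  have U: "open U" "p \<in> U" "U \<subseteq> W" using open_nonzero[OF du] W by (auto simp: U_def)
  have UB: "U \<subseteq> base M" "U \<subseteq> U0" using U W U0 by auto
  define c where "c t = 1 / dif u t (X0 t)" for t
  have c: "hol c U" unfolding c_def
    by (rule hol_divide) (use hol_subset[OF du U(1,3)] U in \<open>auto simp: U_def\<close>)
  have u: "hol u U" "hol \<tau> U" using W(4,5) U hol_subset by blast+
  have e: "holo_on ?e U" by (rule holo_on_subset[OF e0 U(1) UB(2)])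
  define X where "X t = c t *s X0 t" for t
  have X: "holo_on X U" unfolding X_def by (intro holo_on_smult c holo_on_subset[OF X0W U(1,3)])
  have Xu: "dif u t (X t) = 1" if "t \<in> U" for t
    using that unfolding X_def hol_dif_smult[OF u(1) that] by (simp add: c_def U_def)
  define f where "f t = c t * c t * f0 t" for t
  have f: "hol f U" unfolding f_def by (intro hol_mult c hol_subset[OF U0(5) U(1) UB(2)])
  have XX: "fmul M t (X t) (X t) = f t *s ?e t" if "t \<in> U" for t
  proof -
    have tb: "t \<in> base M" "t \<in> U0" using that UB by auto
    show ?thesis unfolding X_def fmul_linear[OF M tb(1)] X0[OF tb(2)] by (simp add: f_def mult_ac)
  qed
  have ind: "det2 (?e t) (X t) \<noteq> 0" if "t \<in> U" for t
    using ind0[of t] that UB by (auto simp: X_def det2_simps c_def U_def)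
  have ue: "dif u s (?e s) = 0" if "s \<in> U" for s using W(7) U(3) that by blast
  have br: "lie_bracket ?e X t = 0 \<and> dif f t (?e t) = 0" if t: "t \<in> U" for t
  proof -
    have tb: "t \<in> base M" using t UB by auto
    define \<alpha> where "\<alpha> = det2 (lie_bracket ?e X t) (X t) / det2 (?e t) (X t)"
    define \<beta> where "\<beta> = det2 (?e t) (lie_bracket ?e X t) / det2 (?e t) (X t)"
    have b: "lie_bracket ?e X t = \<alpha> *s ?e t + \<beta> *s X t"
      unfolding \<alpha>_def \<beta>_def by (rule cramer2[OF ind[OF t]])
    have feq: "field_mul M X X s = f s *s ?e s" if "s \<in> U" for s
      using XX[OF that] by (simp add: field_mul_def)
    have jcong: "jac (field_mul M X X) t = jac (\<lambda>s. f s *s ?e s) t"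
      by (rule frechet_derivative_cong_open[OF U(1) t feq])
    have "lie_bracket ?e (field_mul M X X) t = dif f t (?e t) *s ?e t"
      unfolding lie_bracket_def feq[OF t] jcong jac_scale_field[OF f e t]
        jac_smult[OF e t] by simp
    then have l: "dif f t (?e t) *s ?e t =
        fmul M t (lie_bracket ?e X t) (X t) + fmul M t (X t) (lie_bracket ?e X t)"
      using lie_unit_mul[OF M UB(1) U(1) X X t] by (simp add: lie_mul_def field_mul_def diff_diff_eq)
    have "fmul M t (lie_bracket ?e X t) (X t) + fmul M t (X t) (lie_bracket ?e X t)
        = (2 * \<alpha>) *s X t + (2 * \<beta> * f t) *s ?e t"
      unfolding b fmul_linear[OF M tb] fmul_unit_left[OF M tb] fmul_unit_right[OF M tb] XX[OF t]
      by (simp add: vec_eq_iff algebra_simps)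
    with l have l2: "dif f t (?e t) *s ?e t = (2 * \<alpha>) *s X t + (2 * \<beta> * f t) *s ?e t" by simp
    have "det2 (?e t) (dif f t (?e t) *s ?e t) = 2 * \<alpha> * det2 (?e t) (X t)"
      unfolding l2 by (simp add: det2_simps)
    with ind[OF t] have \<alpha>: "\<alpha> = 0" by (simp add: det2_simps)
    have "det2 (dif f t (?e t) *s ?e t) (X t) = 2 * \<beta> * f t * det2 (?e t) (X t)"
      unfolding l2 by (simp add: det2_simps)
    with ind[OF t] have fe: "dif f t (?e t) = 2 * \<beta> * f t" by (simp add: det2_simps)
    have "dif u t (lie_bracket ?e X t) = 0"
      unfolding dif_lie_bracket[OF u(1) e X t]
      using dif_zero_on[OF U(1) t, of "\<lambda>s. dif u s (X s)" 1] Xu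
        dif_zero_on[OF U(1) t ue] by simp
    then have "\<beta> = 0" unfolding b \<alpha> using Xu[OF t] by (simp add: hol_dif_smult[OF u(1) t])
    with \<alpha> b fe show ?thesis by simp
  qed
  define k where "k t = - 1 * dif \<tau> t (X t)" for t
  have k0: "hol (\<lambda>t. dif \<tau> t (X t)) U" by (rule hol_dir[OF u(2) X])
  have k: "hol k U" unfolding k_def by (intro hol_cmult k0)
  have ke: "dif k t (?e t) = 0" if t: "t \<in> U" for t
  proof -
    have "0 = dif \<tau> t (lie_bracket ?e X t)" using br[OF t] hol_dif_0[OF u(2) t] by simp
    also have "\<dots> = dif (\<lambda>s. dif \<tau> s (X s)) t (?e t)"
      unfolding dif_lie_bracket[OF u(2) e X t]
      using dif_zero_on[OF U(1) t, of "\<lambda>s. dif \<tau> s (?e s)" 1] W(9) U(3) by auto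
    finally show ?thesis unfolding k_def dif_cmult[OF k0 t] by simp
  qed
  obtain S \<sigma> where S: "open S" "p \<in> S" "S \<subseteq> U" "hol \<sigma> S" "\<And>t. t \<in> S \<Longrightarrow> dif \<sigma> t (X t) = k t"
    and \<sigma>: "\<forall>Y. holo_on Y U \<and>
       (\<forall>t\<in>U. lie_bracket Y X t = 0 \<and> dif u t (Y t) = 0 \<and> dif k t (Y t) = 0) \<longrightarrow>
       (\<forall>t\<in>S. dif \<sigma> t (Y t) = 0)"
    by (rule solve_directional[OF X u(1) _ U(2) W(6) k]) (erule Xu, rule that)
  have \<sigma>e: "dif \<sigma> t (?e t) = 0" if "t \<in> S" for t
  proof -
    have "\<forall>t\<in>U. lie_bracket ?e X t = 0 \<and> dif u t (?e t) = 0 \<and> dif k t (?e t) = 0"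
      using br ke ue by blast
    with \<sigma> e that show ?thesis by blast
  qed
  have \<tau>S: "hol \<tau> S" by (rule hol_subset[OF u(2) S(1,3)])
  define t1 where "t1 t = (\<tau> t + \<sigma> t) - (\<tau> p + \<sigma> p)" for t
  have cS: "hol (\<lambda>t. \<tau> p + \<sigma> p) S" by (simp add: S)
  have dt1: "dif t1 t v = dif \<tau> t v + dif \<sigma> t v" if "t \<in> S" for t v
    unfolding t1_def dif_diff[OF hol_add[OF \<tau>S S(4)] cS that] dif_add[OF \<tau>S S(4) that] by simp
  show ?thesis
  proof (rule that[of S X f t1 u, OF S(1,2)])
    show "S \<subseteq> base M" using S UB by blast
    show "holo_on X S" by (rule holo_on_subset[OF X S(1,3)])
    show "hol f S" by (rule hol_subset[OF f S(1,3)])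
    show "hol u S" by (rule hol_subset[OF u(1) S(1,3)])
    show "hol t1 S" unfolding t1_def by (intro hol_diff hol_add \<tau>S S(4) cS)
    show "t1 p = 0" "u p = 0" by (simp_all add: t1_def W)
    fix t assume t: "t \<in> S"
    then have tU: "t \<in> U" and tW: "t \<in> W" using S U by auto
    show "fmul M t (X t) (X t) = f t *s ?e t" by (rule XX[OF tU])
    show "dif t1 t (?e t) = 1" unfolding dt1[OF t] \<sigma>e[OF t] W(9)[OF tW] by simp
    show "dif t1 t (X t) = 0" unfolding dt1[OF t] S(5)[OF t] by (simp add: k_def)
    show "dif u t (?e t) = 0" by (rule W(7)[OF tW])
    show "dif u t (X t) = 1" by (rule Xu[OF tU])
    show "dif f t (?e t) = 0" using br[OF tU] by blast
  qed
qed

text \<open>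
  In the chart the derivative along the first coordinate vanishes; on a product of two discs this
  makes the function independent of the first coordinate.
\<close>

lemma function_of_second_coordinate:
  fixes \<Phi> :: "complex ^ 2 \<Rightarrow> complex ^ 2"
  assumes \<Phi>: "holo_on \<Phi> U" "\<Phi> p = 0" and p: "p \<in> U" and e: "\<And>t. t \<in> U \<Longrightarrow> jac \<Phi> t (e t) = \<delta> 1"
    and inj: "inj (jac \<Phi> p)"
    and f: "hol f U" "\<And>t. t \<in> U \<Longrightarrow> dif f t (e t) = 0"
  obtains N r F where "open N" "p \<in> N" "N \<subseteq> U" "r > 0" "F holomorphic_on ball 0 r"
    "\<And>t. t \<in> N \<Longrightarrow> \<Phi> t $ 2 \<in> ball 0 r \<and> f t = F (\<Phi> t $ 2)"
proof -
  obtain U' V \<psi> where U': "open U'" "p \<in> U'" "U' \<subseteq> U" "open V" "\<Phi> ` U' = V" "\<psi> ` V = U'"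
    "\<And>t. t \<in> U' \<Longrightarrow> \<psi> (\<Phi> t) = t" "\<And>s. s \<in> V \<Longrightarrow> \<Phi> (\<psi> s) = s" "holo_on \<psi> V"
    by (rule holo_local_inverse[OF \<Phi>(1) p inj]) blast
  have "0 \<in> V" using U'(2,5) \<Phi>(2) by force
  then obtain \<rho> where \<rho>: "\<rho> > 0" "ball 0 \<rho> \<subseteq> V" using \<open>open V\<close> open_contains_ball by blast
  define r where "r = \<rho> / 2"
  have r: "r > 0" using \<rho> by (simp add: r_def)
  have box: "s \<in> V" if "s $ 1 \<in> ball 0 r" "s $ 2 \<in> ball 0 r" for s
  proof -
    have "norm s \<le> (\<Sum>i\<in>UNIV. norm (s $ i))" unfolding norm_vec_def by (rule L2_set_le_sum) simp
    also have "\<dots> < \<rho>" using that by (simp add: sum_2 r_def)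
    finally show ?thesis using \<rho>(2) by auto
  qed
  define k where "k s = f (\<psi> s)" for s
  have im: "\<psi> s \<in> U" if "s \<in> V" for s using U' that by blast
  have k: "hol k V" unfolding k_def by (rule hol_pullback[OF f(1) U'(9) im])
  have dk: "dif k s (\<delta> 1) = 0" if s: "s \<in> V" for s
  proof -
    have s': "\<psi> s \<in> U'" using U' s by blast
    have "jac \<psi> (\<Phi> (\<psi> s)) (jac \<Phi> (\<psi> s) (e (\<psi> s))) = e (\<psi> s)"
      by (rule jac_inverse[OF holo_on_subset[OF \<Phi>(1) U'(1,3)] U'(9,5,6,7) s'])
    then have "jac \<psi> s (\<delta> 1) = e (\<psi> s)" using U'(8)[OF s] e[OF im[OF s]] by simp
    moreover have "dif (\<lambda>s. f (\<psi> s)) s (\<delta> 1) = dif f (\<psi> s) (jac \<psi> s (\<delta> 1))"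
      by (rule dif_pullback[OF f(1) U'(9) _ s]) (rule im)
    ultimately show ?thesis unfolding k_def using f(2)[OF im[OF s]] by simp
  qed
  define vec where "vec z y = z *s \<delta> 1 + y *s (\<delta> 2 :: complex ^ 2)" for z y :: complex
  have vec: "vec z y $ 1 = z" "vec z y $ 2 = y" for z y by (simp_all add: vec_def axis_def)
  have vec_eta: "vec (s $ 1) (s $ 2) = s" for s by (simp add: vec_eq_iff forall_2 vec)
  have indep: "k (vec z y) = k (vec 0 y)" if "z \<in> ball 0 r" "y \<in> ball 0 r" for z y
  proof -
    have "\<exists>c. \<forall>z\<in>ball 0 r. k (vec z y) = c"
    proof (rule has_field_derivative_zero_constant)
      fix z :: complex assume z: "z \<in> ball 0 r"
      have zV: "vec z y \<in> V" by (rule box) (use z that in \<open>auto simp: vec\<close>)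
      have vs: "vec z y = y *s \<delta> 2 + z *s \<delta> 1" for z by (simp add: vec_def add.commute)
      have "((\<lambda>z. k (y *s \<delta> 2 + z *s \<delta> 1)) has_field_derivative dif k (y *s \<delta> 2 + z *s \<delta> 1) (\<delta> 1)) (at z)"
        by (rule hol_line[OF k]) (use zV vs in simp)
      then have "((\<lambda>z. k (vec z y)) has_field_derivative 0) (at z)"
        using dk[OF zV] by (simp add: vs)
      then show "((\<lambda>z. k (vec z y)) has_field_derivative 0) (at z within ball 0 r)"
        by (rule has_field_derivative_at_within)
    qed simp
    then show ?thesis using that r by auto
  qed
  define F where "F y = k (vec 0 y)" for y
  have F: "F holomorphic_on ball 0 r"
    unfolding holomorphic_on_open[OF open_ball]
  proof
    fix y :: complex assume y: "y \<in> ball 0 r"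
    have "vec 0 y \<in> V" by (rule box) (use y r in \<open>auto simp: vec\<close>)
    then have "((\<lambda>z. k (0 + z *s \<delta> 2)) has_field_derivative dif k (0 + y *s \<delta> 2) (\<delta> 2)) (at y)"
      by (intro hol_line[OF k]) (simp add: vec_def)
    then show "\<exists>F'. (F has_field_derivative F') (at y)" unfolding F_def vec_def by auto
  qed
  define N where "N = {t \<in> U'. \<Phi> t $ 1 \<in> ball 0 r \<and> \<Phi> t $ 2 \<in> ball 0 r}"
  have \<Phi>': "hol (\<lambda>t. \<Phi> t $ i) U'" for i by (rule holo_on_nth[OF holo_on_subset[OF \<Phi>(1) U'(1,3)]])
  have "open ((U' \<inter> (\<lambda>t. \<Phi> t $ 1) -` ball 0 r) \<inter> (U' \<inter> (\<lambda>t. \<Phi> t $ 2) -` ball 0 r))"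
    by (intro open_Int continuous_open_preimage hol_continuous_on[OF \<Phi>'] U'(1) open_ball)
  also have "\<dots> = N" by (auto simp: N_def)
  finally have oN: "open N" .
  show ?thesis
  proof (rule that[OF oN _ _ r F])
    show "p \<in> N" "N \<subseteq> U" using U' \<Phi>(2) r by (auto simp: N_def)
    fix t assume t: "t \<in> N"
    then have t': "t \<in> U'" "\<Phi> t $ 1 \<in> ball 0 r" "\<Phi> t $ 2 \<in> ball 0 r" by (auto simp: N_def)
    have "f t = k (vec (\<Phi> t $ 1) (\<Phi> t $ 2))" unfolding vec_eta k_def U'(7)[OF t'(1)] ..
    also have "\<dots> = F (\<Phi> t $ 2)" unfolding F_def by (rule indep[OF t'(2,3)])
    finally show "\<Phi> t $ 2 \<in> ball 0 r \<and> f t = F (\<Phi> t $ 2)" using t' by blast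
  qed
qed

section \<open>Normalizing the multiplication\<close>

text \<open>
  If \<open>G = \<Sum> c\<^sub>n z\<^sup>n\<close>, then \<open>H = \<Sum> m/(m + 2n) c\<^sub>n z\<^sup>n\<close>. The equation is \<open>(z\<^sup>m\<^sup>/\<^sup>2 H)' = (m/2) z\<^sup>m\<^sup>/\<^sup>2\<^sup>-\<^sup>1 G\<close>, freed of the
  half-integral powers that occur for odd \<open>m\<close>.
\<close>

lemma weighted_antiderivative:
  fixes m :: nat
  assumes G: "G holomorphic_on ball 0 r" and r: "0 < r" and m: "m > 0"
  obtains H where "H holomorphic_on ball 0 r" "H 0 = G 0"
    "\<And>z. z \<in> ball 0 r \<Longrightarrow> of_nat m * H z + 2 * z * deriv H z = of_nat m * G z"
proof -
  define c where "c n = (deriv ^^ n) G 0 / fact n" for n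
  have Gs: "(\<lambda>n. c n * z ^ n) sums G z" if "z \<in> ball 0 r" for z
    using holomorphic_power_series[OF G that] by (simp add: c_def)
  define d where "d n = of_nat m / of_nat (m + 2 * n) * c n" for n
  have dn: "norm (of_nat m / of_nat (m + 2 * n) :: complex) \<le> 1" for n
    unfolding norm_divide norm_of_nat using m by (simp add: divide_le_eq)
  have sd: "summable (\<lambda>n. d n * z ^ n)" if z: "z \<in> ball 0 r" for z
  proof -
    obtain R where R: "norm z < R" "R < r" using z dense by auto
    have "of_real R \<in> ball (0::complex) r" using R norm_ge_zero[of z] by (simp add: abs_of_nonneg[of R] del: norm_ge_zero)
    then have "summable (\<lambda>n. c n * of_real R ^ n)" using Gs sums_summable by blast
    moreover have "norm z < norm (of_real R :: complex)" using R by simp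
    ultimately have "summable (\<lambda>n. norm (c n * z ^ n))" by (rule powser_insidea)
    then show ?thesis
    proof (rule summable_comparison_test'[where N = 0])
      fix n
      show "norm (d n * z ^ n) \<le> norm (c n * z ^ n)"
        unfolding d_def norm_mult using dn[of n] by (simp add: mult_left_le_one_le mult_right_mono)
    qed
  qed
  define H where "H z = (\<Sum>n. d n * z ^ n)" for z
  have Hs: "(\<lambda>n. d n * z ^ n) sums H z" if "z \<in> ball 0 r" for z
    unfolding H_def using sd[OF that] by (rule summable_sums)
  have H: "H holomorphic_on ball 0 r"
    by (rule power_series_holomorphic[of 0 r d]) (use Hs in simp)
  show ?thesis
  proof (rule that[OF H])
    show "H 0 = G 0"
    proof -
      have "H 0 = d 0" using powser_sums_zero_iff Hs[of 0] r by force
      moreover have "G 0 = c 0" using powser_sums_zero_iff Gs[of 0] r by force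
      ultimately show ?thesis using m by (simp add: d_def)
    qed
    fix z :: complex assume z: "z \<in> ball 0 r"
    have "((\<lambda>z. suminf (\<lambda>n. d n * z ^ n)) has_field_derivative suminf (\<lambda>n. diffs d n * z ^ n)) (at z)"
      by (rule termdiffs_strong'[of r]) (use sd z in auto)
    then have dH: "deriv H z = suminf (\<lambda>n. diffs d n * z ^ n)"
      unfolding H_def[abs_def] by (rule DERIV_imp_deriv)
    have "summable (\<lambda>n. diffs d n * z ^ n)"
      by (rule termdiff_converges[of z r]) (use sd z in auto)
    then have "(\<lambda>n. diffs d n * z ^ n) sums deriv H z" unfolding dH by (rule summable_sums)
    then have "(\<lambda>n. z * (diffs d n * z ^ n)) sums (z * deriv H z)" by (rule sums_mult)
    then have "(\<lambda>n. of_nat (Suc n) * d (Suc n) * z ^ Suc n) sums (z * deriv H z)"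
      by (simp add: diffs_def mult_ac)
    then have 1: "(\<lambda>n. of_nat n * d n * z ^ n) sums (z * deriv H z)"
      using sums_Suc_iff[of "\<lambda>n. of_nat n * d n * z ^ n"] by simp
    have "(\<lambda>n. of_nat m * (d n * z ^ n) + 2 * (of_nat n * d n * z ^ n)) sums (of_nat m * H z + 2 * (z * deriv H z))"
      by (intro sums_add sums_mult Hs z 1)
    moreover have "of_nat m * (d n * z ^ n) + 2 * (of_nat n * d n * z ^ n) = of_nat m * (c n * z ^ n)" for n
    proof -
      have "(of_nat (m + 2 * n) :: complex) \<noteq> 0" using m by (simp only: of_nat_eq_0_iff)
      then have "of_nat (m + 2 * n) * d n = of_nat m * c n" unfolding d_def by simp
      then have "(of_nat (m + 2 * n) * d n) * z ^ n = of_nat m * c n * z ^ n" by simp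
      then show ?thesis by (simp add: algebra_simps)
    qed
    ultimately have "(\<lambda>n. of_nat m * (c n * z ^ n)) sums (of_nat m * H z + 2 * (z * deriv H z))" by simp
    moreover have "(\<lambda>n. of_nat m * (c n * z ^ n)) sums (of_nat m * G z)" by (intro sums_mult Gs z)
    ultimately show "of_nat m * H z + 2 * z * deriv H z = of_nat m * G z"
      using sums_unique2 by (simp add: mult.assoc)
  qed
qed

text \<open>
  Write \<open>F = z\<^sup>k S\<^sup>2\<close> with \<open>S\<close> free of zeros and put \<open>m = k + 2\<close>. The equation \<open>s'\<^sup>2 s\<^sup>k = F\<close> says that the
  derivative of \<open>s\<^sup>m\<^sup>/\<^sup>2\<close> is \<open>(m/2) z\<^sup>k\<^sup>/\<^sup>2 S\<close>. With \<open>H\<close> the weighted antiderivative of \<open>S\<close> this is solved by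
  \<open>s = z H\<^sup>2\<^sup>/\<^sup>m\<close>, where the power exists because \<open>H 0 = S 0 \<noteq> 0\<close>.
\<close>

lemma normalizing_coordinate:
  fixes F :: "complex \<Rightarrow> complex"
  assumes F: "F holomorphic_on ball 0 r" and r: "0 < r" and nz: "\<exists>z\<in>ball 0 r. F z \<noteq> 0"
  obtains k \<rho> s where "0 < \<rho>" "\<rho> \<le> r" "s holomorphic_on ball 0 \<rho>" "s 0 = 0"
    "\<And>z. z \<in> ball 0 \<rho> \<Longrightarrow> deriv s z \<noteq> 0 \<and> (deriv s z)\<^sup>2 * s z ^ k = F z"
proof -
  obtain k r1 G where r1: "0 < r1" "r1 \<le> r" and G: "G holomorphic_on ball 0 r1"
    and FG: "\<And>z. z \<in> ball 0 r1 \<Longrightarrow> F z = z ^ k * G z" and G0: "G 0 \<noteq> 0"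
  proof (cases "F 0 = 0")
    case False
    with F r show ?thesis by (intro that[of r F 0]) auto
  next
    case True
    have "\<not> F constant_on ball 0 r"
      using nz True r unfolding constant_on_def by (metis centre_in_ball)
    from holomorphic_factor_zero_nonconstant[OF F _ _ _ True this] r
    obtain g r' n where "0 < n" "0 < r'" "ball 0 r' \<subseteq> ball (0::complex) r" "g holomorphic_on ball 0 r'"
      and g: "\<And>w. w \<in> ball 0 r' \<Longrightarrow> F w = (w - 0) ^ n * g w" "\<And>w. w \<in> ball 0 r' \<Longrightarrow> g w \<noteq> 0"
      by (metis centre_in_ball connected_ball open_ball)
    then show ?thesis by (intro that[of r' g n]) (auto simp: subset_ball ball_subset_ball_iff)
  qed
  define m where "m = k + 2"
  have m: "m > 0" by (simp add: m_def)
  have contG: "isCont G 0"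
    using holomorphic_on_imp_continuous_on[OF G] r1 by (simp add: continuous_on_eq_continuous_at)
  obtain r2 where r2: "0 < r2" "r2 \<le> r1" "\<And>z. z \<in> ball 0 r2 \<Longrightarrow> G z \<noteq> 0"
  proof -
    have "\<forall>\<^sub>F z in nhds 0. G z \<noteq> 0"
      using tendsto_imp_eventually_ne[OF contG[unfolded isCont_def] G0] G0
      by (simp add: eventually_nhds_conv_at)
    then obtain e where "e > 0" "\<And>z. dist z 0 < e \<Longrightarrow> G z \<noteq> 0" unfolding eventually_nhds_metric by blast
    then show ?thesis using that[of "min e r1"] r1 by auto
  qed
  have Gr2: "G holomorphic_on ball 0 r2" by (rule holomorphic_on_subset[OF G]) (use r2 in auto)
  obtain S where S: "S holomorphic_on ball 0 r2" "\<And>z. z \<in> ball 0 r2 \<Longrightarrow> G z = (S z)\<^sup>2"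
    by (rule contractible_imp_holomorphic_sqrt[OF Gr2])
       (use r2(3) convex_imp_contractible[of "ball (0::complex) r2"] in auto)
  obtain H where H: "H holomorphic_on ball 0 r2" "H 0 = S 0"
    and HS: "\<And>z. z \<in> ball 0 r2 \<Longrightarrow> of_nat m * H z + 2 * z * deriv H z = of_nat m * S z"
    by (rule weighted_antiderivative[OF S(1) r2(1) m]) blast
  have H0: "H 0 \<noteq> 0" using H(2) S(2)[of 0] r2 by auto
  have contH: "isCont H 0"
    using holomorphic_on_imp_continuous_on[OF H(1)] r2 by (simp add: continuous_on_eq_continuous_at)
  obtain \<rho> where \<rho>: "0 < \<rho>" "\<rho> \<le> r2" "\<And>z. z \<in> ball 0 \<rho> \<Longrightarrow> H z \<noteq> 0"
  proof -
    have "\<forall>\<^sub>F z in nhds 0. H z \<noteq> 0"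
      using tendsto_imp_eventually_ne[OF contH[unfolded isCont_def] H0] H0
      by (simp add: eventually_nhds_conv_at)
    then obtain e where "e > 0" "\<And>z. dist z 0 < e \<Longrightarrow> H z \<noteq> 0" unfolding eventually_nhds_metric by blast
    then show ?thesis using that[of "min e r2"] r2 by auto
  qed
  have Hr: "H holomorphic_on ball 0 \<rho>" by (rule holomorphic_on_subset[OF H(1)]) (use \<rho> in auto)
  obtain L where L: "L holomorphic_on ball 0 \<rho>" "\<And>z. z \<in> ball 0 \<rho> \<Longrightarrow> H z = exp (L z)"
    by (rule contractible_imp_holomorphic_log[OF Hr])
       (use \<rho>(3) convex_imp_contractible[of "ball (0::complex) \<rho>"] in auto)
  \<comment> \<open>the branch of \<open>H\<^sup>2\<^sup>/\<^sup>m\<close> given by the logarithm \<open>L\<close> of \<open>H\<close>\<close>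
  define P where "P z = exp (2 / of_nat m * L z)" for z
  define s where "s z = z * P z" for z
  have P: "P holomorphic_on ball 0 \<rho>" unfolding P_def by (intro holomorphic_intros L)
  have s: "s holomorphic_on ball 0 \<rho>" unfolding s_def by (intro holomorphic_intros P)
  have Pm: "P z ^ m = (H z)\<^sup>2" if "z \<in> ball 0 \<rho>" for z
    unfolding P_def L(2)[OF that] exp_of_nat_mult[symmetric] using m by simp
  have ds: "deriv s z = P z * S z / H z" if z: "z \<in> ball 0 \<rho>" for z
  proof -
    have zr2: "z \<in> ball 0 r2" using z \<rho> by auto
    have dL: "(L has_field_derivative deriv L z) (at z)"
      by (rule holomorphic_derivI[OF L(1) open_ball z])
    have "((\<lambda>z. exp (L z)) has_field_derivative exp (L z) * deriv L z) (at z)"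
      by (auto intro!: derivative_eq_intros dL)
    then have "(H has_field_derivative exp (L z) * deriv L z) (at z)"
      by (rule has_field_derivative_transform_within_open[OF _ open_ball z]) (use L(2) in auto)
    then have dH: "deriv H z = H z * deriv L z" using DERIV_imp_deriv L(2)[OF z] by metis
    have "(s has_field_derivative P z * (1 + z * (2 / of_nat m * deriv L z))) (at z)"
      unfolding s_def P_def by (use m in \<open>auto intro!: derivative_eq_intros dL simp: algebra_simps\<close>)
    then have dsP: "deriv s z = P z * (1 + z * (2 / of_nat m * deriv L z))" by (rule DERIV_imp_deriv)
    have HQ: "H z * (1 + z * (2 / of_nat m * deriv L z)) = S z"
    proof -
      have "of_nat m * (H z * (1 + z * (2 / of_nat m * deriv L z))) = of_nat m * H z + 2 * z * deriv H z"
        using m by (simp add: dH algebra_simps)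
      also have "\<dots> = of_nat m * S z" by (rule HS[OF zr2])
      finally show ?thesis using m by simp
    qed
    have "S z / H z = 1 + z * (2 / of_nat m * deriv L z)"
      unfolding HQ[symmetric] by (rule nonzero_mult_div_cancel_left[OF \<rho>(3)[OF z]])
    then show ?thesis using dsP by (simp only: times_divide_eq_right[symmetric])
  qed
  show ?thesis
  proof (rule that[OF \<rho>(1) _ s])
    show "\<rho> \<le> r" using \<rho> r1 r2 by simp
    show "s 0 = 0" by (simp add: s_def)
    fix z :: complex assume z: "z \<in> ball 0 \<rho>"
    have zr: "z \<in> ball 0 r2" "z \<in> ball 0 r1" using z \<rho> r2 by auto
    have S0: "S z \<noteq> 0" using S(2)[OF zr(1)] r2(3)[OF zr(1)] by auto
    have "P z \<noteq> 0" by (simp add: P_def)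
    then have nz: "deriv s z \<noteq> 0" using ds[OF z] S0 \<rho>(3)[OF z] by simp
    have "(deriv s z)\<^sup>2 * s z ^ k = z ^ k * (S z)\<^sup>2 * (P z ^ m / (H z)\<^sup>2)"
      unfolding ds[OF z] s_def m_def by (simp add: power_mult_distrib power_add power_divide power2_eq_square)
    also have "\<dots> = F z" unfolding Pm[OF z] FG[OF zr(2)] S(2)[OF zr(1)] using \<rho>(3)[OF z] by simp
    finally show "deriv s z \<noteq> 0 \<and> (deriv s z)\<^sup>2 * s z ^ k = F z" using nz by blast
  qed
qed

text \<open>
  In the chart with coordinates \<open>t1, s \<circ> t2\<close> the coordinate frame is \<open>e\<close> and \<open>X / (s' \<circ> t2)\<close>, and the square
  of the latter is \<open>f / (s' \<circ> t2)\<^sup>2 e\<close>. In the nilpotent case \<open>s\<close> is the identity.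
\<close>

theorem local_normal_form:
  fixes M :: "2 fmanifold"
  assumes M: "F_manifold M" and p: "p \<in> base M"
  shows "(\<exists>m\<ge>2. germ_iso M p (I2 m) 0) \<or> germ_iso M p nilpotent_F 0"
proof -
  obtain U X f t1 t2 where U: "open U" "p \<in> U" "U \<subseteq> base M" and X: "holo_on X U" and f: "hol f U"
    and t1: "hol t1 U" "t1 p = 0" and t2: "hol t2 U" "t2 p = 0"
    and XX: "\<And>t. t \<in> U \<Longrightarrow> fmul M t (X t) (X t) = f t *s funit M t"
    and d: "\<And>t. t \<in> U \<Longrightarrow> dif t1 t (funit M t) = 1" "\<And>t. t \<in> U \<Longrightarrow> dif t2 t (funit M t) = 0"
      "\<And>t. t \<in> U \<Longrightarrow> dif t1 t (X t) = 0" "\<And>t. t \<in> U \<Longrightarrow> dif t2 t (X t) = 1"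
    and fe: "\<And>t. t \<in> U \<Longrightarrow> dif f t (funit M t) = 0"
    by (rule rectified_frame[OF M p]) blast
  define \<Phi> where "\<Phi> s t = (vector [t1 t, s (t2 t)] :: complex ^ 2)" for s :: "complex \<Rightarrow> complex" and t
  have n: "\<Phi> s t $ 1 = t1 t" "\<Phi> s t $ 2 = s (t2 t)" for s t by (simp_all add: \<Phi>_def)
  have chart: "holo_on (\<Phi> s) N"
    "t \<in> N \<Longrightarrow> jac (\<Phi> s) t (funit M t) = \<delta> 1"
    "t \<in> N \<Longrightarrow> jac (\<Phi> s) t ((1 / deriv s (t2 t)) *s X t) = \<delta> 2"
    if s: "s holomorphic_on S" "open S" and N: "open N" "N \<subseteq> U" "t2 ` N \<subseteq> S"
      and ds: "\<And>z. z \<in> S \<Longrightarrow> deriv s z \<noteq> 0" for s S N t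
  proof -
    have t1N: "hol t1 N" and t2N: "hol t2 N" using hol_subset N t1 t2 by blast+
    have c: "hol (\<lambda>t. \<Phi> s t $ i) N" for i
      using t1N hol_compose_holomorphic(1)[OF t2N s N(3)] exhaust_2[of i] by (auto simp: n)
    show h: "holo_on (\<Phi> s) N" by (rule holo_onI[OF N(1) c])
    have j: "jac (\<Phi> s) t v = (dif t1 t v) *s \<delta> 1 + (deriv s (t2 t) * dif t2 t v) *s \<delta> 2" if "t \<in> N" for t v
      by (simp add: vec_eq_iff forall_2 jac_nth[OF h that] n hol_compose_holomorphic(2)[OF t2N s N(3) that] axis_def)
    show "jac (\<Phi> s) t (funit M t) = \<delta> 1" if t: "t \<in> N"
    proof -
      have "t \<in> U" using t N by blast
      then show ?thesis unfolding j[OF t] using d by simp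
    qed
    show "jac (\<Phi> s) t ((1 / deriv s (t2 t)) *s X t) = \<delta> 2" if t: "t \<in> N"
    proof -
      have tU: "t \<in> U" using t N by blast
      have "t2 t \<in> S" using t N by blast
      then show ?thesis unfolding j[OF t] hol_dif_smult[OF t1 (1) tU] hol_dif_smult[OF t2(1) tU]
        using d[OF tU] ds by simp
    qed
  qed
  have idc: "holo_on (\<Phi> (\<lambda>z. z)) U"
    "\<And>t. t \<in> U \<Longrightarrow> jac (\<Phi> (\<lambda>z. z)) t (funit M t) = \<delta> 1"
    "\<And>t. t \<in> U \<Longrightarrow> jac (\<Phi> (\<lambda>z. z)) t (X t) = \<delta> 2"
    using chart[of "\<lambda>z. z" UNIV U] U by (auto simp: holomorphic_on_ident)
  have inj: "inj (jac (\<Phi> (\<lambda>z. z)) p)"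
  proof (rule linear_surjective_imp_injective[OF has_derivative_linear[OF holo_on_has_derivative[OF idc(1) U(2)]]])
    show "surj (jac (\<Phi> (\<lambda>z. z)) p)"
      unfolding surj_def
    proof
      fix y :: "complex ^ 2"
      have "jac (\<Phi> (\<lambda>z. z)) p ((y $ 1) *s funit M p + (y $ 2) *s X p) = y"
        by (simp add: jac_add[OF idc(1) U(2)] jac_smult[OF idc(1) U(2)] idc(2,3)[OF U(2)]
            vec_eq_iff forall_2 axis_def)
      then show "\<exists>x. y = jac (\<Phi> (\<lambda>z. z)) p x" by metis
    qed
  qed (rule refl)
  have z0: "\<Phi> s p = 0" if "s 0 = 0" for s using that t1(2) t2(2) by (simp add: vec_eq_iff forall_2 n)
  have zid: "\<Phi> (\<lambda>z. z) p = 0" by (rule z0) simp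
  obtain N r F where N: "open N" "p \<in> N" "N \<subseteq> U" "r > 0" "F holomorphic_on ball 0 r"
    and fF: "\<And>t. t \<in> N \<Longrightarrow> \<Phi> (\<lambda>z. z) t $ 2 \<in> ball 0 r \<and> f t = F (\<Phi> (\<lambda>z. z) t $ 2)"
    by (rule function_of_second_coordinate[OF idc(1) zid U(2) idc(2) inj f fe]) (assumption, assumption, rule that)
  show ?thesis
  proof (cases "\<exists>z\<in>ball 0 r. F z \<noteq> 0")
    case False
    have "germ_iso M p (plane_F (\<lambda>t. 0)) 0"
    proof (rule germ_iso_plane_F[where U = N and \<Phi> = "\<Phi> (\<lambda>z. z)" and X = X and g = "\<lambda>t. 0",
        OF M _ N(2) _ zid])
      show "holo_on (\<Phi> (\<lambda>z. z)) N" by (rule holo_on_subset[OF idc(1) N(1,3)])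
      show "fmul M t (X t) (X t) = 0 *s funit M t" if "t \<in> N" for t
        using XX[of t] fF[OF that] False that N(3) by auto
    qed (use N U idc in auto)
    then show ?thesis by (simp add: nilpotent_F_def)
  next
    case True
    obtain k \<rho> s where \<rho>: "0 < \<rho>" "\<rho> \<le> r" and s: "s holomorphic_on ball 0 \<rho>" "s 0 = 0"
      and ds: "\<And>z. z \<in> ball 0 \<rho> \<Longrightarrow> deriv s z \<noteq> 0 \<and> (deriv s z)\<^sup>2 * s z ^ k = F z"
      by (rule normalizing_coordinate[OF N(5,4) True]) blast
    define N' where "N' = N \<inter> t2 -` ball 0 \<rho>"
    have N': "open N'" "p \<in> N'" "N' \<subseteq> U" "N' \<subseteq> N" "t2 ` N' \<subseteq> ball 0 \<rho>"
      using N t2(2) \<rho>(1) continuous_open_preimage[OF continuous_on_subset[OF hol_continuous_on[OF t2(1)] N(3)] N(1) open_ball]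
      by (auto simp: N'_def)
    have ds0: "deriv s z \<noteq> 0" if "z \<in> ball 0 \<rho>" for z using ds[OF that] by blast
    note ch = chart[OF s(1) open_ball N'(1,3,5)]
    have ch: "holo_on (\<Phi> s) N'" "\<And>t. t \<in> N' \<Longrightarrow> jac (\<Phi> s) t (funit M t) = \<delta> 1"
      "\<And>t. t \<in> N' \<Longrightarrow> jac (\<Phi> s) t ((1 / deriv s (t2 t)) *s X t) = \<delta> 2"
      by (rule ch; simp add: ds0)+
    have "germ_iso M p (plane_F (\<lambda>t. (t $ 2) ^ k)) 0"
    proof (rule germ_iso_plane_F[where U = N' and \<Phi> = "\<Phi> s" and X = "\<lambda>t. (1 / deriv s (t2 t)) *s X t"
          and g = "\<lambda>t. (t $ 2) ^ k", OF M _ N'(2) ch(1) z0[of s, OF s(2)]])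
      fix t assume t: "t \<in> N'"
      then have tt: "t \<in> N" "t \<in> U" "t \<in> base M" "t2 t \<in> ball 0 \<rho>" using N' U by auto
      have "f t = (deriv s (t2 t))\<^sup>2 * s (t2 t) ^ k" using fF[OF tt(1)] ds[OF tt(4)] by (simp add: n)
      then show "fmul M t ((1 / deriv s (t2 t)) *s X t) ((1 / deriv s (t2 t)) *s X t) =
          (\<Phi> s t $ 2) ^ k *s funit M t"
        using ds0[OF tt(4)]
        by (simp add: fmul_linear[OF M tt(3)] XX[OF tt(2)] n power2_eq_square)
    qed (use ch N' U in auto)
    then have "germ_iso M p (I2 (k + 2)) 0" by (simp add: I2_def)
    then show ?thesis by (meson le_add2)
  qed
qed

section \<open>Lie derivatives of plane multiplications\<close>

lemma plane_fmul_nth: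
  "fmul (plane_F f) t v w $ 1 = v $ 1 * w $ 1 + v $ 2 * w $ 2 * f t"
  "fmul (plane_F f) t v w $ 2 = v $ 1 * w $ 2 + v $ 2 * w $ 1"
  by (simp_all add: plane_F_def axis_def)

lemma plane_base [simp]: "base (plane_F f) = UNIV" and plane_unit [simp]: "funit (plane_F f) t = \<delta> 1"
  by (simp_all add: plane_F_def)

lemma delta_nth [simp]: "\<delta> 1 $ 1 = (1::complex)" "\<delta> (1::2) $ 2 = (0::complex)" "\<delta> (2::2) $ 1 = (0::complex)"
  "\<delta> (2::2) $ 2 = (1::complex)"
  by (simp_all add: axis_def)

lemma hol_dif_expand_2:
  fixes f :: "complex ^ 2 \<Rightarrow> complex"
  shows "hol f U \<Longrightarrow> t \<in> U \<Longrightarrow> dif f t v = v $ 1 * dif f t (\<delta> 1) + v $ 2 * dif f t (\<delta> 2)"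
  by (simp add: hol_dif_expand[of f U t v] sum_2)

context
  fixes g g' :: "complex \<Rightarrow> complex"
  assumes g: "\<And>z. (g has_field_derivative g' z) (at z)"
begin

lemma
  assumes Z: "holo_on Z V" and W: "holo_on W V" and t: "t \<in> V"
  shows holo_plane_mul: "holo_on (field_mul (plane_F (\<lambda>t. g (t $ 2))) Z W) V"
    and dif_plane_mul_1: "dif (\<lambda>s. field_mul (plane_F (\<lambda>t. g (t $ 2))) Z W s $ 1) t v =
      dif (\<lambda>s. Z s $ 1) t v * W t $ 1 + Z t $ 1 * dif (\<lambda>s. W s $ 1) t v +
      (dif (\<lambda>s. Z s $ 2) t v * W t $ 2 + Z t $ 2 * dif (\<lambda>s. W s $ 2) t v) * g (t $ 2) +
      Z t $ 2 * W t $ 2 * (g' (t $ 2) * v $ 2)" (is ?D1)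
    and dif_plane_mul_2: "dif (\<lambda>s. field_mul (plane_F (\<lambda>t. g (t $ 2))) Z W s $ 2) t v =
      dif (\<lambda>s. Z s $ 1) t v * W t $ 2 + Z t $ 1 * dif (\<lambda>s. W s $ 2) t v +
      (dif (\<lambda>s. Z s $ 2) t v * W t $ 1 + Z t $ 2 * dif (\<lambda>s. W s $ 1) t v)" (is ?D2)
proof -
  note oV = holo_on_open[OF Z]
  note h = holo_on_nth[OF Z] holo_on_nth[OF W]
  have t2: "hol (\<lambda>t. t $ 2) V" by (simp add: oV)
  have gh: "hol (\<lambda>t. g (t $ 2)) V" by (rule hol_compose[OF t2 g])
  have gd: "dif (\<lambda>t. g (t $ 2)) t v = g' (t $ 2) * v $ 2" for v
    using dif_compose[OF t2 g t] by simp
  have "hol (\<lambda>s. field_mul (plane_F (\<lambda>t. g (t $ 2))) Z W s $ i) V" for i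
    using exhaust_2[of i]
    by (auto simp: field_mul_def plane_fmul_nth intro!: hol_add hol_mult h gh)
  then show "holo_on (field_mul (plane_F (\<lambda>t. g (t $ 2))) Z W) V" by (intro holo_onI oV)
  show ?D1
    unfolding field_mul_def plane_fmul_nth
      dif_add[OF hol_mult[OF h(1) h(2)] hol_mult[OF hol_mult[OF h(1) h(2)] gh] t]
      dif_mult[OF h(1) h(2) t] dif_mult[OF hol_mult[OF h(1) h(2)] gh t] gd
    by simp
  show ?D2
    unfolding field_mul_def plane_fmul_nth
      dif_add[OF hol_mult[OF h(1) h(2)] hol_mult[OF h(1) h(2)] t]
      dif_mult[OF h(1) h(2) t]
    by simp
qed

lemma lie_bracket_nth:
  assumes "holo_on X V" "holo_on Y V" "t \<in> V"
  shows "lie_bracket X Y t $ i = dif (\<lambda>s. Y s $ i) t (X t) - dif (\<lambda>s. X s $ i) t (Y t)"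
  by (simp add: lie_bracket_def jac_nth[OF assms(1,3)] jac_nth[OF assms(2,3)])

text \<open>
  All derivatives of \<open>Z\<close> and \<open>W\<close> cancel: \<open>Lie\<^sub>X(\<circ>)\<close> is a tensor. What remains involves \<open>X\<close>, its first
  partial derivatives and the values of \<open>Z\<close> and \<open>W\<close>.
\<close>

lemma lie_mul_plane:
  fixes X :: "complex ^ 2 \<Rightarrow> complex ^ 2"
  assumes X: "holo_on X V" and Z: "holo_on Z V" and W: "holo_on W V" and t: "t \<in> V"
  defines "a \<equiv> dif (\<lambda>s. X s $ 1) t (\<delta> 1)" and "b \<equiv> dif (\<lambda>s. X s $ 1) t (\<delta> 2)"
    and "c \<equiv> dif (\<lambda>s. X s $ 2) t (\<delta> 1)" and "d \<equiv> dif (\<lambda>s. X s $ 2) t (\<delta> 2)"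
  shows "lie_mul (plane_F (\<lambda>t. g (t $ 2))) X Z W t $ 1 =
      g' (t $ 2) * X t $ 2 * Z t $ 2 * W t $ 2
      - a * (Z t $ 1 * W t $ 1 + Z t $ 2 * W t $ 2 * g (t $ 2)) - b * (Z t $ 1 * W t $ 2 + Z t $ 2 * W t $ 1)
      + (a * Z t $ 1 + b * Z t $ 2) * W t $ 1 + (c * Z t $ 1 + d * Z t $ 2) * W t $ 2 * g (t $ 2)
      + Z t $ 1 * (a * W t $ 1 + b * W t $ 2) + Z t $ 2 * (c * W t $ 1 + d * W t $ 2) * g (t $ 2)" (is ?A)
    and "lie_mul (plane_F (\<lambda>t. g (t $ 2))) X Z W t $ 2 =
      - c * (Z t $ 1 * W t $ 1 + Z t $ 2 * W t $ 2 * g (t $ 2)) - d * (Z t $ 1 * W t $ 2 + Z t $ 2 * W t $ 1)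
      + (a * Z t $ 1 + b * Z t $ 2) * W t $ 2 + (c * Z t $ 1 + d * Z t $ 2) * W t $ 1
      + Z t $ 1 * (c * W t $ 1 + d * W t $ 2) + Z t $ 2 * (a * W t $ 1 + b * W t $ 2)" (is ?B)
proof -
  let ?M = "plane_F (\<lambda>t. g (t $ 2))"
  note ZW = holo_plane_mul[OF Z W t]
  have e1: "dif (\<lambda>s. X s $ 1) t v = v $ 1 * a + v $ 2 * b" for v
    unfolding a_def b_def by (rule hol_dif_expand_2[OF holo_on_nth[OF X] t])
  have e2: "dif (\<lambda>s. X s $ 2) t v = v $ 1 * c + v $ 2 * d" for v
    unfolding c_def d_def by (rule hol_dif_expand_2[OF holo_on_nth[OF X] t])
  have f: "field_mul ?M Z W t $ 1 = Z t $ 1 * W t $ 1 + Z t $ 2 * W t $ 2 * g (t $ 2)"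
     "field_mul ?M Z W t $ 2 = Z t $ 1 * W t $ 2 + Z t $ 2 * W t $ 1"
    by (simp_all add: field_mul_def plane_fmul_nth)
  show ?A
    unfolding lie_mul_def vector_minus_component lie_bracket_nth[OF X ZW t] dif_plane_mul_1[OF Z W t]
    unfolding field_mul_def plane_fmul_nth lie_bracket_nth[OF X Z t] lie_bracket_nth[OF X W t] e1 e2
    by (simp add: algebra_simps)
  show ?B
    unfolding lie_mul_def vector_minus_component lie_bracket_nth[OF X ZW t] dif_plane_mul_2[OF Z W t]
    unfolding field_mul_def plane_fmul_nth lie_bracket_nth[OF X Z t] lie_bracket_nth[OF X W t] e1 e2
    by (simp add: algebra_simps)
qed

text \<open>
  By \<open>lie_mul_plane\<close> the defining condition becomes a polynomial identity in the values and first
  partial derivatives of \<open>X\<close> and \<open>Y\<close> and the values of \<open>Z\<close>, \<open>W\<close>, \<open>g\<close> and \<open>g'\<close>.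
\<close>

lemma F_manifold_plane: "F_manifold (plane_F (\<lambda>t. g (t $ 2)))"
proof -
  let ?M = "plane_F (\<lambda>t. g (t $ 2))"
  have hg: "hol (\<lambda>t. g (t $ 2)) UNIV" by (rule hol_compose[OF _ g]) simp
  have "holo_on (\<lambda>t. fmul ?M t v w) UNIV" for v w
  proof (rule holo_onI)
    show "hol (\<lambda>t. fmul ?M t v w $ i) UNIV" for i
      using exhaust_2[of i] by (auto simp: plane_fmul_nth intro!: hol_add hol_mult hg)
  qed simp
  moreover have "lie_mul ?M (field_mul ?M X Y) Z W t =
      field_mul ?M X (lie_mul ?M Y Z W) t + field_mul ?M Y (lie_mul ?M X Z W) t"
    if X: "holo_on X V" and Y: "holo_on Y V" and Z: "holo_on Z V" and W: "holo_on W V" and t: "t \<in> V"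
    for V X Y Z W t
  proof -
    note XY = holo_plane_mul[OF X Y t]
    note d = dif_plane_mul_1[OF X Y t] dif_plane_mul_2[OF X Y t]
    show ?thesis
      unfolding vec_eq_iff forall_2 vector_add_component
      unfolding lie_mul_plane[OF XY Z W t] d
      unfolding field_mul_def plane_fmul_nth lie_mul_plane[OF X Z W t] lie_mul_plane[OF Y Z W t] delta_nth
      by (simp add: algebra_simps)
  qed
  moreover have "Vector_Spaces.linear (*s) (*s) (fmul ?M t v)"
      "Vector_Spaces.linear (*s) (*s) (\<lambda>w. fmul ?M t w v)" for t v
    by (rule vector_linearI; simp add: vec_eq_iff forall_2 plane_fmul_nth algebra_simps)+
  ultimately show ?thesis
    unfolding F_manifold_def
    by (auto simp: vec_eq_iff forall_2 plane_fmul_nth plane_F_def[THEN arg_cong, of funit]) (simp_all add: algebra_simps)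
qed

text \<open>
  By tensoriality it suffices to evaluate at pairs of coordinate fields; the pairs \<open>\<delta> 1, \<delta> 1\<close> and
  \<open>\<delta> 2, \<delta> 2\<close> already give the four equations, which conversely suffice for all arguments.
\<close>

lemma euler_field_plane_iff:
  assumes U: "open U"
  shows "euler_field ((plane_F (\<lambda>t. g (t $ 2)))\<lparr>base := U\<rparr>) d E \<longleftrightarrow> holo_on E U \<and>
    (\<forall>t\<in>U. dif (\<lambda>s. E s $ 1) t (\<delta> 1) = d \<and> dif (\<lambda>s. E s $ 1) t (\<delta> 2) = 0 \<and>
      dif (\<lambda>s. E s $ 2) t (\<delta> 1) = 0 \<and>
      g' (t $ 2) * E t $ 2 + 2 * g (t $ 2) * dif (\<lambda>s. E s $ 2) t (\<delta> 2) = 2 * d * g (t $ 2))"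
    (is "?L \<longleftrightarrow> ?R")
proof -
  let ?M = "plane_F (\<lambda>t. g (t $ 2))"
  have lm: "lie_mul (?M\<lparr>base := U\<rparr>) = lie_mul ?M" "field_mul (?M\<lparr>base := U\<rparr>) = field_mul ?M"
    by (simp_all add: lie_mul_def field_mul_def fun_eq_iff)
  show ?thesis
  proof
    assume L: ?L
    then have E: "holo_on E U" by (simp add: euler_field_def)
    have L2: "\<forall>V Z W. V \<subseteq> U \<and> holo_on Z V \<and> holo_on W V \<longrightarrow>
        (\<forall>t\<in>V. lie_mul ?M E Z W t = d *s field_mul ?M Z W t)"
      using L unfolding euler_field_def lm by simp
    have "lie_mul ?M E (\<lambda>_. v) (\<lambda>_. w) t = d *s field_mul ?M (\<lambda>_. v) (\<lambda>_. w) t" if "t \<in> U" for v w t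
      using L2[rule_format, of U "\<lambda>_. v" "\<lambda>_. w" t] that U by simp
    then have *: "lie_mul ?M E (\<lambda>_. v) (\<lambda>_. w) t $ i = (d *s field_mul ?M (\<lambda>_. v) (\<lambda>_. w) t) $ i"
      if "t \<in> U" for v w t i using that by simp
    show ?R
    proof (intro conjI ballI E)
      fix t assume t: "t \<in> U"
      have c: "holo_on (\<lambda>_. v) U" for v :: "complex ^ 2" using U by simp
      note l = lie_mul_plane[OF E c c t]
      note s = field_mul_def plane_fmul_nth vector_smult_component
      show 1: "dif (\<lambda>s. E s $ 1) t (\<delta> 1) = d"
        using *[OF t, of "\<delta> 1" "\<delta> 1" 1] unfolding l s by simp
      show 2: "dif (\<lambda>s. E s $ 2) t (\<delta> 1) = 0"
        using *[OF t, of "\<delta> 1" "\<delta> 1" 2] unfolding l s by simp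
      show "dif (\<lambda>s. E s $ 1) t (\<delta> 2) = 0"
        using *[OF t, of "\<delta> 2" "\<delta> 2" 2] unfolding l s by (simp add: 2)
      show "g' (t $ 2) * E t $ 2 + 2 * g (t $ 2) * dif (\<lambda>s. E s $ 2) t (\<delta> 2) = 2 * d * g (t $ 2)"
        using *[OF t, of "\<delta> 2" "\<delta> 2" 1] unfolding l s by (simp add: 1 algebra_simps)
    qed
  next
    assume R: ?R
    then have E: "holo_on E U" by blast
    show ?L
      unfolding euler_field_def lm
    proof (intro conjI allI impI ballI, goal_cases)
      case 1
      then show ?case using E by simp
    next
      case (2 V Z W t)
      then have V: "V \<subseteq> U" and Z: "holo_on Z V" and W: "holo_on W V" and t: "t \<in> V" "t \<in> U" by auto
      have EV: "holo_on E V" by (rule holo_on_subset[OF E holo_on_open[OF Z] V])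
      have eqs: "dif (\<lambda>s. E s $ 1) t (\<delta> 1) = d" "dif (\<lambda>s. E s $ 1) t (\<delta> 2) = 0"
        "dif (\<lambda>s. E s $ 2) t (\<delta> 1) = 0"
        and e4: "g' (t $ 2) * E t $ 2 = 2 * d * g (t $ 2) - 2 * g (t $ 2) * dif (\<lambda>s. E s $ 2) t (\<delta> 2)"
        using R t(2) by (auto simp: algebra_simps)
      show ?case
        unfolding vec_eq_iff forall_2 vector_smult_component lie_mul_plane[OF EV Z W t(1)] eqs e4
        by (simp add: field_mul_def plane_fmul_nth algebra_simps)
    qed
  qed
qed

end

section \<open>Semisimplicity and decompositions into local algebras\<close>

text \<open>
  If \<open>r\<^sup>2 = f t \<noteq> 0\<close>, the two characters \<open>v\<^sub>1 \<plusminus> r v\<^sub>2\<close> identify the algebra with a product of two copies of the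
  complex numbers; if \<open>f t = 0\<close>, then \<open>\<delta> 2\<close> is a nonzero nilpotent element.
\<close>

lemma semisimple_plane_iff: "semisimple_at (plane_F f) t \<longleftrightarrow> f t \<noteq> 0"
proof
  assume "semisimple_at (plane_F f) t"
  then obtain h :: "complex ^ 2 \<Rightarrow> complex ^ 2" where lin: "Vector_Spaces.linear (*s) (*s) h" and b: "bij h"
    and m: "\<And>v w. h (fmul (plane_F f) t v w) = h v * h w" unfolding semisimple_at_def by blast
  interpret Vector_Spaces.linear "(*s)" "(*s)" h by (rule lin)
  show "f t \<noteq> 0"
  proof
    assume "f t = 0"
    then have "h (\<delta> 2) * h (\<delta> 2) = 0" using m[of "\<delta> 2" "\<delta> 2"] zero by (simp add: plane_F_basis)
    then have "h (\<delta> 2) $ i * h (\<delta> 2) $ i = 0" for i by (metis vector_mult_component zero_index)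
    then have "h (\<delta> 2) = h 0" using zero by (simp add: vec_eq_iff)
    then have "\<delta> 2 = (0 :: complex ^ 2)" using bij_is_inj[OF b] injD by metis
    then show False by (simp add: axis_eq_0_iff)
  qed
next
  assume ft: "f t \<noteq> 0"
  define r where "r = csqrt (f t)"
  have r: "r * r = f t" "r \<noteq> 0" using ft by (auto simp: r_def power2_eq_square[symmetric])
  define h :: "complex ^ 2 \<Rightarrow> complex ^ 2" where "h v = vector [v $ 1 + r * v $ 2, v $ 1 - r * v $ 2]" for v
  define k :: "complex ^ 2 \<Rightarrow> complex ^ 2" where "k v = vector [(v $ 1 + v $ 2) / 2, (v $ 1 - v $ 2) / (2 * r)]" for v
  show "semisimple_at (plane_F f) t"
    unfolding semisimple_at_def
  proof (intro exI conjI allI)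
    show "Vector_Spaces.linear (*s) (*s) h"
      by (rule vector_linearI) (simp_all add: h_def vec_eq_iff forall_2 algebra_simps)
    show "bij h"
    proof (rule o_bij[of k])
      show "k \<circ> h = id" using r(2) by (auto simp: fun_eq_iff h_def k_def vec_eq_iff forall_2)
      show "h \<circ> k = id" using r(2) by (auto simp: fun_eq_iff h_def k_def vec_eq_iff forall_2 field_simps)
    qed
    show "h (fmul (plane_F f) t v w) = h v * h w" for v w
      by (simp add: h_def vec_eq_iff forall_2 plane_fmul_nth algebra_simps r(1)[symmetric])
    show "h (funit (plane_F f) t) = 1"
      by (simp add: h_def vec_eq_iff forall_2)
  qed
qed

lemma alg_partition_eqI:
  assumes "local_decomposition mu D" "\<And>D'. local_decomposition mu D' \<Longrightarrow> D' = D"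
  shows "alg_partition mu = image_mset vec.dim (mset_set D)"
  unfolding alg_partition_def using assms by (intro the_equality) blast+

lemma zero_not_local: "\<not> local_algebra mu {0}"
proof
  assume "local_algebra mu {0}"
  then obtain J where J: "alg_maximal_ideal mu {0} J" unfolding local_algebra_def by blast
  then have "vec.subspace J" "J \<subseteq> {0}" "J \<noteq> {0}" unfolding alg_maximal_ideal_def alg_ideal_def by auto
  then show False using vec.subspace_0 by blast
qed

text \<open>
  The only ideals are \<open>{0}\<close>, the whole algebra and the lines \<open>L r\<close> and \<open>L (- r)\<close> spanned by the two
  idempotents. The lines are local and the other two are not, so they are the only possible summands,
  and neither can be omitted.
\<close>

lemma alg_partition_semisimple:
  assumes ft: "f t \<noteq> 0"
  shows "alg_partition (fmul (plane_F f) t) = {#1, 1#}"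
proof -
  let ?mu = "fmul (plane_F f) t"
  define r where "r = csqrt (f t)"
  have r: "r * r = f t" "r \<noteq> 0" using ft by (auto simp: r_def power2_eq_square[symmetric])
  \<comment> \<open>For a square root \<open>s\<close> of \<open>f t\<close>, \<open>l s\<close> is a character, \<open>e s\<close> the idempotent on which it is \<open>1\<close>, and \<open>L s\<close> the line of \<open>e s\<close>.\<close>
  define l :: "complex \<Rightarrow> complex ^ 2 \<Rightarrow> complex" where "l s x = x $ 1 + s * x $ 2" for s x
  define e :: "complex \<Rightarrow> complex ^ 2" where "e s = vector [1 / 2, 1 / (2 * s)]" for s
  define L where "L s = {x. l (- s) x = 0}" for s
  have l_lin: "l s (x + y) = l s x + l s y" "l s (c *s x) = c * l s x" for s x y c
    by (simp_all add: l_def algebra_simps)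
  have le: "l s (e s) = 1" "l (- s) (e s) = 0" "l s (e (- s)) = 0" if "s \<noteq> 0" for s
    using that by (auto simp: l_def e_def)
  have ll: "l s (?mu x y) = l s x * l s y" if "s * s = f t" for s x y
    by (simp add: l_def plane_fmul_nth algebra_simps that[symmetric])
  have ex: "x = l s x *s e s + l (- s) x *s e (- s)" if "s \<noteq> 0" for s x
    using that by (simp add: l_def e_def vec_eq_iff forall_2 field_simps)
  have l_eq: "x = y" if "l s x = l s y" "l (- s) x = l (- s) y" "s \<noteq> 0" for s x y
    using ex[OF that(3), of x] ex[OF that(3), of y] that by metis
  have emul: "?mu (e s) x = l s x *s e s" if "s * s = f t" "s \<noteq> 0" for s x
    by (rule l_eq[of s]) (use that in \<open>simp_all add: ll le l_lin\<close>)
  have LE: "x = l s x *s e s" if "x \<in> L s" "s \<noteq> 0" for s x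
    using ex[of s x] that by (simp add: L_def)
  have eL: "e s \<in> L s" if "s \<noteq> 0" for s using le[OF that] by (simp add: L_def)
  have subL: "vec.subspace (L s)" for s
    unfolding vec.subspace_def by (auto simp: L_def l_lin) (simp add: l_def)
  have subspaces: "J = {0} \<or> J = L s" if J: "vec.subspace J" "J \<subseteq> L s" and s: "s \<noteq> 0" for J s
  proof (cases "J = {0}")
    case False
    then obtain x where x: "x \<in> J" "x \<noteq> 0" using vec.subspace_0[OF J(1)] by blast
    have xs: "x = l s x *s e s" using LE x(1) J(2) s by blast
    with x have "l s x \<noteq> 0" by (metis vec.scale_zero_left)
    have "e s = (1 / l s x) *s x" by (subst xs) (simp add: l_lin le[OF s] \<open>l s x \<noteq> 0\<close>)
    then have "e s \<in> J" using vec.subspace_scale[OF J(1) x(1)] by simp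
    then have "L s \<subseteq> J" using LE[OF _ s] vec.subspace_scale[OF J(1)] by (metis subsetI)
    then show ?thesis using J by blast
  qed simp
  have ideals: "A = {0} \<or> A = L r \<or> A = L (- r) \<or> A = UNIV" if "alg_ideal ?mu UNIV A" for A
  proof -
    have A: "vec.subspace A" "\<And>x y. y \<in> A \<Longrightarrow> ?mu x y \<in> A" using that by (auto simp: alg_ideal_def)
    have eA: "e s \<in> A" if "x \<in> A" "l s x \<noteq> 0" "s * s = f t" "s \<noteq> 0" for s x
    proof -
      have "l s x *s e s \<in> A" using A(2)[OF that(1), of "e s"] emul that by simp
      from vec.subspace_scale[OF A(1) this, of "1 / l s x"] show ?thesis using that by simp
    qed
    consider "A \<subseteq> L r" | "A \<subseteq> L (- r)" | x y where "x \<in> A" "l (- r) x \<noteq> 0" "y \<in> A" "l r y \<noteq> 0"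
      unfolding L_def by auto
    then show ?thesis
    proof cases
      case 1
      then show ?thesis using subspaces[OF A(1)] r(2) by blast
    next
      case 2
      then have "A = {0} \<or> A = L (- r)" by (rule subspaces[OF A(1)]) (use r(2) in simp)
      then show ?thesis by blast
    next
      case 3
      have "e r \<in> A" "e (- r) \<in> A" using eA[OF 3(1,2)] eA[OF 3(3,4)] r by auto
      then have "x \<in> A" for x
        using ex[OF r(2), of x] vec.subspace_add[OF A(1)] vec.subspace_scale[OF A(1)] by metis
      then show ?thesis by blast
    qed
  qed
  have idL: "alg_ideal ?mu UNIV (L s)" if "s * s = f t" for s
    unfolding alg_ideal_def using subL ll[of "- s"] that by (auto simp: L_def)
  have e0: "e s \<noteq> 0" for s by (simp add: e_def vec_eq_iff forall_2)
  have neq: "L r \<noteq> L (- r)" "L s \<noteq> {0}" "L s \<noteq> UNIV" if "s \<noteq> 0" for s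
  proof -
    have "e r \<in> L r" "e r \<notin> L (- r)" using le[OF r(2)] by (simp_all add: L_def)
    then show "L r \<noteq> L (- r)" by blast
    show "L s \<noteq> {0}" using eL[OF that] e0 by blast
    have "e (- s) \<notin> L s" using le(1)[of "- s"] that by (simp add: L_def)
    then show "L s \<noteq> UNIV" by blast
  qed
  have loc: "local_algebra ?mu (L s)" if s: "s * s = f t" "s \<noteq> 0" for s
    unfolding local_algebra_def
  proof (intro conjI)
    show "\<exists>u\<in>L s. \<forall>x\<in>L s. ?mu u x = x"
    proof (intro bexI[of _ "e s"] ballI eL[OF s(2)])
      show "?mu (e s) x = x" if "x \<in> L s" for x using emul[OF s, of x] LE[OF that s(2)] by simp
    qed
    show "\<exists>!J. alg_maximal_ideal ?mu (L s) J"
    proof (rule ex1I[of _ "{0}"])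
      have "?mu x 0 = 0" for x by (simp add: vec_eq_iff forall_2 plane_fmul_nth)
      then have "alg_ideal ?mu (L s) {0}"
        unfolding alg_ideal_def using vec.subspace_0[OF subL] by simp
      moreover have "K = {0} \<or> K = L s" if "alg_ideal ?mu (L s) K" for K
        using that subspaces[OF _ _ s(2)] unfolding alg_ideal_def by blast
      ultimately show "alg_maximal_ideal ?mu (L s) {0}"
        unfolding alg_maximal_ideal_def using neq(2)[OF s(2)] by blast
      fix J assume "alg_maximal_ideal ?mu (L s) J"
      then have "vec.subspace J" "J \<subseteq> L s" "J \<noteq> L s"
        unfolding alg_maximal_ideal_def alg_ideal_def by simp_all
      then show "J = {0}" using subspaces[OF _ _ s(2)] by blast
    qed
  qed
  have notU: "\<not> local_algebra ?mu UNIV"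
  proof
    assume "local_algebra ?mu UNIV"
    then have u: "J = K" if "alg_maximal_ideal ?mu UNIV J" "alg_maximal_ideal ?mu UNIV K" for J K
      using that unfolding local_algebra_def by blast
    have max: "alg_maximal_ideal ?mu UNIV (L s)" if s: "s = r \<or> s = - r" for s
      unfolding alg_maximal_ideal_def
    proof (intro conjI allI impI)
      have ss: "s * s = f t" "s \<noteq> 0" using s r by auto
      show "alg_ideal ?mu UNIV (L s)" by (rule idL[OF ss(1)])
      show "L s \<noteq> UNIV" by (rule neq(3)[OF ss(2)])
      fix K assume K: "alg_ideal ?mu UNIV K \<and> L s \<subseteq> K"
      have "e s \<in> K" using K eL[OF ss(2)] by blast
      moreover have "e s \<notin> L (- s)" using le[OF ss(2)] by (simp add: L_def)
      ultimately have "K \<noteq> L (- s)" "K \<noteq> {0}" using e0 by auto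
      moreover have "K = {0} \<or> K = L s \<or> K = L (- s) \<or> K = UNIV"
      proof -
        have "L s = L r \<and> L (- s) = L (- r) \<or> L s = L (- r) \<and> L (- s) = L r" using s by auto
        then show ?thesis using ideals[of K] K by (elim disjE conjE) (simp_all add: disj_ac)
      qed
      ultimately show "K = L s \<or> K = UNIV" by blast
    qed
    show False using u[OF max max] neq(1)[OF r(2)] by auto
  qed
  let ?D = "{L r, L (- r)}"
  have dec: "local_decomposition ?mu ?D"
    unfolding local_decomposition_def
  proof (intro conjI ballI allI)
    show "alg_ideal ?mu UNIV A" "local_algebra ?mu A" if "A \<in> ?D" for A
      using that idL loc r by auto
    fix x
    let ?g = "\<lambda>A\<in>?D. if A = L r then l r x *s e r else l (- r) x *s e (- r)"
    show "\<exists>!f. f \<in> (\<Pi>\<^sub>E A\<in>?D. A) \<and> (\<Sum>A\<in>?D. f A) = x"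
    proof (rule ex1I[of _ ?g])
      have "l r x *s e r \<in> L r" "l (- r) x *s e (- r) \<in> L (- r)"
        using vec.subspace_scale[OF subL eL] r(2) by auto
      then show "?g \<in> (\<Pi>\<^sub>E A\<in>?D. A) \<and>
         (\<Sum>A\<in>?D. ?g A) = x"
        using neq(1)[OF r(2)] ex[OF r(2), of x] by auto
      fix f assume f: "f \<in> (\<Pi>\<^sub>E A\<in>?D. A) \<and> (\<Sum>A\<in>?D. f A) = x"
      then have f1: "f (L r) \<in> L r" "f (L (- r)) \<in> L (- r)" "f (L r) + f (L (- r)) = x"
        and f2: "\<And>A. A \<notin> ?D \<Longrightarrow> f A = undefined"
        using neq(1)[OF r(2)] by (auto simp: PiE_def extensional_def Pi_def)
      have "l r x = l r (f (L r))" "l (- r) x = l (- r) (f (L (- r)))"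
        unfolding f1(3)[symmetric] l_lin using f1(1,2) by (auto simp: L_def)
      then have "f (L r) = l r x *s e r" "f (L (- r)) = l (- r) x *s e (- r)"
        using LE[OF f1(1) r(2)] LE[OF f1(2)] r(2) by auto
      then show "f = ?g"
        using f2 neq(1)[OF r(2)] by (auto simp: fun_eq_iff)
    qed
  qed simp
  have uniq: "D = ?D" if D: "local_decomposition ?mu D" for D
  proof -
    have "A = L r \<or> A = L (- r)" if "A \<in> D" for A
    proof -
      have "alg_ideal ?mu UNIV A" "local_algebra ?mu A"
        using D that unfolding local_decomposition_def by simp_all
      then show ?thesis using ideals[of A] notU zero_not_local[of ?mu] by auto
    qed
    then have sub: "D \<subseteq> ?D" by blast
    have "L s \<in> D" if s: "s = r \<or> s = - r" for s
    proof (rule ccontr)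
      assume n: "L s \<notin> D"
      have s0: "s \<noteq> 0" using s r by auto
      have Ds: "A = L (- s)" if "A \<in> D" for A using sub n that s by auto
      obtain f where f: "f \<in> (\<Pi>\<^sub>E A\<in>D. A)" "(\<Sum>A\<in>D. f A) = e s"
        using D unfolding local_decomposition_def by metis
      have "f A \<in> L (- s)" if "A \<in> D" for A using f(1) Ds[OF that] that by (metis PiE_mem)
      then have "e s \<in> L (- s)" unfolding f(2)[symmetric] by (rule vec.subspace_sum[OF subL])
      then show False using le[OF s0] by (simp add: L_def)
    qed
    then show ?thesis using sub by auto
  qed
  have dim: "vec.dim (L s) = 1" if "s \<noteq> 0" for s
  proof -
    have "vec.span {e s} = L s"
    proof
      show "vec.span {e s} \<subseteq> L s" using eL[OF that] by (intro vec.span_minimal subL) auto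
      show "L s \<subseteq> vec.span {e s}" using LE[OF _ that] by (metis insertI1 subsetI vec.span_base vec.span_scale)
    qed
    then show ?thesis using vec.dim_eq_card[of "{e s}" "L s"] e0[of s] vec.span_eq_iff[THEN iffD2, OF subL]
      by (simp add: vec.dependent_single)
  qed
  have "alg_partition ?mu = image_mset vec.dim (mset_set ?D)"
    by (rule alg_partition_eqI[OF dec uniq])
  then show ?thesis using neq(1)[OF r(2)] dim r(2) by simp
qed

text \<open>
  The only ideals are \<open>{0}\<close>, the line \<open>N\<close> of nilpotent elements and the whole algebra, since every
  element outside \<open>N\<close> is invertible. Only the whole algebra is local.
\<close>

lemma alg_partition_nilpotent:
  assumes ft: "f t = 0"
  shows "alg_partition (fmul (plane_F f) t) = {#2#}"
proof -
  let ?mu = "fmul (plane_F f) t"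
  define N :: "(complex ^ 2) set" where "N = {x. x $ 1 = 0}"
  note mu = plane_fmul_nth[of f t, unfolded ft]
  have subN: "vec.subspace N" unfolding vec.subspace_def by (auto simp: N_def)
  have Nx: "x = x $ 2 *s \<delta> 2" if "x \<in> N" for x using that by (simp add: N_def vec_eq_iff forall_2)
  have ideals: "A = {0} \<or> A = N \<or> A = UNIV" if "alg_ideal ?mu UNIV A" for A
  proof -
    have A: "vec.subspace A" "\<And>x y. y \<in> A \<Longrightarrow> ?mu x y \<in> A" using that by (auto simp: alg_ideal_def)
    show ?thesis
    proof (cases "A \<subseteq> N")
      case True
      show ?thesis
      proof (cases "A = {0}")
        case False
        then obtain x where x: "x \<in> A" "x \<noteq> 0" using vec.subspace_0[OF A(1)] by blast
        have "x $ 2 \<noteq> 0" using x True by (auto simp: N_def vec_eq_iff forall_2)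
        have "\<delta> 2 = (1 / x $ 2) *s x" using x True \<open>x $ 2 \<noteq> 0\<close> by (auto simp: N_def vec_eq_iff forall_2)
        then have "\<delta> 2 \<in> A" using vec.subspace_scale[OF A(1) x(1)] by simp
        then have "N \<subseteq> A" using Nx vec.subspace_scale[OF A(1)] by (metis subsetI)
        then show ?thesis using True by blast
      qed simp
    next
      case False
      then obtain x where x: "x \<in> A" "x $ 1 \<noteq> 0" by (auto simp: N_def)
      have "y \<in> A" for y
      proof -
        \<comment> \<open>the vector is the inverse of \<open>x\<close>\<close>
        have "?mu (?mu y (vector [1 / x $ 1, - x $ 2 / (x $ 1 * x $ 1)])) x = y"
          using x(2) by (simp add: vec_eq_iff forall_2 mu field_simps)
        then show ?thesis using A(2)[OF x(1)] by metis
      qed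
      then show ?thesis by blast
    qed
  qed
  have "(\<delta> 1 :: complex ^ 2) \<notin> N" by (simp add: N_def)
  then have NU: "N \<noteq> UNIV" by blast
  have d2: "\<delta> 2 \<in> N" by (simp add: N_def)
  have N0: "N \<noteq> {0}" using d2 by (auto simp: axis_eq_0_iff)
  have notN: "\<not> local_algebra ?mu N"
  proof
    assume "local_algebra ?mu N"
    then obtain u where "u \<in> N" "?mu u (\<delta> 2) = \<delta> 2" unfolding local_algebra_def using d2 by blast
    then have "?mu u (\<delta> 2) $ 2 = 1" by simp
    then show False using \<open>u \<in> N\<close> by (simp add: mu N_def)
  qed
  have idN: "alg_ideal ?mu UNIV N" unfolding alg_ideal_def using subN by (auto simp: N_def mu)
  have idU: "alg_ideal ?mu UNIV UNIV" unfolding alg_ideal_def by simp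
  have locU: "local_algebra ?mu UNIV"
    unfolding local_algebra_def
  proof (intro conjI)
    show "\<exists>u\<in>UNIV. \<forall>x\<in>UNIV. ?mu u x = x" using plane_F_basis(1)[of f t] by blast
    show "\<exists>!J. alg_maximal_ideal ?mu UNIV J"
    proof (rule ex1I[of _ N])
      show "alg_maximal_ideal ?mu UNIV N" unfolding alg_maximal_ideal_def
        using idN NU N0 ideals vec.subspace_0[OF subN] by blast
      show "J = N" if "alg_maximal_ideal ?mu UNIV J" for J
        using that ideals[of J] idN NU N0 vec.subspace_0[OF subN] unfolding alg_maximal_ideal_def
        by (metis empty_subsetI insert_subset)
    qed
  qed
  have dec: "local_decomposition ?mu {UNIV}"
    unfolding local_decomposition_def
  proof (intro conjI ballI allI)
    show "alg_ideal ?mu UNIV A" "local_algebra ?mu A" if "A \<in> {UNIV}" for A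
      using that idU locU by auto
    fix x
    show "\<exists>!f. f \<in> (\<Pi>\<^sub>E A\<in>{UNIV}. A) \<and> (\<Sum>A\<in>{UNIV}. f A) = x"
      by (rule ex1I[of _ "\<lambda>A\<in>{UNIV}. x"]) (auto simp: fun_eq_iff PiE_def extensional_def)
  qed simp
  have uniq: "D = {UNIV}" if D: "local_decomposition ?mu D" for D
  proof -
    have "A = UNIV" if "A \<in> D" for A
    proof -
      have "alg_ideal ?mu UNIV A" "local_algebra ?mu A"
        using D that unfolding local_decomposition_def by simp_all
      then show ?thesis using ideals[of A] notN zero_not_local[of ?mu] by auto
    qed
    then have "D \<subseteq> {UNIV}" by blast
    moreover have "D \<noteq> {}"
    proof
      assume "D = {}"
      then have "0 = (\<delta> 2 :: complex ^ 2)" using D unfolding local_decomposition_def by auto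
      then have "(0 :: complex ^ 2) $ 2 = \<delta> 2 $ 2" by simp
      then show False by simp
    qed
    ultimately show ?thesis by blast
  qed
  have "alg_partition ?mu = image_mset vec.dim (mset_set {UNIV :: (complex ^ 2) set})"
    by (rule alg_partition_eqI[OF dec uniq])
  then show ?thesis by (simp add: card_cart_basis)
qed

lemma generic_partition_eqI:
  assumes gen: "generically (base M) (\<lambda>t. alg_partition (fmul M t) = P)" and ne: "base M \<noteq> {}"
  shows "generic_partition M = P"
  unfolding generic_partition_def
proof (rule the_equality)
  show "generically (base M) (\<lambda>t. alg_partition (fmul M t) = P)" by (rule gen)
next
  fix Q assume "generically (base M) (\<lambda>t. alg_partition (fmul M t) = Q)"
  then obtain W' where W': "open W'" "W' \<subseteq> base M" "base M \<subseteq> closure W'" "\<forall>t\<in>W'. alg_partition (fmul M t) = Q"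
    unfolding generically_def by blast
  obtain W where W: "open W" "W \<subseteq> base M" "base M \<subseteq> closure W" "\<forall>t\<in>W. alg_partition (fmul M t) = P"
    using gen unfolding generically_def by blast
  have "W' \<noteq> {}" using W'(3) ne by auto
  then have "W' \<inter> closure W \<noteq> {}" using W'(2) W(3) by blast
  then have "W' \<inter> W \<noteq> {}" using open_Int_closure_eq_empty[OF W'(1)] by blast
  then obtain t where "t \<in> W'" "t \<in> W" by blast
  then show "Q = P" using W(4) W'(4) by force
qed

section \<open>The massive and the non-massive case\<close>

lemma germ_isoE:
  assumes "germ_iso M p N q"
  obtains U V \<phi> \<psi> where "open U" "U \<subseteq> base M" "p \<in> U" "open V" "V \<subseteq> base N" "\<phi> p = q"
    "holo_on \<phi> U" "holo_on \<psi> V" "\<phi> ` U = V" "\<psi> ` V = U"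
    "\<And>t. t \<in> U \<Longrightarrow> \<psi> (\<phi> t) = t" "\<And>s. s \<in> V \<Longrightarrow> \<phi> (\<psi> s) = s"
    "\<And>t. t \<in> U \<Longrightarrow> jac \<phi> t (funit M t) = funit N (\<phi> t)"
    "\<And>t v w. t \<in> U \<Longrightarrow> jac \<phi> t (fmul M t v w) = fmul N (\<phi> t) (jac \<phi> t v) (jac \<phi> t w)"
    "\<And>t. t \<in> U \<Longrightarrow> bij (jac \<phi> t)"
proof -
  obtain U V \<phi> \<psi> where *: "U \<subseteq> base M" "p \<in> U" "V \<subseteq> base N" "\<phi> p = q"
    "holo_on \<phi> U" "holo_on \<psi> V" "\<phi> ` U = V" "\<psi> ` V = U"
    "\<forall>t\<in>U. \<psi> (\<phi> t) = t" "\<forall>s\<in>V. \<phi> (\<psi> s) = s"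
    "\<forall>t\<in>U. jac \<phi> t (funit M t) = funit N (\<phi> t)"
    "\<forall>t\<in>U. \<forall>v w. jac \<phi> t (fmul M t v w) = fmul N (\<phi> t) (jac \<phi> t v) (jac \<phi> t w)"
    using assms unfolding germ_iso_def by (elim exE conjE) (rule that)
  have bij: "bij (jac \<phi> t)" if t: "t \<in> U" for t
  proof (rule o_bij[of "jac \<psi> (\<phi> t)"])
    have "\<phi> t \<in> V" using t *(7) by blast
    show "jac \<psi> (\<phi> t) \<circ> jac \<phi> t = id"
      using jac_inverse[OF *(5,6,7,8) _ t] *(9) by (auto simp: fun_eq_iff)
    have "jac \<phi> (\<psi> (\<phi> t)) (jac \<psi> (\<phi> t) v) = v" for v
      by (rule jac_inverse[OF *(6,5,8,7) _ \<open>\<phi> t \<in> V\<close>]) (use *(10) in blast)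
    then show "jac \<phi> t \<circ> jac \<psi> (\<phi> t) = id" using *(9) t by (auto simp: fun_eq_iff)
  qed
  show ?thesis
    by (rule that[of U V \<phi> \<psi>]) (use * bij holo_on_open in auto)
qed

lemma semisimple_transfer:
  fixes M N :: "'n::finite fmanifold"
  assumes lin: "Vector_Spaces.linear (*s) (*s) J" and bij: "bij J" and u: "J (funit M t) = funit N s"
    and m: "\<And>v w. J (fmul M t v w) = fmul N s (J v) (J w)"
  shows "semisimple_at M t \<longleftrightarrow> semisimple_at N s"
proof
  interpret J: Vector_Spaces.linear "(*s)" "(*s)" J by (rule lin)
  show "semisimple_at M t" if ss: "semisimple_at N s"
  proof -
    obtain h :: "complex ^ 'n \<Rightarrow> complex ^ 'n" where h: "Vector_Spaces.linear (*s) (*s) h" "bij h"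
      "\<And>v w. h (fmul N s v w) = h v * h w" "h (funit N s) = 1"
      using ss unfolding semisimple_at_def by blast
    interpret h: Vector_Spaces.linear "(*s)" "(*s)" h by (rule h(1))
    show ?thesis unfolding semisimple_at_def
      by (rule exI[of _ "h \<circ> J"])
         (auto intro!: vector_linearI bij_comp bij h(2) simp: J.add h.add J.scale h.scale h m u)
  qed
  show "semisimple_at N s" if ss: "semisimple_at M t"
  proof -
    obtain h :: "complex ^ 'n \<Rightarrow> complex ^ 'n" where h: "Vector_Spaces.linear (*s) (*s) h" "bij h"
      "\<And>v w. h (fmul M t v w) = h v * h w" "h (funit M t) = 1"
      using ss unfolding semisimple_at_def by blast
    interpret h: Vector_Spaces.linear "(*s)" "(*s)" h by (rule h(1))
    define K where "K = inv J"
    have JK: "J (K v) = v" and KJ: "K (J w) = w" for v w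
      unfolding K_def using bij by (simp_all add: bij_is_surj surj_f_inv_f bij_is_inj)
    have inj: "a = b" if "J a = J b" for a b using that bij_is_inj[OF bij] by (simp add: inj_eq)
    have K: "K (v + w) = K v + K w" "K (c *s v) = c *s K v" "K (fmul N s v w) = fmul M t (K v) (K w)"
       "K (funit N s) = funit M t" for v w c
      by (rule inj; simp add: JK J.add J.scale m u)+
    show ?thesis unfolding semisimple_at_def
      by (rule exI[of _ "h \<circ> K"])
         (use bij_imp_bij_inv[OF bij] in \<open>auto intro!: vector_linearI bij_comp h(2) simp: K_def[symmetric] K h.add h.scale h\<close>)
  qed
qed

lemma dense_second_coordinate_nonzero:
  assumes "open V" "s \<in> V"
  shows "\<exists>s'\<in>V. (s' :: complex ^ 2) $ 2 \<noteq> 0"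
proof (cases "s $ 2 = 0")
  case True
  obtain e where e: "e > 0" "ball s e \<subseteq> V" using assms open_contains_ball by blast
  have "norm (of_real (e / 2) *s (\<delta> 2 :: complex ^ 2)) < e"
    unfolding norm_smult_complex using e(1) by (simp add: norm_vec_def L2_set_def sum_2)
  then have "s + of_real (e / 2) *s \<delta> 2 \<in> V" using e(2) by (auto simp: dist_norm subset_iff)
  moreover have "(s + of_real (e / 2) *s \<delta> 2) $ 2 \<noteq> 0" using True e(1) by simp
  ultimately show ?thesis by blast
qed (use assms in blast)

lemma open_second_coordinate_nonzero: "open {t :: complex ^ 2. t $ 2 \<noteq> 0}"
  using open_nonzero[of "\<lambda>t. t $ 2" UNIV] by simp

lemma closure_second_coordinate_nonzero: "closure {t :: complex ^ 2. t $ 2 \<noteq> 0} = UNIV"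
  unfolding closure_iff_nhds_not_empty set_eq_iff using dense_second_coordinate_nonzero
  by (auto simp: closure_iff_nhds_not_empty) blast

text \<open>
  Isomorphisms of germs preserve the algebras on the tangent spaces, so semisimple points correspond;
  openness of the chart transports density statements.
\<close>

lemma germ_semisimple_points:
  fixes M :: "2 fmanifold"
  assumes "germ_iso M p (plane_F f) 0"
  obtains U \<phi> where "open U" "p \<in> U" "U \<subseteq> base M" "holo_on \<phi> U"
    "\<And>t. t \<in> U \<Longrightarrow> semisimple_at M t \<longleftrightarrow> f (\<phi> t) \<noteq> 0"
    "\<And>G. open G \<Longrightarrow> G \<subseteq> U \<Longrightarrow> open (\<phi> ` G)"
proof -
  obtain U V \<phi> \<psi> where *: "open U" "U \<subseteq> base M" "p \<in> U" "open V"
    "holo_on \<phi> U" "holo_on \<psi> V" "\<phi> ` U = V" "\<psi> ` V = U"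
    "\<And>t. t \<in> U \<Longrightarrow> \<psi> (\<phi> t) = t" "\<And>s. s \<in> V \<Longrightarrow> \<phi> (\<psi> s) = s"
    "\<And>t. t \<in> U \<Longrightarrow> jac \<phi> t (funit M t) = funit (plane_F f) (\<phi> t)"
    "\<And>t v w. t \<in> U \<Longrightarrow> jac \<phi> t (fmul M t v w) = fmul (plane_F f) (\<phi> t) (jac \<phi> t v) (jac \<phi> t w)"
    "\<And>t. t \<in> U \<Longrightarrow> bij (jac \<phi> t)"
    by (rule germ_isoE[OF assms]) (rule that)
  show ?thesis
  proof (rule that[OF *(1,3,2,5)])
    fix t assume t: "t \<in> U"
    show "semisimple_at M t \<longleftrightarrow> f (\<phi> t) \<noteq> 0"
      unfolding semisimple_plane_iff[symmetric]
      by (rule semisimple_transfer[OF jac_linear[OF *(5) t] *(13,11,12)[OF t]])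
  next
    fix G assume G: "open G" "G \<subseteq> U"
    have "continuous_on V \<psi>"
      by (meson continuous_at_imp_continuous_on has_derivative_continuous holo_on_has_derivative[OF *(6)])
    from continuous_open_preimage[OF this *(4) G(1)] have "open (V \<inter> \<psi> -` G)" .
    moreover have "V \<inter> \<psi> -` G = \<phi> ` G"
    proof
      show "V \<inter> \<psi> -` G \<subseteq> \<phi> ` G" using *(10) by force
      show "\<phi> ` G \<subseteq> V \<inter> \<psi> -` G" using G(2) *(7,9) by auto
    qed
    ultimately show "open (\<phi> ` G)" by simp
  qed
qed

lemma germ_nilpotent_not_semisimple:
  fixes M :: "2 fmanifold"
  assumes "germ_iso M p nilpotent_F 0"
  shows "\<exists>U. open U \<and> p \<in> U \<and> U \<subseteq> base M \<and> (\<forall>t\<in>U. \<not> semisimple_at M t)"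
  by (rule germ_semisimple_points[OF assms[unfolded nilpotent_F_def]]) blast

lemma germ_I2_dense_semisimple:
  fixes M :: "2 fmanifold"
  assumes "germ_iso M p (I2 m) 0"
  shows "\<exists>U. open U \<and> p \<in> U \<and> U \<subseteq> base M \<and> U \<subseteq> closure (interior {t \<in> base M. semisimple_at M t})"
proof -
  obtain U and \<phi> :: "complex ^ 2 \<Rightarrow> complex ^ 2" where U: "open U" "p \<in> U" "U \<subseteq> base M" and \<phi>: "holo_on \<phi> U"
    and ss: "\<And>t. t \<in> U \<Longrightarrow> semisimple_at M t \<longleftrightarrow> (\<phi> t $ 2) ^ (m - 2) \<noteq> 0"
    and op: "\<And>G. open G \<Longrightarrow> G \<subseteq> U \<Longrightarrow> open (\<phi> ` G)"
    by (rule germ_semisimple_points[OF assms[unfolded I2_def]]) (rule that)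
  define S where "S = {t \<in> U. \<phi> t $ 2 \<noteq> 0}"
  have "open S" unfolding S_def by (rule open_nonzero[OF holo_on_nth[OF \<phi>]])
  moreover have "S \<subseteq> {t \<in> base M. semisimple_at M t}" using ss U by (auto simp: S_def)
  ultimately have S: "S \<subseteq> interior {t \<in> base M. semisimple_at M t}" by (rule interior_maximal[rotated])
  have "U \<subseteq> closure S"
  proof
    fix t assume t: "t \<in> U"
    show "t \<in> closure S"
      unfolding closure_iff_nhds_not_empty
    proof (intro allI impI)
    fix A V assume V: "V \<subseteq> A" "open V" "t \<in> V"
    have "open (\<phi> ` (V \<inter> U))" using V U by (intro op) auto
    moreover have "\<phi> t \<in> \<phi> ` (V \<inter> U)" using V t by blast
    ultimately obtain s where s: "s \<in> \<phi> ` (V \<inter> U)" "s $ 2 \<noteq> 0"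
      using dense_second_coordinate_nonzero by meson
    then obtain t' where "t' \<in> V" "t' \<in> U" "\<phi> t' $ 2 \<noteq> 0" by auto
    then have "t' \<in> S \<inter> A" using V(1) by (auto simp: S_def)
    then show "S \<inter> A \<noteq> {}" by blast
    qed
  qed
  from order_trans[OF this closure_mono[OF S]] U show ?thesis by (intro exI[of _ U]) simp
qed

text \<open>
  The sets \<open>A\<close> of points with a neighbourhood without semisimple points and \<open>B\<close> of points with a
  neighbourhood in the closure of the open semisimple locus are open and disjoint, and by the local
  normal form they cover the connected base. Hence one of them is empty: if \<open>A\<close> is empty, \<open>M\<close> is massive,
  and if \<open>B\<close> is empty, it is not.
\<close>

theorem massive_germ_dichotomy:
  fixes M :: "2 fmanifold"
  assumes "F_germ M p"
  shows "massive M \<Longrightarrow> \<exists>m\<ge>2. germ_iso M p (I2 m) 0"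
    and "\<not> massive M \<Longrightarrow> germ_iso M p nilpotent_F 0"
proof -
  have M: "F_manifold M" and p: "p \<in> base M" using assms by (auto simp: F_germ_def)
  let ?S = "interior {t \<in> base M. semisimple_at M t}"
  define A where "A = {q \<in> base M. \<exists>U. open U \<and> q \<in> U \<and> U \<subseteq> base M \<and> (\<forall>t\<in>U. \<not> semisimple_at M t)}"
  define B where "B = {q \<in> base M. \<exists>U. open U \<and> q \<in> U \<and> U \<subseteq> base M \<and> U \<subseteq> closure ?S}"
  have inA: "q \<in> A" if "q \<in> base M" "germ_iso M q nilpotent_F 0" for q
    unfolding A_def using germ_nilpotent_not_semisimple[OF that(2)] that(1) by simp
  have inB: "q \<in> B" if "q \<in> base M" "germ_iso M q (I2 m) 0" for q m
    unfolding B_def using germ_I2_dense_semisimple[OF that(2)] that(1) by simp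
  have cover: "base M \<subseteq> A \<union> B"
    using local_normal_form[OF M] inA inB by blast
  have disj: "A \<inter> B = {}"
  proof (rule ccontr)
    assume "A \<inter> B \<noteq> {}"
    then obtain q U U' where "open U" "q \<in> U" "\<forall>t\<in>U. \<not> semisimple_at M t" "q \<in> U'" "U' \<subseteq> closure ?S"
      unfolding A_def B_def by blast
    then have "U \<inter> ?S \<noteq> {}" using open_Int_closure_eq_empty[of U ?S] by blast
    then show False using \<open>\<forall>t\<in>U. \<not> semisimple_at M t\<close> interior_subset by blast
  qed
  have "open A" "open B" unfolding A_def B_def by (subst open_subopen, blast)+
  then have AB: "A = {} \<or> B = {}"
    using connectedD[OF F_manifoldD(2)[OF M] \<open>open A\<close> \<open>open B\<close>] disj cover
    by (metis (no_types, lifting) A_def B_def Int_absorb2 inf_bot_left mem_Collect_eq subsetI)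
  have B: "massive M" if "A = {}"
    unfolding massive_def generically_def
  proof (intro exI conjI)
    show "?S \<subseteq> base M" "\<forall>t\<in>?S. semisimple_at M t" using interior_subset by blast+
    show "base M \<subseteq> closure ?S" using cover that unfolding B_def by blast
  qed simp
  have A: "\<not> massive M" if "B = {}"
  proof
    assume "massive M"
    then obtain W where W: "open W" "W \<subseteq> base M" "base M \<subseteq> closure W" "\<forall>t\<in>W. semisimple_at M t"
      unfolding massive_def generically_def by blast
    have "W \<noteq> {}" using W(3) p by auto
    then obtain t where "t \<in> W" by blast
    then show False using W cover that unfolding A_def by blast
  qed
  show "\<exists>m\<ge>2. germ_iso M p (I2 m) 0" if "massive M"
  proof -
    have "p \<notin> A" using A AB that by blast
    then show ?thesis using local_normal_form[OF M p] inA[OF p] by blast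
  qed
  show "germ_iso M p nilpotent_F 0" if "\<not> massive M"
  proof -
    have "p \<notin> B" using B AB that by blast
    then show ?thesis using local_normal_form[OF M p] inB[OF p] by blast
  qed
qed

section \<open>The germs of the two normal forms\<close>

lemma power_deriv: "((\<lambda>z. z ^ k) has_field_derivative of_nat k * z ^ (k - 1)) (at (z :: complex))"
  by (auto intro!: derivative_eq_intros)

lemma zero_deriv: "((\<lambda>z. 0) has_field_derivative 0) (at (z :: complex))"
  by simp

lemma generically_second_coordinate:
  "(\<And>t. (t :: complex ^ 2) $ 2 \<noteq> 0 \<Longrightarrow> P t) \<Longrightarrow> generically UNIV P"
  unfolding generically_def using open_second_coordinate_nonzero closure_second_coordinate_nonzero by blast

lemma F_germ_I2: "F_germ (I2 m) 0"
  unfolding F_germ_def I2_def using F_manifold_plane[OF power_deriv] by simp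

lemma massive_I2: "massive (I2 m)"
  unfolding massive_def I2_def plane_base semisimple_plane_iff
  by (rule generically_second_coordinate) simp

lemma caustic_I2:
  assumes "m \<ge> 3" shows "caustic (I2 m) = {t. t $ 2 = 0}"
proof -
  have part: "alg_partition (fmul (I2 m) t) = (if t $ 2 = 0 then {#2#} else {#1, 1#})" for t
    using alg_partition_semisimple[of "\<lambda>t. (t $ 2) ^ (m - 2)" t]
      alg_partition_nilpotent[of "\<lambda>t. (t $ 2) ^ (m - 2)" t] assms
    by (auto simp: I2_def)
  have "generic_partition (I2 m) = {#1, 1#}"
    by (rule generic_partition_eqI)
       (auto simp: I2_def[of m] part[unfolded I2_def] intro!: generically_second_coordinate)
  then show ?thesis by (auto simp: caustic_def part I2_def[of m]) (simp_all add: part[unfolded I2_def] split: if_splits)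
qed

lemma nilpotent_F_properties:
  "F_germ nilpotent_F 0" "\<not> massive nilpotent_F" "caustic nilpotent_F = {}"
proof -
  show "F_germ nilpotent_F 0"
    unfolding F_germ_def nilpotent_F_def using F_manifold_plane[OF zero_deriv] by simp
  show "\<not> massive nilpotent_F"
    unfolding massive_def nilpotent_F_def semisimple_plane_iff generically_def by auto
  have part: "alg_partition (fmul nilpotent_F t) = {#2#}" for t
    unfolding nilpotent_F_def by (rule alg_partition_nilpotent) simp
  have "generic_partition nilpotent_F = {#2#}"
    by (rule generic_partition_eqI)
       (simp_all add: part generically_def nilpotent_F_def[THEN arg_cong, of base] exI[of _ UNIV])
  then show "caustic nilpotent_F = {}" by (auto simp: caustic_def part)
qed

lemma discriminant_I2:
  assumes "m \<ge> 2"
  shows "discriminant (I2 m) (I2_euler m) = {t. (t $ 1) ^ 2 - 4 / (of_nat m) ^ 2 * (t $ 2) ^ m = 0}"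
proof -
  obtain k where k: "m = k + 2" using assms le_Suc_ex by (metis add.commute)
  have "det (matrix (fmul (I2 m) t (I2_euler m t))) = (t $ 1) ^ 2 - 4 / (of_nat m) ^ 2 * (t $ 2) ^ m" for t
    unfolding det_2 matrix_def I2_def k
    by (simp add: plane_fmul_nth I2_euler_def power2_eq_square power_add)
  then show ?thesis by (simp add: discriminant_def I2_def)
qed

text \<open>
  With \<open>E = t\<^sub>1 \<delta> 1 + b \<delta> 2\<close> and \<open>r\<^sup>2 = t\<^sub>2\<^sup>m\<^sup>-\<^sup>2\<close> the eigenvalues of \<open>E \<circ>\<close> are \<open>t\<^sub>1 \<plusminus> b r\<close>, and they coincide exactly where
  \<open>t\<^sub>2 = 0\<close>.
\<close>

lemma bifurcation_I2:
  assumes "m \<ge> 3" shows "bifurcation_diagram (I2 m) (I2_euler m) = {t. t $ 2 = 0}"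
proof -
  have "card {c. \<exists>v. v \<noteq> 0 \<and> fmul (I2 m) t (I2_euler m t) v = c *s v} < 2 \<longleftrightarrow> t $ 2 = 0" for t
  proof -
    define b where "b = 2 / of_nat m * t $ 2"
    define f where "f = (t $ 2) ^ (m - 2)"
    have mul: "fmul (I2 m) t (I2_euler m t) v = c *s v \<longleftrightarrow>
        t $ 1 * v $ 1 + b * v $ 2 * f = c * v $ 1 \<and> t $ 1 * v $ 2 + b * v $ 1 = c * v $ 2" for v c
      by (simp add: vec_eq_iff forall_2 I2_def plane_fmul_nth I2_euler_def b_def f_def)
    define r where "r = csqrt f"
    have r: "r * r = f" by (simp add: r_def power2_eq_square[symmetric])
    show ?thesis
    proof (cases "t $ 2 = 0")
      case True
      then have "b = 0" by (simp add: b_def)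
      have "{c. \<exists>v. v \<noteq> 0 \<and> fmul (I2 m) t (I2_euler m t) v = c *s v} \<subseteq> {t $ 1}"
        unfolding mul \<open>b = 0\<close> by (auto simp: vec_eq_iff forall_2)
      then have "card {c. \<exists>v. v \<noteq> 0 \<and> fmul (I2 m) t (I2_euler m t) v = c *s v} \<le> card {t $ 1}"
        by (intro card_mono) auto
      then show ?thesis using True by simp
    next
      case False
      then have nz: "b \<noteq> 0" "r \<noteq> 0" using assms r by (auto simp: b_def f_def)
      have "{c. \<exists>v. v \<noteq> 0 \<and> fmul (I2 m) t (I2_euler m t) v = c *s v} = {t $ 1 + b * r, t $ 1 - b * r}" (is "?L = ?R")
      proof
        have "\<exists>v. v \<noteq> 0 \<and> fmul (I2 m) t (I2_euler m t) v = (t $ 1 + b * s) *s v" if "s * s = f" for s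
          unfolding mul that[symmetric]
          by (rule exI[of _ "vector [s, 1]"]) (simp add: vec_eq_iff forall_2 algebra_simps)
        from this[of r] this[of "- r"] r show "?R \<subseteq> ?L" by auto
        show "?L \<subseteq> ?R"
        proof
          fix c assume "c \<in> ?L"
          then obtain v :: "complex ^ 2" where v: "v \<noteq> 0" and e1: "b * v $ 2 * f = (c - t $ 1) * v $ 1"
            and e2: "b * v $ 1 = (c - t $ 1) * v $ 2" unfolding mul by (auto simp: algebra_simps)
          have v2: "v $ 2 \<noteq> 0" using v e2 nz by (auto simp: vec_eq_iff forall_2)
          have "b * (b * v $ 2 * f) = (c - t $ 1) * (b * v $ 1)" unfolding e1 by simp
          then have "v $ 2 * (b * b * (r * r)) = v $ 2 * ((c - t $ 1) * (c - t $ 1))"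
            unfolding e2 r by (simp add: mult_ac)
          then have "(b * r) * (b * r) = (c - t $ 1) * (c - t $ 1)" using v2 by (simp add: mult_ac)
          then have "c - t $ 1 = b * r \<or> c - t $ 1 = - (b * r)"
            using square_eq_iff[of "c - t $ 1" "b * r"] by simp
          then show "c \<in> ?R" by (auto simp: algebra_simps)
        qed
      qed
      moreover have "t $ 1 + b * r \<noteq> t $ 1 - b * r" using nz by (simp add: eq_diff_eq)
      ultimately show ?thesis using False by simp
    qed
  qed
  then show ?thesis by (simp add: bifurcation_diagram_def I2_def)
qed

text \<open>
  A product germ has an idempotent other than zero and the unit in its tangent algebra, namely the
  unit of one factor. The algebra of \<open>I2 m\<close> at the origin has none, because \<open>\<delta> 2\<close> squares to zero
  there.
\<close>

lemma irreducible_I2: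
  assumes "m \<ge> 3" shows "irreducible_germ_2 (I2 m) 0"
  unfolding irreducible_germ_2_def
proof (rule notI, elim exE conjE)
  fix N1 :: "1 fmanifold" and q1 and N2 :: "1 fmanifold" and q2
  assume N: "F_germ N1 q1" "F_germ N2 q2" and iso: "germ_iso (I2 m) 0 (fprod N1 N2) (vjoin q1 q2)"
  have unit: "funit K q \<noteq> 0" if "F_germ K q" for K :: "1 fmanifold" and q
  proof
    assume u: "funit K q = 0"
    have K: "F_manifold K" "q \<in> base K" using that by (auto simp: F_germ_def)
    have "\<delta> 1 = (0 :: complex ^ 1)"
      using fmul_unit_left[OF K, of "\<delta> 1"] fmul_zero_left[OF K] u by simp
    then show False by (simp add: axis_eq_0_iff)
  qed
  obtain U V \<phi> \<psi> where *: "(0 :: complex ^ 2) \<in> U" "holo_on \<phi> U" "\<phi> 0 = vjoin q1 q2"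
    "\<And>t. t \<in> U \<Longrightarrow> jac \<phi> t (funit (I2 m) t) = funit (fprod N1 N2) (\<phi> t)"
    "\<And>t v w. t \<in> U \<Longrightarrow> jac \<phi> t (fmul (I2 m) t v w) = fmul (fprod N1 N2) (\<phi> t) (jac \<phi> t v) (jac \<phi> t w)"
    "\<And>t. t \<in> U \<Longrightarrow> bij (jac \<phi> t)"
    by (rule germ_isoE[OF iso]) (rule that)
  let ?J = "jac \<phi> 0" and ?mu = "fmul (I2 m) 0"
  have q: "vleft (\<phi> 0) = q1" "vright (\<phi> 0) = q2"
    unfolding *(3) by (simp_all add: vleft_def vright_def vjoin_def)
  have vl: "vleft (vjoin a b) = a" "vright (vjoin a b) = b" for a :: "complex ^ 1" and b :: "complex ^ 1"
    by (simp_all add: vleft_def vright_def vjoin_def)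
  define a where "a = vjoin (funit N1 q1) (0 :: complex ^ 1)"
  obtain x where x: "?J x = a" using bij_is_surj[OF *(6)[OF *(1)]] by (metis surjD)
  have N1: "F_manifold N1" "q1 \<in> base N1" and N2: "F_manifold N2" "q2 \<in> base N2"
    using N by (auto simp: F_germ_def)
  have "fmul (fprod N1 N2) (\<phi> 0) a a = a"
    by (simp add: fprod_def q a_def vl fmul_unit_left[OF N1] fmul_zero_left[OF N2])
  then have "?J (?mu x x) = ?J x" using *(5)[OF *(1), of x x] x by simp
  then have idem: "?mu x x = x" using bij_is_inj[OF *(6)[OF *(1)]] by (simp add: inj_eq)
  have c: "x $ 1 * x $ 1 = x $ 1" "2 * x $ 1 * x $ 2 = x $ 2"
    using idem assms by (simp_all add: vec_eq_iff forall_2 I2_def plane_fmul_nth power_0_left)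
  then have "x = 0 \<or> x = \<delta> 1" by (auto simp: vec_eq_iff forall_2)
  then show False
  proof
    assume "x = 0"
    then have "a = 0" using x jac_0[OF *(2,1)] by simp
    then have "vleft a = 0" by (simp add: vleft_def vec_eq_iff)
    then show False using unit[OF N(1)] by (simp add: a_def vl)
  next
    assume "x = \<delta> 1"
    then have "a = funit (fprod N1 N2) (\<phi> 0)" using x *(4)[OF *(1)] by (simp add: I2_def)
    then have "vright a = funit N2 q2" by (simp add: fprod_def q vl)
    then show False using unit[OF N(2)] by (simp add: a_def vl)
  qed
qed

section \<open>Euler fields\<close>

lemma plane_rebase [simp]: "(plane_F f)\<lparr>base := UNIV\<rparr> = plane_F f"
  by (simp add: plane_F_def)

lemma euler_germs_planeI:
  assumes g: "\<And>z. (g has_field_derivative g' z) (at z)"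
    and V: "open V" "0 \<in> V" and G: "euler_field ((plane_F (\<lambda>t. g (t $ 2)))\<lparr>base := V\<rparr>) d G"
    and eq: "\<forall>\<^sub>F t in nhds 0. X t = G t"
  shows "X \<in> euler_germs (plane_F (\<lambda>t. g (t $ 2))) 0 d"
proof -
  obtain S where S: "open S" "0 \<in> S" "\<And>t. t \<in> S \<Longrightarrow> X t = G t" using eq unfolding eventually_nhds by blast
  define U where "U = S \<inter> V"
  have U: "open U" "0 \<in> U" "U \<subseteq> V" "\<And>t. t \<in> U \<Longrightarrow> G t = X t" using S V by (auto simp: U_def)
  note G' = G[unfolded euler_field_plane_iff[OF g V(1)]]
  have "holo_on G U" by (rule holo_on_subset[OF _ U(1,3)]) (use G' in blast)
  then have "holo_on X U" by (rule holo_on_cong) (rule U(4))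
  moreover have "dif (\<lambda>s. X s $ i) t = dif (\<lambda>s. G s $ i) t" if "t \<in> U" for t i
    by (rule frechet_derivative_cong_open[OF U(1) that]) (simp add: U(4))
  moreover have "X t = G t" if "t \<in> U" for t using U(4)[OF that] by simp
  ultimately have "euler_field ((plane_F (\<lambda>t. g (t $ 2)))\<lparr>base := U\<rparr>) d X"
    unfolding euler_field_plane_iff[OF g U(1)] using G' U(3) by auto
  then show ?thesis unfolding euler_germs_def using U by auto
qed

lemma hol_dif_zero_constant:
  fixes f :: "complex ^ 2 \<Rightarrow> complex"
  assumes f: "hol f U" and B: "B \<subseteq> U" "convex B"
    and d: "\<And>t. t \<in> B \<Longrightarrow> dif f t (\<delta> 1) = 0" "\<And>t. t \<in> B \<Longrightarrow> dif f t (\<delta> 2) = 0"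
  shows "\<exists>c. \<forall>t\<in>B. f t = c"
proof (rule has_derivative_zero_constant[OF B(2)])
  fix t assume t: "t \<in> B"
  then have tU: "t \<in> U" using B by blast
  have "dif f t = (\<lambda>v. 0)" using hol_dif_expand_2[OF f tU] d[OF t] by (simp add: fun_eq_iff)
  with hol_has_derivative[OF f tU] show "(f has_derivative (\<lambda>v. 0)) (at t within B)"
    by (simp add: has_derivative_at_withinI)
qed

lemma dif_cmult_coord [simp]: "dif (\<lambda>s. c * s $ i) t v = c * v $ i"
  using dif_cmult[of "\<lambda>s. s $ i" UNIV t c v] by simp

lemma I2_euler_nth: "I2_euler m t $ 1 = t $ 1" "I2_euler m t $ 2 = 2 / of_nat m * t $ 2"
  by (simp_all add: I2_euler_def)

lemma euler_field_I2_multiple: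
  assumes m: "m \<ge> 2"
  shows "euler_field (I2 m) d (\<lambda>t. d *s I2_euler m t + c *s \<delta> 1)"
proof -
  obtain k where k: "m = k + 2" using m le_Suc_ex by (metis add.commute)
  let ?E = "\<lambda>t. d *s I2_euler m t + c *s \<delta> 1"
  define b where "b = d * (2 / of_nat m)"
  have E: "?E t $ 1 = d * t $ 1 + c" "?E t $ 2 = b * t $ 2" for t
    by (simp_all add: I2_euler_nth b_def)
  have h: "hol (\<lambda>t. d * t $ 1) UNIV" for d by (intro hol_cmult) simp
  have d1: "dif (\<lambda>t. d * t $ 1 + c) t v = d * v $ 1" for t v :: "complex ^ 2"
    using dif_add[OF h[of d], of "\<lambda>_. c" t v] by simp
  have "hol (\<lambda>t :: complex ^ 2. 2 * t $ 2 / of_nat m) UNIV"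
    using hol_cmult[of "\<lambda>t :: complex ^ 2. t $ 2" UNIV "2 / of_nat m"] by simp
  then have "hol (\<lambda>t. ?E t $ i) UNIV" for i
    using exhaust_2[of i] by (auto simp: I2_euler_nth intro!: hol_add hol_cmult)
  then have "holo_on ?E UNIV" by (intro holo_onI) auto
  moreover have "of_nat k * (t $ 2) ^ (k - 1) * (b * t $ 2) +
      2 * (t $ 2) ^ k * b = 2 * d * (t $ 2) ^ k" for t :: "complex ^ 2"
  proof -
    have "of_nat k * (t $ 2) ^ (k - 1) * (b * t $ 2) =
        b * (of_nat k * (t $ 2) ^ k)" by (cases k) auto
    then have "of_nat k * (t $ 2) ^ (k - 1) * (b * t $ 2) +
      2 * (t $ 2) ^ k * b = b * (of_nat m * (t $ 2) ^ k)"
      unfolding k by (simp add: algebra_simps)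
    then show ?thesis using m by (simp add: b_def)
  qed
  ultimately have "euler_field ((plane_F (\<lambda>t. (t $ 2) ^ k))\<lparr>base := UNIV\<rparr>) d ?E"
    unfolding euler_field_plane_iff[OF power_deriv open_UNIV] E d1 by simp
  then show ?thesis by (simp add: I2_def k)
qed

text \<open>
  The Euler equations make \<open>X\<^sub>1 - d t\<^sub>1\<close> constant. The difference \<open>y\<close> between \<open>X\<^sub>2\<close> and \<open>2 d t\<^sub>2 / m\<close> depends only on
  \<open>t\<^sub>2\<close> and solves \<open>k t\<^sub>2\<^sup>k\<^sup>-\<^sup>1 y + 2 t\<^sub>2\<^sup>k y' = 0\<close> with \<open>k = m - 2\<close>; then \<open>t\<^sub>2\<^sup>k y\<^sup>2\<close> has derivative zero and vanishes
  at the origin, so \<open>y = 0\<close> off the line \<open>t\<^sub>2 = 0\<close> and by continuity everywhere.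
\<close>

lemma euler_germs_I2:
  assumes m: "m \<ge> 3"
  shows "euler_germs (I2 m) 0 d =
    {X. \<exists>c. \<forall>\<^sub>F t in nhds 0. X t = d *s I2_euler m t + c *s funit (I2 m) t}"
proof (intro equalityI subsetI CollectI)
  obtain k where k: "m = k + 2" "k \<ge> 1"
    by (rule that[of "m - 2"]) (use m in auto)
  have I2k: "I2 m = plane_F (\<lambda>t. (t $ 2) ^ k)" by (simp add: I2_def k)
  {
    fix X assume "X \<in> {X. \<exists>c. \<forall>\<^sub>F t in nhds 0. X t = d *s I2_euler m t + c *s funit (I2 m) t}"
    then obtain c where c: "\<forall>\<^sub>F t in nhds 0. X t = d *s I2_euler m t + c *s \<delta> 1" by (auto simp: I2k)
    have "euler_field ((plane_F (\<lambda>t. (t $ 2) ^ k))\<lparr>base := UNIV\<rparr>) d (\<lambda>t. d *s I2_euler m t + c *s \<delta> 1)"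
      using euler_field_I2_multiple[of m d c] m by (simp add: I2k)
    then show "X \<in> euler_germs (I2 m) 0 d"
      unfolding I2k by (rule euler_germs_planeI[OF power_deriv open_UNIV UNIV_I _ c])
  }
  fix X assume "X \<in> euler_germs (I2 m) 0 d"
  then obtain U where U: "open U" "0 \<in> U" and EU: "euler_field ((plane_F (\<lambda>t. (t $ 2) ^ k))\<lparr>base := U\<rparr>) d X"
    unfolding euler_germs_def I2k by blast
  note E = EU[unfolded euler_field_plane_iff[OF power_deriv U(1)]]
  have X: "holo_on X U" using E by blast
  have d: "dif (\<lambda>s. X s $ 1) t (\<delta> 1) = d" "dif (\<lambda>s. X s $ 1) t (\<delta> 2) = 0" "dif (\<lambda>s. X s $ 2) t (\<delta> 1) = 0"
    "of_nat k * (t $ 2) ^ (k - 1) * X t $ 2 + 2 * (t $ 2) ^ k * dif (\<lambda>s. X s $ 2) t (\<delta> 2) = 2 * d * (t $ 2) ^ k"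
    if "t \<in> U" for t using E that by auto
  obtain r where r: "r > 0" "ball 0 r \<subseteq> U" using U open_contains_ball by blast
  have lin: "hol (\<lambda>t. a * t $ i) U" for a i by (intro hol_cmult) (simp add: U)
  define x where "x t = X t $ 1 - d * t $ 1" for t
  have x: "hol x U" unfolding x_def by (intro hol_diff holo_on_nth[OF X] lin)
  have dx: "dif x t v = dif (\<lambda>s. X s $ 1) t v - d * v $ 1" if "t \<in> U" for t v
    unfolding x_def dif_diff[OF holo_on_nth[OF X] lin that] by simp
  obtain c where c: "\<And>t. t \<in> ball 0 r \<Longrightarrow> x t = c"
    using hol_dif_zero_constant[OF x r(2) convex_ball] dx d r(2) by (auto simp: subset_iff)
  define b where "b = 2 / of_nat m * d"
  define y where "y t = X t $ 2 - b * t $ 2" for t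
  have y: "hol y U" unfolding y_def by (intro hol_diff holo_on_nth[OF X] lin)
  have dy: "dif y t v = dif (\<lambda>s. X s $ 2) t v - b * v $ 2" if "t \<in> U" for t v
    unfolding y_def dif_diff[OF holo_on_nth[OF X] lin that] by simp
  have ode: "of_nat k * (t $ 2) ^ (k - 1) * y t + 2 * (t $ 2) ^ k * dif y t (\<delta> 2) = 0" if t: "t \<in> U" for t
  proof -
    have "(t $ 2) ^ (k - 1) * t $ 2 = (t $ 2) ^ k" using k by (metis power_minus_mult zero_less_one less_le_trans)
    then have "of_nat k * (t $ 2) ^ (k - 1) * y t + 2 * (t $ 2) ^ k * dif y t (\<delta> 2) =
       2 * d * (t $ 2) ^ k - b * (of_nat m * (t $ 2) ^ k)"
      unfolding d(4)[OF t, symmetric] dy[OF t] y_def k by (simp add: algebra_simps)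
    also have "b * (of_nat m * (t $ 2) ^ k) = 2 * d * (t $ 2) ^ k" using m by (simp add: b_def)
    finally show ?thesis by simp
  qed
  define P where "P t = (t $ 2) ^ k * (y t * y t)" for t
  have pw: "hol (\<lambda>t. (t $ 2) ^ k) U" "dif (\<lambda>t. (t $ 2) ^ k) t v = of_nat k * (t $ 2) ^ (k - 1) * v $ 2"
    if "t \<in> U" for t v
    using hol_power[of "\<lambda>t. t $ 2" U k] dif_power[of "\<lambda>t. t $ 2" U t k v] U that by simp_all
  have pw1: "hol (\<lambda>t. (t $ 2) ^ k) U" using pw(1)[OF U(2)] .
  have P: "hol P U" unfolding P_def by (intro hol_mult pw1 y)
  have dP: "dif P t v = of_nat k * (t $ 2) ^ (k - 1) * v $ 2 * (y t * y t) + (t $ 2) ^ k * (2 * y t * dif y t v)"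
    if "t \<in> U" for t v
    unfolding P_def dif_mult[OF pw1 hol_mult[OF y y] that] dif_mult[OF y y that] pw(2)[OF that]
    by (simp add: algebra_simps)
  have "dif P t (\<delta> 1) = 0" if "t \<in> ball 0 r" for t
  proof -
    have "t \<in> U" using that r by blast
    then show ?thesis using dP dy d(3) by simp
  qed
  moreover have "dif P t (\<delta> 2) = 0" if "t \<in> ball 0 r" for t
  proof -
    have t: "t \<in> U" using that r by blast
    have "dif P t (\<delta> 2) = y t * (of_nat k * (t $ 2) ^ (k - 1) * y t + 2 * (t $ 2) ^ k * dif y t (\<delta> 2))"
      unfolding dP[OF t] by (simp add: algebra_simps)
    then show ?thesis unfolding ode[OF t] by simp
  qed
  ultimately obtain c' where "\<forall>t\<in>ball 0 r. P t = c'"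
    using hol_dif_zero_constant[OF P r(2) convex_ball] by blast
  moreover have "P 0 = 0" using k by (simp add: P_def)
  ultimately have P0: "P t = 0" if "t \<in> ball 0 r" for t using that r(1) by (metis centre_in_ball)
  have y0: "y t = 0" if t: "t \<in> ball 0 r" for t
  proof (rule ccontr)
    assume "y t \<noteq> 0"
    then have "t \<in> {t \<in> ball 0 r. y t \<noteq> 0}" using t by simp
    moreover have "open {t \<in> ball 0 r. y t \<noteq> 0}" by (rule open_nonzero[OF hol_subset[OF y open_ball r(2)]])
    ultimately obtain s where s: "s \<in> ball 0 r" "y s \<noteq> 0" "s $ 2 \<noteq> 0" using dense_second_coordinate_nonzero by blast
    then show False using P0[OF s(1)] by (simp add: P_def)
  qed
  have "X t = d *s I2_euler m t + c *s funit (I2 m) t" if "t \<in> ball 0 r" for t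
    using c[OF that] y0[OF that]
    by (simp add: vec_eq_iff forall_2 I2k I2_euler_nth x_def y_def b_def algebra_simps)
  then show "\<exists>c. \<forall>\<^sub>F t in nhds 0. X t = d *s I2_euler m t + c *s funit (I2 m) t"
    unfolding eventually_nhds using r(1) by (intro exI[of _ c] exI[of _ "ball 0 r"]) simp
qed

lemma euler_field_nilpotent: "euler_field nilpotent_F 1 (\<lambda>t. (t $ 1) *s \<delta> 1)"
proof -
  have "holo_on (\<lambda>t. (t $ 1) *s (\<delta> 1 :: complex ^ 2)) UNIV" by (intro holo_on_smult) auto
  then have "euler_field ((plane_F (\<lambda>t. 0))\<lparr>base := UNIV\<rparr>) 1 (\<lambda>t. (t $ 1) *s \<delta> 1)"
    unfolding euler_field_plane_iff[OF zero_deriv open_UNIV] by simp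
  then show ?thesis by (simp add: nilpotent_F_def)
qed

lemma euler_germs_nilpotent:
  "euler_germs nilpotent_F 0 0 =
       {X. \<exists>\<epsilon>\<^sub>1 \<epsilon>\<^sub>2. \<epsilon>\<^sub>2 analytic_on {0} \<and>
            (\<forall>\<^sub>F t in nhds 0. X t = \<epsilon>\<^sub>1 *s \<delta> 1 + \<epsilon>\<^sub>2 (t $ 2) *s \<delta> 2)}"
proof (intro equalityI subsetI CollectI)
  fix X :: "complex ^ 2 \<Rightarrow> complex ^ 2"
  assume "X \<in> {X. \<exists>\<epsilon>\<^sub>1 \<epsilon>\<^sub>2. \<epsilon>\<^sub>2 analytic_on {0} \<and>
            (\<forall>\<^sub>F t in nhds 0. X t = \<epsilon>\<^sub>1 *s \<delta> 1 + \<epsilon>\<^sub>2 (t $ 2) *s (\<delta> 2 :: complex ^ 2))}"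
  then obtain a h where h: "h analytic_on {0}" and X: "\<forall>\<^sub>F t in nhds 0. X t = a *s \<delta> 1 + h (t $ 2) *s \<delta> 2" by blast
  obtain S where S: "open S" "0 \<in> S" "h holomorphic_on S" using h unfolding analytic_at by blast
  define V where "V = {t :: complex ^ 2. t $ 2 \<in> S}"
  have "open ((\<lambda>t :: complex ^ 2. t $ 2) -` S)" by (intro open_vimage S continuous_intros)
  then have V: "open V" "0 \<in> V" using S by (auto simp: V_def vimage_def)
  let ?G = "\<lambda>t :: complex ^ 2. a *s \<delta> 1 + h (t $ 2) *s (\<delta> 2 :: complex ^ 2)"
  have c: "hol (\<lambda>t. t $ 2) V" by (simp add: V)
  have im: "(\<lambda>t. t $ 2) ` V \<subseteq> S" by (auto simp: V_def)
  have h2: "hol (\<lambda>t. h (t $ 2)) V" by (rule hol_compose_holomorphic(1)[OF c S(3,1) im])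
  have d2: "dif (\<lambda>t. h (t $ 2)) t v = deriv h (t $ 2) * v $ 2" if "t \<in> V" for t v
    using hol_compose_holomorphic(2)[OF c S(3,1) im that] by simp
  have G: "?G t $ 1 = a" "?G t $ 2 = h (t $ 2)" for t by simp_all
  have "holo_on ?G V" by (intro holo_on_add holo_on_smult h2) (auto simp: V)
  then have "euler_field ((plane_F (\<lambda>t. 0))\<lparr>base := V\<rparr>) 0 ?G"
    unfolding euler_field_plane_iff[OF zero_deriv V(1)] G using d2 by simp
  then show "X \<in> euler_germs nilpotent_F 0 0"
    unfolding nilpotent_F_def by (rule euler_germs_planeI[OF zero_deriv V _ X])
next
  fix X assume "X \<in> euler_germs nilpotent_F 0 0"
  then obtain U where U: "open U" "0 \<in> U" and EU: "euler_field ((plane_F (\<lambda>t. 0))\<lparr>base := U\<rparr>) 0 X"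
    unfolding euler_germs_def nilpotent_F_def by blast
  note E = EU[unfolded euler_field_plane_iff[OF zero_deriv U(1)]]
  have X: "holo_on X U" using E by blast
  have d: "dif (\<lambda>s. X s $ 1) t (\<delta> 1) = 0" "dif (\<lambda>s. X s $ 1) t (\<delta> 2) = 0" "dif (\<lambda>s. X s $ 2) t (\<delta> 1) = 0"
    if "t \<in> U" for t using E that by auto
  obtain r where r: "r > 0" "ball 0 r \<subseteq> U" using U open_contains_ball by blast
  obtain c where c: "\<And>t. t \<in> ball 0 r \<Longrightarrow> X t $ 1 = c"
    using hol_dif_zero_constant[OF holo_on_nth[OF X] r(2) convex_ball, of 1] d r(2) by (auto simp: subset_iff)
  have id: "holo_on (\<lambda>t. t) U" "jac (\<lambda>t. t) t = (\<lambda>v. v)" for t :: "complex ^ 2"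
    by (rule holo_onI) (simp_all add: U frechet_derivative_ident)
  obtain N \<rho> F where N: "open N" "0 \<in> N" "\<rho> > 0" "F holomorphic_on ball 0 \<rho>"
    and F: "\<And>t. t \<in> N \<Longrightarrow> t $ 2 \<in> ball 0 \<rho> \<and> X t $ 2 = F (t $ 2)"
    by (rule function_of_second_coordinate[OF id(1) refl U(2), of "\<lambda>_. \<delta> 1" "\<lambda>t. X t $ 2"])
       (auto simp: id d holo_on_nth[OF X])
  have "F analytic_on {0}" unfolding analytic_at using N(3,4) by (intro exI[of _ "ball 0 \<rho>"]) simp
  moreover have "\<forall>\<^sub>F t in nhds 0. X t = c *s \<delta> 1 + F (t $ 2) *s \<delta> 2"
    unfolding eventually_nhds
  proof (intro exI[of _ "N \<inter> ball 0 r"] conjI ballI)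
    fix t assume "t \<in> N \<inter> ball 0 r"
    then show "X t = c *s \<delta> 1 + F (t $ 2) *s \<delta> 2" using c F by (simp add: vec_eq_iff forall_2)
  qed (use N r in auto)
  ultimately show "\<exists>\<epsilon>\<^sub>1 \<epsilon>\<^sub>2. \<epsilon>\<^sub>2 analytic_on {0} \<and>
            (\<forall>\<^sub>F t in nhds 0. X t = \<epsilon>\<^sub>1 *s \<delta> 1 + \<epsilon>\<^sub>2 (t $ 2) *s \<delta> 2)" by blast
qed


section \<open>Classification of plane germs\<close>

theorem theorem12p1:
  shows
    "\<comment> \<open>a)\<close>
     (\<forall>(M :: 2 fmanifold) p. F_germ M p \<and> massive M \<longrightarrow> (\<exists>m\<ge>2. germ_iso M p (I2 m) 0)) \<and>
     (\<forall>m\<ge>2.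
        F_germ (I2 m) 0 \<and> massive (I2 m) \<and>
        euler_field (I2 m) 1 (I2_euler m) \<and>
        discriminant (I2 m) (I2_euler m) =
          {t. (t $ 1) ^ 2 - 4 / (of_nat m) ^ 2 * (t $ 2) ^ m = 0}) \<and>
     (\<forall>m\<ge>3.
        irreducible_germ_2 (I2 m) 0 \<and>
        caustic (I2 m) = {t. t $ 2 = 0} \<and>
        bifurcation_diagram (I2 m) (I2_euler m) = {t. t $ 2 = 0} \<and>
        (\<forall>d. euler_germs (I2 m) 0 d =
               {X. \<exists>c. \<forall>\<^sub>F t in nhds 0. X t = d *s I2_euler m t + c *s funit (I2 m) t})) \<and>
     \<comment> \<open>b)\<close>
     (\<forall>(M :: 2 fmanifold) p. F_germ M p \<and> \<not> massive M \<longrightarrow> germ_iso M p nilpotent_F 0) \<and>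
     F_germ nilpotent_F 0 \<and> \<not> massive nilpotent_F \<and>
     caustic nilpotent_F = {} \<and>
     euler_field nilpotent_F 1 (\<lambda>t. (t $ 1) *s \<delta> 1) \<and>
     euler_germs nilpotent_F 0 0 =
       {X. \<exists>\<epsilon>\<^sub>1 \<epsilon>\<^sub>2. \<epsilon>\<^sub>2 analytic_on {0} \<and>
            (\<forall>\<^sub>F t in nhds 0. X t = \<epsilon>\<^sub>1 *s \<delta> 1 + \<epsilon>\<^sub>2 (t $ 2) *s \<delta> 2)}"
proof (intro conjI allI impI)
  fix M :: "2 fmanifold" and p
  show "\<exists>m\<ge>2. germ_iso M p (I2 m) 0" if "F_germ M p \<and> massive M"
    using massive_germ_dichotomy(1) that by blast
  show "germ_iso M p nilpotent_F 0" if "F_germ M p \<and> \<not> massive M"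
    using massive_germ_dichotomy(2) that by blast
next
  fix m :: nat assume m: "m \<ge> 2"
  show "F_germ (I2 m) 0" "massive (I2 m)" by (rule F_germ_I2 massive_I2)+
  show "euler_field (I2 m) 1 (I2_euler m)" using euler_field_I2_multiple[OF m, of 1 0] by simp
  show "discriminant (I2 m) (I2_euler m) =
      {t. (t $ 1) ^ 2 - 4 / (of_nat m) ^ 2 * (t $ 2) ^ m = 0}" by (rule discriminant_I2[OF m])
next
  fix m :: nat and d assume m: "m \<ge> 3"
  show "irreducible_germ_2 (I2 m) 0" by (rule irreducible_I2[OF m])
  show "caustic (I2 m) = {t. t $ 2 = 0}" by (rule caustic_I2[OF m])
  show "bifurcation_diagram (I2 m) (I2_euler m) = {t. t $ 2 = 0}" by (rule bifurcation_I2[OF m])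
  show "euler_germs (I2 m) 0 d =
      {X. \<exists>c. \<forall>\<^sub>F t in nhds 0. X t = d *s I2_euler m t + c *s funit (I2 m) t}"
    by (rule euler_germs_I2[OF m])
qed (rule nilpotent_F_properties euler_field_nilpotent euler_germs_nilpotent)+

end
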